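(* Let $n\ge 1$ and let $\mathcal{T}_{\mathrm{Sym}_n}(\mathbb{R})$ be the real locus of the Coxeter toric variety attached to the root system of type $A_{n-1}$. Its Euler characteristic is $$ \chi(\mathcal{T}_{\mathrm{Sym}_n}(\mathbb{R}))=\begin{cases} 0,&\text{if $n$ is even,}\\ (-1)^{\frac{n-1}{2}}E_n,&\text{if $n$ is odd,} \end{cases} $$ where, for $n$ odd, $E_n$ is the Euler number, i.e. the coefficient of $\frac{x^n}{n!}$ in the Taylor series of $\tan(x)$ at $0$.
   Context: $\Phi$ is a crystallographic root system spanning a Euclidean space $V$ with inner product $\langle\cdot,\cdot\rangle$, with Weyl group $W$. The weight lattice is $N=\{\omega\in V\mid\langle\omega,\alpha\rangle\in\mathbb{Z}\ \text{for all }\alpha\in\Phi\}$. In type $A_{n-1}$, $W\cong\mathrm{Sym}_n$ and $N$ may be identified with $\mathbb{Z}^n/\mathbb{Z}(1,1,\ldots,1)$, where $\mathrm{Sym}_n$ permutes coordinates. $\mathcal{T}_W$ is the complex toric variety attached to the lattice $N$ and the complete fan in $V=N\otimes_{\mathbb{Z}}\mathbb{R}$ consisting of the rational convex polyhedral cones into which the reflecting hyperplanes of $W$ divide $V$ (the closed Weyl chambers and all their faces). It is a nonsingular projective variety with its standard real structure (as a toric variety it is defined over $\mathbb{Z}$), and $\mathcal{T}_W(\mathbb{R})$ is the set of fixed points of complex conjugation on $\mathcal{T}_W$, with its usual topology. For $W=\mathrm{Sym}_n$ one writes $\mathcal{T}_{\mathrm{Sym}_n}$. $\chi$ denotes the Euler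 characteristic (alternating sum of dimensions of the rational cohomology spaces). *)

theory Defs
  imports "HOL-Analysis.Analysis" "HOL-Homology.Homology"
begin

section \<open>Quotient topologies\<close>

definition quotient_topology :: "'a topology \<Rightarrow> ('a \<times> 'a) set \<Rightarrow> 'a set topology" where
  "quotient_topology X r =
    topology (\<lambda>U. U \<subseteq> topspace X // r \<and> openin X {x \<in> topspace X. r `` {x} \<in> U})"

lemma openin_quotient_topology:
  "openin (quotient_topology X r) U \<longleftrightarrow>
    U \<subseteq> topspace X // r \<and> openin X {x \<in> topspace X. r `` {x} \<in> U}"
proof -
  have inter: "{x \<in> topspace X. r `` {x} \<in> S \<inter> T} =
      {x \<in> topspace X. r `` {x} \<in> S} \<inter> {x \<in> topspace X. r `` {x} \<in> T}" for S T
    by auto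
  have union: "{x \<in> topspace X. r `` {x} \<in> \<Union>K} =
      (\<Union>S\<in>K. {x \<in> topspace X. r `` {x} \<in> S})" for K
    by auto
  have "istopology (\<lambda>U. U \<subseteq> topspace X // r \<and> openin X {x \<in> topspace X. r `` {x} \<in> U})"
    unfolding istopology_def inter union by (blast intro: openin_Int openin_Union)
  then show ?thesis
    by (simp add: quotient_topology_def)
qed

lemma topspace_quotient_topology: "topspace (quotient_topology X r) = topspace X // r"
proof -
  have "{x \<in> topspace X. r `` {x} \<in> topspace X // r} = topspace X"
    by (auto intro: quotientI)
  then have "openin (quotient_topology X r) (topspace X // r)"
    by (simp add: openin_quotient_topology)
  then show ?thesis
    by (metis openin_quotient_topology openin_subset openin_topspace subset_antisym)
qed


section \<open>The complex toric variety of a lattice and a fan\<close>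

text \<open>The inner product identifies the dual of the real space spanned by \<open>N\<close> with that space.\<close>

definition dual_lattice :: "'a::euclidean_space set \<Rightarrow> 'a set" where
  "dual_lattice N = {m \<in> span N. \<forall>v\<in>N. m \<bullet> v \<in> \<int>}"

definition dual_monoid :: "'a::euclidean_space set \<Rightarrow> 'a set \<Rightarrow> 'a set" where
  "dual_monoid N \<sigma> = {m \<in> dual_lattice N. \<forall>v\<in>\<sigma>. 0 \<le> m \<bullet> v}"

text \<open>
  The complex points of the affine chart of \<open>\<sigma>\<close>, i.e. of the spectrum of the monoid algebra of
  \<open>dual_monoid N \<sigma>\<close>, are the monoid homomorphisms into the multiplicative monoid of the complex
  numbers. The monoid is finitely generated for a rational polyhedral cone \<open>\<sigma>\<close>, so that the
  topology of pointwise convergence is the usual (Euclidean) topology of the chart.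
\<close>

definition affine_toric :: "'a::euclidean_space set \<Rightarrow> 'a set \<Rightarrow> ('a \<Rightarrow> complex) topology" where
  "affine_toric N \<sigma> =
    subtopology (product_topology (\<lambda>_. euclidean) (dual_monoid N \<sigma>))
      {x. x 0 = 1 \<and> (\<forall>m\<in>dual_monoid N \<sigma>. \<forall>m'\<in>dual_monoid N \<sigma>. x (m + m') = x m * x m')}"

text \<open>
  The charts of \<open>\<sigma>\<close> and \<open>\<tau>\<close> are glued along the chart of \<open>\<sigma> \<inter> \<tau>\<close>, which embeds into both by
  restriction of homomorphisms.
\<close>

definition toric_gluing :: "'a::euclidean_space set \<Rightarrow> 'a set set \<Rightarrow>
    (('a set \<times> ('a \<Rightarrow> complex)) \<times> ('a set \<times> ('a \<Rightarrow> complex))) set" where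
  "toric_gluing N F =
    {((\<sigma>, x), (\<tau>, y)). \<sigma> \<in> F \<and> \<tau> \<in> F \<and>
      (\<exists>z \<in> topspace (affine_toric N (\<sigma> \<inter> \<tau>)).
        x = restrict z (dual_monoid N \<sigma>) \<and> y = restrict z (dual_monoid N \<tau>))}"

definition toric_variety :: "'a::euclidean_space set \<Rightarrow> 'a set set \<Rightarrow>
    ('a set \<times> ('a \<Rightarrow> complex)) set topology" where
  "toric_variety N F = quotient_topology (sum_topology (affine_toric N) F) (toric_gluing N F)"

definition toric_conj :: "'a::euclidean_space set \<Rightarrow>
    ('a set \<times> ('a \<Rightarrow> complex)) set \<Rightarrow> ('a set \<times> ('a \<Rightarrow> complex)) set" where
  "toric_conj N P = (\<lambda>(\<sigma>, x). (\<sigma>, restrict (cnj \<circ> x) (dual_monoid N \<sigma>))) ` P"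

definition toric_real_locus :: "'a::euclidean_space set \<Rightarrow> 'a set set \<Rightarrow>
    ('a set \<times> ('a \<Rightarrow> complex)) set topology" where
  "toric_real_locus N F = subtopology (toric_variety N F) {P. toric_conj N P = P}"


section \<open>Coxeter toric varieties\<close>

text \<open>
  For a root system \<open>\<Phi>\<close>, the space spanned by \<open>\<Phi>\<close> may be a proper subspace of the ambient type.
\<close>

definition weight_lattice :: "'a::euclidean_space set \<Rightarrow> 'a set" where
  "weight_lattice \<Phi> = {\<omega> \<in> span \<Phi>. \<forall>\<alpha>\<in>\<Phi>. \<omega> \<bullet> \<alpha> \<in> \<int>}"

definition open_weyl_chambers :: "'a::euclidean_space set \<Rightarrow> 'a set set" where
  "open_weyl_chambers \<Phi> = components (span \<Phi> - (\<Union>\<alpha>\<in>\<Phi>. {v. \<alpha> \<bullet> v = 0}))"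

text \<open>The empty set counts as a face for \<open>face_of\<close>, but it is not a cone.\<close>

definition coxeter_fan :: "'a::euclidean_space set \<Rightarrow> 'a set set" where
  "coxeter_fan \<Phi> = {\<sigma>. \<sigma> \<noteq> {} \<and> (\<exists>C \<in> open_weyl_chambers \<Phi>. \<sigma> face_of closure C)}"

definition coxeter_toric_real_locus :: "'a::euclidean_space set \<Rightarrow>
    ('a set \<times> ('a \<Rightarrow> complex)) set topology" where
  "coxeter_toric_real_locus \<Phi> = toric_real_locus (weight_lattice \<Phi>) (coxeter_fan \<Phi>)"

text \<open>The root system of type \<open>A\<close> and rank \<open>CARD('n) - 1\<close>, with Weyl group the symmetric group on \<open>'n\<close>.\<close>

definition type_A_roots :: "(real ^ 'n) set" where
  "type_A_roots = {axis i 1 - axis j 1 | i j. i \<noteq> j}"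


section \<open>Rational singular cohomology and the Euler characteristic\<close>

definition rat_cochains :: "nat \<Rightarrow> 'a topology \<Rightarrow> (((nat \<Rightarrow> real) \<Rightarrow> 'a) \<Rightarrow> rat) set" where
  "rat_cochains p X = {f. \<forall>s. \<not> singular_simplex p X s \<longrightarrow> f s = 0}"

definition coboundary :: "nat \<Rightarrow> 'a topology \<Rightarrow> (((nat \<Rightarrow> real) \<Rightarrow> 'a) \<Rightarrow> rat) \<Rightarrow>
    (((nat \<Rightarrow> real) \<Rightarrow> 'a) \<Rightarrow> rat)" where
  "coboundary p X f =
    (\<lambda>s. if singular_simplex (Suc p) X s
         then \<Sum>k\<le>Suc p. (-1) ^ k * f (singular_face (Suc p) k s) else 0)"

definition rat_cocycles :: "nat \<Rightarrow> 'a topology \<Rightarrow> (((nat \<Rightarrow> real) \<Rightarrow> 'a) \<Rightarrow> rat) set" where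
  "rat_cocycles p X = {f \<in> rat_cochains p X. coboundary p X f = (\<lambda>_. 0)}"

definition rat_coboundaries :: "nat \<Rightarrow> 'a topology \<Rightarrow> (((nat \<Rightarrow> real) \<Rightarrow> 'a) \<Rightarrow> rat) set" where
  "rat_coboundaries p X =
    (case p of 0 \<Rightarrow> {\<lambda>_. 0} | Suc q \<Rightarrow> coboundary q X ` rat_cochains q X)"

text \<open>
  \<open>S\<close> is a finite set of cocycles whose classes are pairwise distinct and form a basis of the
  rational vector space of \<open>p\<close>-cocycles modulo \<open>p\<close>-coboundaries.
\<close>

definition cohomology_basis :: "nat \<Rightarrow> 'a topology \<Rightarrow> (((nat \<Rightarrow> real) \<Rightarrow> 'a) \<Rightarrow> rat) set \<Rightarrow> bool" where
  "cohomology_basis p X S \<longleftrightarrow>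
    finite S \<and> S \<subseteq> rat_cocycles p X \<and>
    (\<forall>c. (\<lambda>s. \<Sum>g\<in>S. c g * g s) \<in> rat_coboundaries p X \<longrightarrow> (\<forall>g\<in>S. c g = 0)) \<and>
    (\<forall>f\<in>rat_cocycles p X. \<exists>c. (\<lambda>s. f s - (\<Sum>g\<in>S. c g * g s)) \<in> rat_coboundaries p X)"

definition betti :: "nat \<Rightarrow> 'a topology \<Rightarrow> nat" where
  "betti p X = (THE d. \<exists>S. cohomology_basis p X S \<and> card S = d)"

definition finite_total_cohomology :: "'a topology \<Rightarrow> bool" where
  "finite_total_cohomology X \<longleftrightarrow>
    (\<forall>p. \<exists>S. cohomology_basis p X S) \<and> finite {p. betti p X \<noteq> 0}"

text \<open>Meaningful only under \<open>finite_total_cohomology\<close>.\<close>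

definition euler_characteristic :: "'a topology \<Rightarrow> int" where
  "euler_characteristic X = (\<Sum>p | betti p X \<noteq> 0. (-1) ^ p * int (betti p X))"


section \<open>Euler numbers\<close>

text \<open>The coefficient of \<open>x ^ n / n!\<close> in the Taylor series of \<open>tan\<close> at \<open>0\<close>.\<close>

definition euler_number :: "nat \<Rightarrow> real" where
  "euler_number n = (deriv ^^ n) tan 0"

end

theory Submission
  imports Defs "HOL-Library.Function_Algebras"
begin

text \<open>
  The cones of the Coxeter fan correspond to the flags \<open>c\<close> of proper nonempty subsets of the index set. The real
  points of the affine chart of \<open>c\<close> fall into \<open>2 ^ (n - 1 - card c)\<close> contractible open pieces, one for each sign
  pattern on the torus of units. The charts form an open cover that is closed under intersections, so
  Mayer--Vietoris gives \<open>\<chi> = (\<Sum>c. (-1) ^ card c * 2 ^ (n - 1 - card c))\<close>. Splitting off the largest member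
  of a flag turns this sum into the recurrence of the Taylor coefficients of \<open>tanh\<close>. Mayer--Vietoris is used for
  ranks of integral homology, which agree with the dimensions of rational cohomology by duality.
\<close>

section \<open>The rank of an abelian group\<close>

text \<open>The integral homology of the real locus can have torsion: for \<open>n = 3\<close> the
  locus is a closed nonorientable surface. A rank defined by families without integer relations
  ignores torsion and is additive along exact sequences, which is all that an alternating sum needs.
  The Mayer--Vietoris step thus reduces to excision and the long exact sequences of two pairs. The
  passage to rational cohomology works because the rationals form an injective group. The points of
  the variety are gluing classes. That the gluing is transitive and that the charts embed as open
  sets both rest on the smoothness of the fan: the ray generators of a cone have a dual family of
  integral vectors, so the chart of a face arises by inverting a single element of the monoid. The
  weights of the flags come from inverting \<open>2 ^ (r - card c)\<close>, the number of pieces of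
  a chart, over the faces of a cone.\<close>

definition (in comm_group) indep_family :: "('i \<Rightarrow> 'a) \<Rightarrow> 'i set \<Rightarrow> bool" where
  "indep_family u I \<longleftrightarrow> finite I \<and> u \<in> I \<rightarrow> carrier G \<and>
    (\<forall>n::'i \<Rightarrow> int. finprod G (\<lambda>i. u i [^] n i) I = \<one> \<longrightarrow> (\<forall>i\<in>I. n i = 0))"

text \<open>The supremum runs over families with values in a subset \<open>S\<close>, so that
  kernels and images are measured inside the ambient group instead of being made into groups. Values
  in \<open>enat\<close> allow it to be used before any finiteness is known.\<close>

definition ab_rank :: "('a, 'm) monoid_scheme \<Rightarrow> 'a set \<Rightarrow> enat" where
  "ab_rank G S = (SUP I\<in>{I::nat set. \<exists>u\<in>I \<rightarrow> S. comm_group.indep_family G u I}. enat (card I))"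

context comm_group
begin

lemma finprod_int_pow_add:
  assumes "u \<in> I \<rightarrow> carrier G"
  shows "finprod G (\<lambda>i. u i [^] (m i + n i :: int)) I =
    finprod G (\<lambda>i. u i [^] m i) I \<otimes> finprod G (\<lambda>i. u i [^] n i) I"
proof -
  have "finprod G (\<lambda>i. u i [^] (m i + n i)) I = finprod G (\<lambda>i. u i [^] m i \<otimes> u i [^] n i) I"
    using assms by (intro finprod_cong') (auto simp: int_pow_mult Pi_iff)
  also have "\<dots> = finprod G (\<lambda>i. u i [^] m i) I \<otimes> finprod G (\<lambda>i. u i [^] n i) I"
    using assms by (intro finprod_multf) (auto simp: Pi_iff)
  finally show ?thesis .
qed

lemma finprod_int_pow_mult:
  assumes "u \<in> I \<rightarrow> carrier G"
  shows "finprod G (\<lambda>i. u i [^] (n i * k :: int)) I = finprod G (\<lambda>i. u i [^] n i) I [^] k"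
proof (cases "finite I")
  case True
  then show ?thesis using assms
  proof (induction I)
    case (insert x I)
    have "finprod G (\<lambda>i. u i [^] (n i * k)) (insert x I) =
      u x [^] (n x * k) \<otimes> finprod G (\<lambda>i. u i [^] (n i * k)) I"
      using insert by (intro finprod_insert) auto
    moreover have "finprod G (\<lambda>i. u i [^] n i) (insert x I) =
      u x [^] n x \<otimes> finprod G (\<lambda>i. u i [^] n i) I"
      using insert by (intro finprod_insert) auto
    ultimately show ?case
      using insert by (simp add: int_pow_distrib int_pow_pow Pi_iff)
  qed simp
qed simp

lemma finprod_finprod_int_pow:
  assumes "u \<in> I \<rightarrow> carrier G" "finite J"
  shows "finprod G (\<lambda>j. finprod G (\<lambda>i. u i [^] (n j i)) I [^] (m j :: int)) J =
    finprod G (\<lambda>i. u i [^] (\<Sum>j\<in>J. n j i * m j)) I"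
  using \<open>finite J\<close>
proof (induction J)
  case empty
  have "finprod G (\<lambda>i. u i [^] (0::int)) I = \<one>"
    by (intro finprod_one_eqI) auto
  then show ?case by simp
next
  case (insert x J)
  have c: "finprod G (\<lambda>i. u i [^] (k i :: int)) I \<in> carrier G" for k
    using assms by (intro finprod_closed) auto
  have "finprod G (\<lambda>j. finprod G (\<lambda>i. u i [^] (n j i)) I [^] m j) (insert x J) =
     finprod G (\<lambda>i. u i [^] (n x i)) I [^] m x \<otimes>
     finprod G (\<lambda>j. finprod G (\<lambda>i. u i [^] (n j i)) I [^] m j) J"
    using insert c by (intro finprod_insert) auto
  also have "\<dots> = finprod G (\<lambda>i. u i [^] (n x i * m x)) I \<otimes>
      finprod G (\<lambda>i. u i [^] (\<Sum>j\<in>J. n j i * m j)) I"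
    using insert assms by (simp add: finprod_int_pow_mult)
  also have "\<dots> = finprod G (\<lambda>i. u i [^] (n x i * m x + (\<Sum>j\<in>J. n j i * m j))) I"
    using assms by (simp add: finprod_int_pow_add)
  finally show ?case using insert by simp
qed

lemma finprod_int_pow_neutral:
  assumes "u \<in> I \<rightarrow> carrier G" "finite I" "T \<subseteq> I" "\<And>i. i \<in> I - T \<Longrightarrow> n i = (0::int)"
  shows "finprod G (\<lambda>i. u i [^] n i) I = finprod G (\<lambda>i. u i [^] n i) T"
  using assms by (intro finprod_mono_neutral_cong_right) auto

lemma indep_family_subset:
  fixes u :: "'i \<Rightarrow> 'a"
  assumes "indep_family u I" "T \<subseteq> I"
  shows "indep_family u T"
  unfolding indep_family_def
proof (intro conjI allI impI)
  have I: "finite I" "u \<in> I \<rightarrow> carrier G" using assms by (auto simp: indep_family_def)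
  show "finite T" using I assms finite_subset by blast
  show "u \<in> T \<rightarrow> carrier G" using I assms by auto
  fix n :: "'i \<Rightarrow> int"
  assume 1: "finprod G (\<lambda>i. u i [^] n i) T = \<one>"
  define n' where "n' i = (if i \<in> T then n i else 0)" for i
  have "finprod G (\<lambda>i. u i [^] n' i) I = finprod G (\<lambda>i. u i [^] n' i) T"
    using I assms by (intro finprod_int_pow_neutral) (auto simp: n'_def)
  also have "\<dots> = finprod G (\<lambda>i. u i [^] n i) T"
    using I assms by (intro finprod_cong') (auto simp: n'_def)
  finally have "\<forall>i\<in>I. n' i = 0" using 1 assms by (auto simp: indep_family_def)
  then show "\<forall>i\<in>T. n i = 0" using assms(2) by (auto simp: n'_def subset_iff split: if_splits)
qed

lemma indep_familyD:
  assumes "indep_family u I" "finprod G (\<lambda>i. u i [^] (n i :: int)) I = \<one>" "i \<in> I"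
  shows "n i = 0"
  using assms by (auto simp: indep_family_def)

lemma indep_family_empty: "indep_family u {}"
  by (auto simp: indep_family_def)

text \<open>\<open>ab_rank\<close> sees only index sets of natural numbers. An enumeration of
  \<open>I\<close> admits other index types, such as the option and sum types used below.\<close>

lemma card_le_ab_rank:
  fixes u :: "'i \<Rightarrow> 'a"
  assumes "indep_family u I" "u \<in> I \<rightarrow> S"
  shows "enat (card I) \<le> ab_rank G S"
proof -
  have I: "finite I" "u \<in> I \<rightarrow> carrier G" using assms by (auto simp: indep_family_def)
  obtain h where h: "bij_betw h {..<card I} I"
    using \<open>finite I\<close> bij_betw_from_nat_into_finite by blast
  have inj: "inj_on h {..<card I}" and img: "h ` {..<card I} = I"
    using h by (auto simp: bij_betw_def)
  have uh: "u (h x) \<in> carrier G" if "x < card I" for x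
    using that I(2) img by (metis Pi_mem imageI lessThan_iff)
  have "indep_family (u \<circ> h) {..<card I}"
    unfolding indep_family_def
  proof (intro conjI allI impI)
    show "u \<circ> h \<in> {..<card I} \<rightarrow> carrier G" using uh by auto
    fix n :: "nat \<Rightarrow> int"
    assume 1: "(\<Otimes>i\<in>{..<card I}. (u \<circ> h) i [^] n i) = \<one>"
    define n' where "n' = n \<circ> the_inv_into {..<card I} h"
    have "finprod G (\<lambda>i. u i [^] n' i) (h ` {..<card I}) =
      finprod G (\<lambda>i. u (h i) [^] n' (h i)) {..<card I}"
      using uh inj by (intro finprod_reindex) (auto simp: Pi_iff)
    also have "\<dots> = (\<Otimes>i\<in>{..<card I}. (u \<circ> h) i [^] n i)"
      using uh inj by (intro finprod_cong') (auto simp: n'_def the_inv_into_f_f Pi_iff)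
    finally have "\<forall>i\<in>I. n' i = 0" using 1 assms img by (auto simp: indep_family_def)
    then show "\<forall>i\<in>{..<card I}. n i = 0"
      using inj img by (metis comp_apply imageI n'_def the_inv_into_f_f)
  qed auto
  moreover have "u \<circ> h \<in> {..<card I} \<rightarrow> S" using assms img by (auto simp: Pi_iff)
  ultimately have "enat (card {..<card I}) \<le> ab_rank G S"
    unfolding ab_rank_def by (intro SUP_upper) blast
  then show ?thesis by simp
qed

lemma ab_rank_leI:
  assumes "\<And>(u::nat \<Rightarrow> 'a) I. indep_family u I \<Longrightarrow> u \<in> I \<rightarrow> S \<Longrightarrow> enat (card I) \<le> d"
  shows "ab_rank G S \<le> d"
  unfolding ab_rank_def using assms by (intro SUP_least) blast

lemma ab_rank_mono: "S \<subseteq> T \<Longrightarrow> ab_rank G S \<le> ab_rank G T"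
  by (rule ab_rank_leI, rule card_le_ab_rank) auto

text \<open>A finite supremum bounds the cardinalities, so only finitely many occur and the supremum
  is a maximum.\<close>

lemma ab_rank_attained:
  assumes "ab_rank G S = enat d"
  obtains u :: "nat \<Rightarrow> 'a" and I where "indep_family u I" "u \<in> I \<rightarrow> S" "card I = d"
proof -
  let ?A = "(\<lambda>I. enat (card I)) ` {I::nat set. \<exists>u\<in>I \<rightarrow> S. indep_family u I}"
  have ne: "?A \<noteq> {}" using indep_family_empty by blast
  have "Sup ?A = enat d" using assms unfolding ab_rank_def by blast
  moreover have "finite ?A"
  proof (rule finite_subset)
    show "?A \<subseteq> enat ` {..d}"
    proof
      fix x assume x: "x \<in> ?A"
      then have "x \<le> enat d" using \<open>Sup ?A = enat d\<close> Sup_upper[OF x] by simp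
      then show "x \<in> enat ` {..d}" using x by auto
    qed
  qed auto
  ultimately have "enat d \<in> ?A"
    using ne Max_in[of ?A] unfolding Sup_enat_def by presburger
  then show ?thesis using that by auto
qed

text \<open>Adjoining \<open>b\<close> at the index \<open>None\<close> exceeds the rank and forces
  a relation, whose exponent at \<open>b\<close> is nonzero because \<open>u\<close> is independent.
  Only a power of \<open>b\<close> is obtained: torsion and finite index are invisible to the
  rank.\<close>

lemma indep_family_maximal:
  fixes u :: "'i \<Rightarrow> 'a"
  assumes u: "indep_family u I" and b: "b \<in> S" "S \<subseteq> carrier G" "u \<in> I \<rightarrow> S"
    and rank: "ab_rank G S \<le> enat (card I)"
  obtains k :: int and n :: "'i \<Rightarrow> int" where "k \<noteq> 0" "b [^] k = finprod G (\<lambda>i. u i [^] n i) I"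
proof -
  have I: "finite I" "u \<in> I \<rightarrow> carrier G" using assms by (auto simp: indep_family_def)
  define w where "w = case_option b u"
  have fin: "finite (insert None (Some ` I))" using I by auto
  have "\<not> indep_family w (insert None (Some ` I))"
  proof
    assume "indep_family w (insert None (Some ` I))"
    then have "enat (card (insert None (Some ` I))) \<le> ab_rank G S"
      by (rule card_le_ab_rank) (use b in \<open>auto simp: w_def\<close>)
    also have "\<dots> \<le> enat (card I)" by fact
    finally show False using I by (simp add: card_image)
  qed
  moreover have w: "w \<in> insert None (Some ` I) \<rightarrow> carrier G" using I b by (auto simp: w_def)
  ultimately obtain m :: "'i option \<Rightarrow> int" where
    m: "finprod G (\<lambda>i. w i [^] m i) (insert None (Some ` I)) = \<one>"
       "\<exists>i\<in>insert None (Some ` I). m i \<noteq> 0"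
    using fin by (auto simp: indep_family_def)
  have "finprod G (\<lambda>i. w i [^] m i) (insert None (Some ` I)) =
    w None [^] m None \<otimes> finprod G (\<lambda>i. w i [^] m i) (Some ` I)"
    using I w by (intro finprod_insert) (auto simp: Pi_iff)
  also have "finprod G (\<lambda>i. w i [^] m i) (Some ` I) = finprod G (\<lambda>i. w (Some i) [^] m (Some i)) I"
    using w by (intro finprod_reindex) (auto simp: Pi_iff)
  finally have e: "b [^] m None \<otimes> finprod G (\<lambda>i. u i [^] m (Some i)) I = \<one>"
    using m by (simp add: w_def)
  have c: "finprod G (\<lambda>i. u i [^] m (Some i)) I \<in> carrier G"
    using I by (intro finprod_closed) auto
  show ?thesis
  proof
    show "m None \<noteq> 0"
    proof
      assume "m None = 0"
      then have "finprod G (\<lambda>i. u i [^] m (Some i)) I = \<one>" using e c by simp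
      then have "\<forall>i\<in>I. m (Some i) = 0" using indep_familyD[OF u, of "\<lambda>i. m (Some i)"] by blast
      then show False using m \<open>m None = 0\<close> by auto
    qed
    have "finprod G (\<lambda>i. u i [^] (m (Some i) * (-1))) I = finprod G (\<lambda>i. u i [^] m (Some i)) I [^] (-1::int)"
      using I by (intro finprod_int_pow_mult) auto
    also have "\<dots> = inv (finprod G (\<lambda>i. u i [^] m (Some i)) I)"
      using c int_pow_neg[OF c, of 1] by (simp add: int_pow_1)
    also have "\<dots> = b [^] m None"
      using e c b by (metis int_pow_closed inv_equality subsetD)
    finally show "b [^] m None = finprod G (\<lambda>i. u i [^] (m (Some i) * (-1))) I" ..
  qed
qed

end

section \<open>Additivity of the rank along homomorphisms\<close>

lemma (in group_hom) hom_finprod_int_pow: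
  assumes "comm_group G" "comm_group H" "u \<in> I \<rightarrow> carrier G"
  shows "h (finprod G (\<lambda>i. u i [^] (n i :: int)) I) = finprod H (\<lambda>i. h (u i) [^]\<^bsub>H\<^esub> n i) I"
proof -
  interpret G: comm_group G by fact
  interpret H: comm_group H by fact
  show ?thesis
  proof (cases "finite I")
    case True
    then show ?thesis using assms(3)
    proof (induction I)
      case (insert x I)
      have "finprod G (\<lambda>i. u i [^] n i) (insert x I) = u x [^] n x \<otimes> finprod G (\<lambda>i. u i [^] n i) I"
        using insert by (intro G.finprod_insert) auto
      moreover have "finprod H (\<lambda>i. h (u i) [^]\<^bsub>H\<^esub> n i) (insert x I) =
          h (u x) [^]\<^bsub>H\<^esub> n x \<otimes>\<^bsub>H\<^esub> finprod H (\<lambda>i. h (u i) [^]\<^bsub>H\<^esub> n i) I"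
        using insert by (intro H.finprod_insert) (auto simp: Pi_iff)
      ultimately show ?case
        using insert by (simp add: hom_int_pow Pi_iff)
    qed auto
  qed auto
qed

text \<open>Rank-nullity over the integers. For the upper bound, split an independent family
  \<open>u\<close> along a maximal part \<open>T\<close> whose images stay independent: every other
  \<open>u i\<close> has a nonzero multiple that elements of \<open>T\<close> correct into the
  kernel, and the corrected elements are again independent. For the lower bound, join a family in
  the kernel with lifts of a family in the image.\<close>

proposition (in group_hom) ab_rank_kernel_image:
  assumes "comm_group G" "comm_group H"
  shows "ab_rank G (carrier G) = ab_rank G (kernel G H h) + ab_rank H (h ` carrier G)"
proof (rule antisym)
  interpret G: comm_group G by fact
  interpret H: comm_group H by fact
  show "ab_rank G (carrier G) \<le> ab_rank G (kernel G H h) + ab_rank H (h ` carrier G)"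
  proof (rule G.ab_rank_leI)
    fix u :: "nat \<Rightarrow> 'a" and I
    assume u: "G.indep_family u I"
    then have I: "finite I" "u \<in> I \<rightarrow> carrier G" by (auto simp: G.indep_family_def)
    let ?P = "\<lambda>T. T \<subseteq> I \<and> H.indep_family (h \<circ> u) T"
    have "?P {}" by (simp add: H.indep_family_empty)
    moreover have "finite {T. ?P T}" using I by simp
    ultimately have "\<exists>T\<in>{T. ?P T}. \<forall>T'\<in>{T. ?P T}. T \<subseteq> T' \<longrightarrow> T = T'"
      by (intro finite_has_maximal) auto
    then obtain T where T': "T \<in> {T. ?P T}" "\<forall>T'\<in>{T. ?P T}. T \<subseteq> T' \<longrightarrow> T = T'" ..
    have T: "?P T" using T'(1) by simp
    have max: "T' = T" if "?P T'" "T \<subseteq> T'" for T'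
      using T'(2) that by blast
    have finT: "finite T" using T I finite_subset by blast
    have "\<exists>n::nat \<Rightarrow> int. n i \<noteq> 0 \<and> (\<forall>j\<in>I - insert i T. n j = 0) \<and>
        finprod G (\<lambda>j. u j [^] n j) I \<in> kernel G H h" if i: "i \<in> I - T" for i
    proof -
      have uT: "u \<in> T \<rightarrow> carrier G" "u \<in> insert i T \<rightarrow> carrier G" using T I i by auto
      have "\<not> H.indep_family (h \<circ> u) (insert i T)" using max[of "insert i T"] i T by blast
      moreover have "h \<circ> u \<in> insert i T \<rightarrow> carrier H" using uT by (auto simp: Pi_iff)
      ultimately obtain n :: "nat \<Rightarrow> int" where
        n: "finprod H (\<lambda>j. (h \<circ> u) j [^]\<^bsub>H\<^esub> n j) (insert i T) = \<one>\<^bsub>H\<^esub>" "\<exists>j\<in>insert i T. n j \<noteq> 0"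
        using finT by (auto simp: H.indep_family_def)
      have ni: "n i \<noteq> 0"
      proof
        assume "n i = 0"
        then have "finprod H (\<lambda>j. (h \<circ> u) j [^]\<^bsub>H\<^esub> n j) T = \<one>\<^bsub>H\<^esub>"
          using n(1) uT finT by (subst (asm) H.finprod_int_pow_neutral[of _ _ T]) (auto simp: Pi_iff)
        then have "\<forall>j\<in>T. n j = 0" using T by (auto simp: H.indep_family_def)
        then show False using n \<open>n i = 0\<close> by auto
      qed
      define n' where "n' j = (if j \<in> insert i T then n j else 0)" for j
      have "finprod G (\<lambda>j. u j [^] n' j) I = finprod G (\<lambda>j. u j [^] n' j) (insert i T)"
        using I T i by (intro G.finprod_int_pow_neutral) (auto simp: n'_def)
      also have "\<dots> = finprod G (\<lambda>j. u j [^] n j) (insert i T)"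
        using uT by (intro G.finprod_cong') (auto simp: n'_def)
      finally have "h (finprod G (\<lambda>j. u j [^] n' j) I) = \<one>\<^bsub>H\<^esub>"
        using n(1) by (simp add: hom_finprod_int_pow[OF assms uT(2)])
      moreover have "finprod G (\<lambda>j. u j [^] n' j) I \<in> carrier G"
        using I by (intro G.finprod_closed) auto
      ultimately show ?thesis using ni by (intro exI[of _ n']) (auto simp: n'_def kernel_def)
    qed
    then obtain n :: "nat \<Rightarrow> nat \<Rightarrow> int" where
      n: "\<And>i. i \<in> I - T \<Longrightarrow> n i i \<noteq> 0" "\<And>i j. i \<in> I - T \<Longrightarrow> j \<in> I - insert i T \<Longrightarrow> n i j = 0"
         "\<And>i. i \<in> I - T \<Longrightarrow> finprod G (\<lambda>j. u j [^] n i j) I \<in> kernel G H h"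
      by metis
    define a where "a i = finprod G (\<lambda>j. u j [^] n i j) I" for i
    have "G.indep_family a (I - T)"
      unfolding G.indep_family_def
    proof (intro conjI allI impI)
      show "finite (I - T)" using I by auto
      show "a \<in> I - T \<rightarrow> carrier G" using I by (auto simp: a_def Pi_iff intro!: G.finprod_closed)
      fix m :: "nat \<Rightarrow> int"
      assume "finprod G (\<lambda>i. a i [^] m i) (I - T) = \<one>"
      then have "finprod G (\<lambda>j. u j [^] (\<Sum>i\<in>I - T. n i j * m i)) I = \<one>"
        using I by (simp add: a_def G.finprod_finprod_int_pow)
      then have *: "\<forall>j\<in>I. (\<Sum>i\<in>I - T. n i j * m i) = 0"
        using G.indep_familyD[OF u, of "\<lambda>j. \<Sum>i\<in>I - T. n i j * m i"] by blast
      show "\<forall>i\<in>I - T. m i = 0"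
      proof
        fix j assume j: "j \<in> I - T"
        \<comment> \<open>Outside \<open>T\<close> the coefficient matrix is diagonal with nonzero
          diagonal, so the relation at \<open>j\<close> involves \<open>m j\<close> alone.\<close>
        have "(\<Sum>i\<in>I - T. n i j * m i) = (\<Sum>i\<in>{j}. n i j * m i)"
          using j I n(2) by (intro sum.mono_neutral_right) auto
        then show "m j = 0" using * j n(1) by auto
      qed
    qed
    then have "enat (card (I - T)) \<le> ab_rank G (kernel G H h)"
      by (rule G.card_le_ab_rank) (auto simp: a_def n)
    moreover have "enat (card T) \<le> ab_rank H (h ` carrier G)"
      by (rule H.card_le_ab_rank[where u = "h \<circ> u"]) (use T I in \<open>auto simp: Pi_iff subset_iff\<close>)
    moreover have "enat (card I) = enat (card (I - T)) + enat (card T)"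
      using T I finT by (simp add: card_Diff_subset card_mono)
    ultimately show "enat (card I) \<le> ab_rank G (kernel G H h) + ab_rank H (h ` carrier G)"
      by (metis add_mono)
  qed
  have key: "enat (card I) + enat (card J) \<le> ab_rank G (carrier G)"
    if s: "G.indep_family s I" "s \<in> I \<rightarrow> kernel G H h" and t: "H.indep_family t J" "t \<in> J \<rightarrow> h ` carrier G"
    for s t and I J :: "nat set"
  proof -
    have fin: "finite I" "finite J" using s t by (auto simp: G.indep_family_def H.indep_family_def)
    have "\<forall>j\<in>J. \<exists>y. y \<in> carrier G \<and> t j = h y" using t(2) by (auto simp: Pi_iff image_iff)
    then obtain t' where t': "\<And>j. j \<in> J \<Longrightarrow> t' j \<in> carrier G \<and> t j = h (t' j)"
      using bchoice by meson
    define w where "w = case_sum s t'"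
    have wI: "(\<lambda>i. w (Inl i)) \<in> I \<rightarrow> carrier G" and wJ: "(\<lambda>i. w (Inr i)) \<in> J \<rightarrow> carrier G"
      and w: "w \<in> I <+> J \<rightarrow> carrier G"
      using s t' by (auto simp: w_def kernel_def)
    have "G.indep_family w (I <+> J)"
      unfolding G.indep_family_def
    proof (intro conjI allI impI w)
      show "finite (I <+> J)" using fin by auto
      fix n :: "nat + nat \<Rightarrow> int"
      let ?A = "finprod G (\<lambda>i. w (Inl i) [^] n (Inl i)) I"
      let ?B = "finprod G (\<lambda>i. w (Inr i) [^] n (Inr i)) J"
      assume "finprod G (\<lambda>i. w i [^] n i) (I <+> J) = \<one>"
      moreover have "finprod G (\<lambda>i. w i [^] n i) (I <+> J) =
         finprod G (\<lambda>i. w i [^] n i) (Inl ` I) \<otimes> finprod G (\<lambda>i. w i [^] n i) (Inr ` J)"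
        unfolding Plus_def using fin wI wJ by (intro G.finprod_Un_disjoint) (auto simp: Pi_iff)
      moreover have "finprod G (\<lambda>i. w i [^] n i) (Inl ` I) = ?A"
        using wI by (intro G.finprod_reindex) (auto simp: Pi_iff)
      moreover have "finprod G (\<lambda>i. w i [^] n i) (Inr ` J) = ?B"
        using wJ by (intro G.finprod_reindex) (auto simp: Pi_iff)
      ultimately have e: "?A \<otimes> ?B = \<one>" by simp
      have cA: "?A \<in> carrier G" and cB: "?B \<in> carrier G"
        using wI wJ by (auto intro!: G.finprod_closed)
      have "h ?A = finprod H (\<lambda>i. h (w (Inl i)) [^]\<^bsub>H\<^esub> n (Inl i)) I"
        by (rule hom_finprod_int_pow[OF assms wI])
      also have "\<dots> = \<one>\<^bsub>H\<^esub>"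
        using s by (intro H.finprod_one_eqI) (auto simp: w_def kernel_def Pi_iff)
      finally have hA: "h ?A = \<one>\<^bsub>H\<^esub>" .
      have "h ?B = h ?A \<otimes>\<^bsub>H\<^esub> h ?B" using hA cB by simp
      also have "\<dots> = h (?A \<otimes> ?B)" using cA cB by simp
      finally have "h ?B = \<one>\<^bsub>H\<^esub>" using e by simp
      moreover have "h ?B = finprod H (\<lambda>i. t i [^]\<^bsub>H\<^esub> n (Inr i)) J"
        unfolding hom_finprod_int_pow[OF assms wJ]
        using t' by (intro H.finprod_cong') (auto simp: w_def)
      ultimately have nJ: "\<forall>j\<in>J. n (Inr j) = 0"
        using H.indep_familyD[OF t(1), of "\<lambda>j. n (Inr j)"] by presburger
      then have "?B = \<one>" by (intro G.finprod_one_eqI) auto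
      then have "?A = \<one>" using e cA by simp
      then have "finprod G (\<lambda>i. s i [^] n (Inl i)) I = \<one>" by (simp add: w_def)
      then have "\<forall>i\<in>I. n (Inl i) = 0"
        using G.indep_familyD[OF s(1), of "\<lambda>j. n (Inl j)"] by blast
      then show "\<forall>i\<in>I <+> J. n i = 0" using nJ by auto
    qed
    from G.card_le_ab_rank[OF this w] show ?thesis using fin by (simp add: card_Plus)
  qed
  show "ab_rank G (kernel G H h) + ab_rank H (h ` carrier G) \<le> ab_rank G (carrier G)"
  proof (cases "ab_rank G (carrier G)")
    case (enat d)
    have "ab_rank G (kernel G H h) \<le> enat d"
      using G.ab_rank_mono[of "kernel G H h" "carrier G"] enat by (auto simp: kernel_def)
    then obtain a where a: "ab_rank G (kernel G H h) = enat a" using enat_ile by blast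
    have "ab_rank H (h ` carrier G) \<le> enat d"
    proof (rule H.ab_rank_leI)
      fix t :: "nat \<Rightarrow> 'c" and J assume "H.indep_family t J" "t \<in> J \<rightarrow> h ` carrier G"
      from key[OF G.indep_family_empty _ this] enat show "enat (card J) \<le> enat d" by (auto simp: zero_enat_def)
    qed
    then obtain c where c: "ab_rank H (h ` carrier G) = enat c" using enat_ile by blast
    show ?thesis
      using G.ab_rank_attained[OF a] H.ab_rank_attained[OF c] key a c by metis
  qed simp
qed

lemma ab_rank_iso:
  assumes "h \<in> iso G H" "comm_group G" "comm_group H"
  shows "ab_rank G (carrier G) = ab_rank H (carrier H)"
proof -
  interpret G: comm_group G by fact
  interpret H: comm_group H by fact
  interpret group_hom G H h
    using assms by (simp add: group_hom_def group_hom_axioms_def iso_imp_homomorphism)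
  have "kernel G H h = {\<one>\<^bsub>G\<^esub>}" "h ` carrier G = carrier H"
    using assms by (auto simp: iso_iff inj_iff_trivial_ker kernel_def)
  moreover have "ab_rank G {\<one>\<^bsub>G\<^esub>} = 0"
  proof -
    have "ab_rank G {\<one>\<^bsub>G\<^esub>} \<le> 0"
    proof (rule G.ab_rank_leI)
      fix u :: "nat \<Rightarrow> 'a" and I assume u: "G.indep_family u I" "u \<in> I \<rightarrow> {\<one>\<^bsub>G\<^esub>}"
      have "finprod G (\<lambda>i. u i [^]\<^bsub>G\<^esub> (1::int)) I = \<one>\<^bsub>G\<^esub>"
        using u by (intro G.finprod_one_eqI) (auto simp: Pi_iff)
      then have "\<forall>i\<in>I. (1::int) = 0" using G.indep_familyD[OF u(1), of "\<lambda>i. 1"] by blast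
      then have "I = {}" by auto
      then show "enat (card I) \<le> 0" by (simp add: zero_enat_def)
    qed
    then show ?thesis by simp
  qed
  ultimately show ?thesis using ab_rank_kernel_image[OF assms(2,3)] by simp
qed

lemma ab_rank_trivial:
  assumes "trivial_group G" "comm_group G"
  shows "ab_rank G (carrier G) = 0"
proof -
  interpret G: comm_group G by fact
  have "ab_rank G (carrier G) \<le> 0"
  proof (rule G.ab_rank_leI)
    fix u :: "nat \<Rightarrow> 'a" and I assume u: "G.indep_family u I" "u \<in> I \<rightarrow> carrier G"
    have "finprod G (\<lambda>i. u i [^]\<^bsub>G\<^esub> (1::int)) I = \<one>\<^bsub>G\<^esub>"
      using u assms by (intro G.finprod_one_eqI) (auto simp: trivial_group_def Pi_iff)
    then have "\<forall>i\<in>I. (1::int) = 0" using G.indep_familyD[OF u(1), of "\<lambda>i. 1"] by blast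
    then have "I = {}" by auto
    then show "enat (card I) \<le> 0" by (simp add: zero_enat_def)
  qed
  then show ?thesis by simp
qed

lemma ab_rank_integer_group: "ab_rank integer_group (carrier integer_group) = 1"
proof (rule antisym)
  interpret G: comm_group integer_group by (rule abelian_integer_group)
  show "ab_rank integer_group (carrier integer_group) \<le> 1"
  proof (rule G.ab_rank_leI)
    fix u :: "nat \<Rightarrow> int" and I assume u: "G.indep_family u I"
    then have fin: "finite I" by (auto simp: G.indep_family_def)
    have "i = j" if ij: "i \<in> I" "j \<in> I" for i j
    proof (rule ccontr)
      assume ne: "i \<noteq> j"
      have "u k \<noteq> 0" if "k \<in> I" for k
      proof
        assume "u k = 0"
        have ind: "G.indep_family u {k}" by (rule G.indep_family_subset[OF u]) (use that in auto)
        have "finprod integer_group (\<lambda>i. u i [^]\<^bsub>integer_group\<^esub> (1::int)) {k} = \<one>\<^bsub>integer_group\<^esub>"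
          using \<open>u k = 0\<close> by (intro G.finprod_one_eqI) auto
        from G.indep_familyD[OF ind this, of k] show False by simp
      qed
      then have nz: "u i \<noteq> 0" "u j \<noteq> 0" using ij by auto
      \<comment> \<open>Two integers always satisfy the relation
        \<open>u j * u i - u i * u j = 0\<close>, which is nontrivial as neither of them
        vanishes.\<close>
      define n where "n k = (if k = i then u j else - u i)" for k
      have ind: "G.indep_family u {i, j}" by (rule G.indep_family_subset[OF u]) (use ij in auto)
      have "finprod integer_group (\<lambda>k. u k [^]\<^bsub>integer_group\<^esub> n k) {i,j} = \<one>\<^bsub>integer_group\<^esub>"
        using ne by (simp add: G.finprod_insert n_def)
      from G.indep_familyD[OF ind this, of i] nz show False by (simp add: n_def)
    qed
    then have "card I \<le> 1" using fin by (simp add: card_le_Suc0_iff_eq)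
    then show "enat (card I) \<le> 1" by (simp add: one_enat_def)
  qed
  have "G.indep_family (\<lambda>_::unit. 1) {()}"
    by (auto simp: G.indep_family_def)
  from G.card_le_ab_rank[OF this, of UNIV] show "1 \<le> ab_rank integer_group (carrier integer_group)"
    by (simp add: one_enat_def)
qed

section \<open>Euler characteristics from ranks of homology groups\<close>

abbreviation relhom_rank :: "nat \<Rightarrow> 'a topology \<Rightarrow> 'a set \<Rightarrow> enat" where
  "relhom_rank p X S \<equiv>
    ab_rank (relative_homology_group (int p) X S) (carrier (relative_homology_group (int p) X S))"

definition finite_ranks :: "'a topology \<Rightarrow> 'a set \<Rightarrow> (nat \<Rightarrow> nat) \<Rightarrow> bool" where
  "finite_ranks X S r \<longleftrightarrow> (\<forall>p. relhom_rank p X S = enat (r p)) \<and> finite {p. r p \<noteq> 0}"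

text \<open>A relation rather than a function, so that every use also carries the finiteness of all
  ranks.\<close>

definition has_euler_char :: "'a topology \<Rightarrow> 'a set \<Rightarrow> int \<Rightarrow> bool" where
  "has_euler_char X S e \<longleftrightarrow> (\<exists>r. finite_ranks X S r \<and> e = (\<Sum>p | r p \<noteq> 0. (-1) ^ p * int (r p)))"

text \<open>The long exact sequence of the pair reduced to numbers: \<open>\<alpha>\<close>,
  \<open>\<beta>\<close> and \<open>\<gamma>\<close> are the ranks of the images of the inclusion,
  the projection and the boundary map, and rank-nullity applies at each term.
  \<open>\<gamma> 0\<close> vanishes because the boundary map in degree 0 lands in homology of
  degree -1.\<close>

lemma relhom_rank_exact:
  fixes X :: "'a topology" and S :: "'a set"
  shows "\<exists>\<alpha> \<beta> \<gamma> :: nat \<Rightarrow> enat.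
    (\<forall>p. relhom_rank p (subtopology X S) {} = \<gamma> (Suc p) + \<alpha> p) \<and>
    (\<forall>p. relhom_rank p X {} = \<alpha> p + \<beta> p) \<and>
    (\<forall>p. relhom_rank p X S = \<beta> p + \<gamma> p) \<and> \<gamma> 0 = 0"
proof -
  define i where "i p = hom_induced p (subtopology X S) {} X {} id" for p :: int
  define j where "j p = hom_induced p X {} X S id" for p :: int
  define d where "d p = hom_boundary p X S" for p :: int
  define HA where "HA p = homology_group p (subtopology X S)" for p :: int
  define HX where "HX p = homology_group p X" for p :: int
  define HR where "HR p = relative_homology_group p X S" for p :: int
  have ex: "exact_seq ([HA (p - 1), HR p, HX p], [d p, j p])"
    "exact_seq ([HX (p - 1), HA (p - 1), HR p], [i (p - 1), d p])"
    "exact_seq ([HR p, HX p, HA p], [j p, i p])" for p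
    unfolding i_def j_def d_def HA_def HX_def HR_def
    by (rule homology_exactness_axiom_1 homology_exactness_axiom_2 homology_exactness_axiom_3)+
  have cg: "comm_group (HA p)" "comm_group (HX p)" "comm_group (HR p)" for p
    unfolding HA_def HX_def HR_def by (rule abelian_relative_homology_group)+
  have gh: "group_hom (HR p) (HA (p - 1)) (d p)" "group_hom (HX p) (HR p) (j p)" "group_hom (HA p) (HX p) (i p)"
    and ker: "kernel (HR p) (HA (p - 1)) (d p) = j p ` carrier (HX p)"
      "kernel (HX p) (HR p) (j p) = i p ` carrier (HA p)" for p
    using ex(1,3)[of p] by (auto simp: group_hom_def group_hom_axioms_def)
  have ker': "kernel (HA p) (HX p) (i p) = d (p + 1) ` carrier (HR (p + 1))" for p
    using ex(2)[of "p + 1"] by simp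
  define \<alpha> where "\<alpha> p = ab_rank (HX (int p)) (i (int p) ` carrier (HA (int p)))" for p :: nat
  define \<beta> where "\<beta> p = ab_rank (HR (int p)) (j (int p) ` carrier (HX (int p)))" for p :: nat
  define \<gamma> where "\<gamma> p = ab_rank (HA (int p - 1)) (d (int p) ` carrier (HR (int p)))" for p :: nat
  show ?thesis
  proof (intro exI conjI allI)
    show "relhom_rank p (subtopology X S) {} = \<gamma> (Suc p) + \<alpha> p" for p
      using group_hom.ab_rank_kernel_image[OF gh(3) cg(1,2), of p]
      by (simp add: HA_def[symmetric] \<alpha>_def \<gamma>_def ker' add.commute)
    show "relhom_rank p X {} = \<alpha> p + \<beta> p" for p
      using group_hom.ab_rank_kernel_image[OF gh(2) cg(2,3), of p]
      by (simp add: HX_def[symmetric] \<alpha>_def \<beta>_def ker)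
    show "relhom_rank p X S = \<beta> p + \<gamma> p" for p
      using group_hom.ab_rank_kernel_image[OF gh(1) cg(3,1), of p]
      by (simp add: HR_def[symmetric] \<gamma>_def \<beta>_def ker)
    have "\<gamma> 0 \<le> ab_rank (HA (-1)) (carrier (HA (-1)))"
      using comm_group.ab_rank_mono[OF cg(1), of "d 0 ` carrier (HR 0)" "carrier (HA (-1))" "-1"] gh(1)[of 0]
      by (auto simp: \<gamma>_def group_hom_def group_hom_axioms_def hom_def)
    also have "\<dots> = 0"
      by (rule ab_rank_trivial) (auto simp: HA_def)
    finally show "\<gamma> 0 = 0" by simp
  qed
qed

section \<open>Additivity of Euler characteristics for pairs and open unions\<close>

lemma support_subset_lessThan:
  fixes r :: "nat \<Rightarrow> nat"
  assumes "\<forall>p\<ge>N. r p = 0"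
  shows "{p. r p \<noteq> 0} \<subseteq> {..<N}"
proof
  fix p assume "p \<in> {p. r p \<noteq> 0}"
  then show "p \<in> {..<N}" using assms by (cases "p < N") simp_all
qed

lemma has_euler_char_sum_eq:
  fixes r :: "nat \<Rightarrow> nat"
  assumes "\<forall>p\<ge>N. r p = 0"
  shows "(\<Sum>p | r p \<noteq> 0. (-1) ^ p * int (r p)) = (\<Sum>p<N. (-1) ^ p * int (r p))"
  by (rule sum.mono_neutral_left[OF _ support_subset_lessThan[OF assms]]) auto

lemma has_euler_charI:
  assumes "\<And>p. relhom_rank p X S = enat (r p)" "\<And>p. p \<ge> N \<Longrightarrow> r p = 0"
    "e = (\<Sum>p<N. (-1) ^ p * int (r p))"
  shows "has_euler_char X S e"
proof -
  have N: "\<forall>p\<ge>N. r p = 0" using assms(2) by blast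
  have "finite {p. r p \<noteq> 0}"
    by (rule finite_subset[OF support_subset_lessThan[OF N]]) simp
  then have "finite_ranks X S r"
    unfolding finite_ranks_def using assms(1) by blast
  then show ?thesis
    unfolding has_euler_char_def assms(3) has_euler_char_sum_eq[OF N, symmetric] by blast
qed

lemma has_euler_charD:
  assumes "has_euler_char X S e"
  shows "\<exists>r N. (\<forall>p. relhom_rank p X S = enat (r p)) \<and> (\<forall>p\<ge>N. r p = 0) \<and>
    (\<forall>M\<ge>N. e = (\<Sum>p<M. (-1) ^ p * int (r p)))"
proof -
  obtain r where r: "\<forall>p. relhom_rank p X S = enat (r p)" "finite {p. r p \<noteq> 0}"
    and e: "e = (\<Sum>p | r p \<noteq> 0. (-1) ^ p * int (r p))"
    using assms by (auto simp: has_euler_char_def finite_ranks_def)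
  obtain N where "{p. r p \<noteq> 0} \<subseteq> {..<N}" using r(2) finite_nat_iff_bounded by blast
  then have N: "\<forall>p\<ge>N. r p = 0" by fastforce
  then have "e = (\<Sum>p<M. (-1) ^ p * int (r p))" if "M \<ge> N" for M
    unfolding e using N that by (intro has_euler_char_sum_eq) simp
  then show ?thesis using r(1) N by blast
qed

text \<open>The rank of a boundary map enters in two neighbouring degrees with opposite signs, so
  these contributions telescope.\<close>

lemma sum_alternating_shift:
  fixes c :: "nat \<Rightarrow> nat"
  shows "(\<Sum>p<N. (-1) ^ p * int (c p)) + (\<Sum>p<N. (-1) ^ p * int (c (Suc p))) =
    int (c 0) - (-1) ^ N * int (c N)"
  by (induction N) (auto simp: algebra_simps)

lemma enat_add_finite: "x + y = enat k \<Longrightarrow> (\<exists>i. x = enat i) \<and> (\<exists>j. y = enat j)"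
  by (cases x; cases y) auto

lemma enat_choice: "(\<And>p. \<exists>i. f p = enat i) \<Longrightarrow> \<exists>g. \<forall>p. f p = enat (g p)"
  by (intro choice) auto

lemma has_euler_char_relative:
  assumes "has_euler_char X {} e" "has_euler_char (subtopology X S) {} f"
  shows "has_euler_char X S (e - f)"
proof -
  obtain a b c where abc:
    "\<forall>p. relhom_rank p (subtopology X S) {} = c (Suc p) + a p"
    "\<forall>p. relhom_rank p X {} = a p + b p" "\<forall>p. relhom_rank p X S = b p + c p" "c 0 = (0::enat)"
    using relhom_rank_exact[of X S] by blast
  obtain r N where r: "\<forall>p. relhom_rank p X {} = enat (r p)" "\<forall>p\<ge>N. r p = 0"
    "\<forall>M\<ge>N. e = (\<Sum>p<M. (-1) ^ p * int (r p))"
    using has_euler_charD[OF assms(1)] by blast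
  obtain s M where s: "\<forall>p. relhom_rank p (subtopology X S) {} = enat (s p)" "\<forall>p\<ge>M. s p = 0"
    "\<forall>K\<ge>M. f = (\<Sum>p<K. (-1) ^ p * int (s p))"
    using has_euler_charD[OF assms(2)] by blast
  have "\<exists>i. a p = enat i" "\<exists>i. b p = enat i" "\<exists>i. c (Suc p) = enat i" for p
    using abc(1,2) r(1) s(1) by (metis enat_add_finite)+
  moreover have "\<exists>i. c p = enat i" for p
    using \<open>\<And>p. \<exists>i. c (Suc p) = enat i\<close> abc(4) by (cases p) (auto simp: zero_enat_def)
  ultimately obtain a' b' c' where e: "\<And>p. a p = enat (a' p)" "\<And>p. b p = enat (b' p)" "\<And>p. c p = enat (c' p)"
    using enat_choice[of a] enat_choice[of b] enat_choice[of c] by blast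
  have eqs: "s p = c' (Suc p) + a' p" "r p = a' p + b' p" "relhom_rank p X S = enat (b' p + c' p)" "c' 0 = 0" for p
    using spec[OF abc(1), of p] spec[OF abc(2), of p] spec[OF abc(3), of p] abc(4) spec[OF r(1), of p] spec[OF s(1), of p] by (auto simp: e zero_enat_def)
  \<comment> \<open>One degree beyond both bounds, since \<open>c' p\<close> is controlled by the
    subspace only through degree \<open>p - 1\<close>.\<close>
  define K where "K = Suc (max N M)"
  have KN: "K \<ge> N" "K \<ge> M" by (auto simp: K_def)
  have van: "b' p = 0" "c' p = 0" if "p \<ge> K" for p
  proof -
    show "b' p = 0" using that spec[OF r(2), of p] eqs(2)[of p] by (simp add: K_def)
    have "p > 0" using that by (simp add: K_def)
    then obtain q where "p = Suc q" using gr0_implies_Suc by blast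
    then show "c' p = 0" using that spec[OF s(2), of q] eqs(1)[of q] by (auto simp: K_def)
  qed
  show ?thesis
  proof (rule has_euler_charI[of _ _ "\<lambda>p. b' p + c' p" K])
    have "e = (\<Sum>p<K. (-1) ^ p * int (r p))" "f = (\<Sum>p<K. (-1) ^ p * int (s p))"
      using r(3) s(3) KN by blast+
    then have "e - f = (\<Sum>p<K. (-1) ^ p * int (b' p)) - (\<Sum>p<K. (-1) ^ p * int (c' (Suc p)))"
      by (simp add: eqs(1,2) distrib_left sum.distrib)
    also have "\<dots> = (\<Sum>p<K. (-1) ^ p * int (b' p)) + (\<Sum>p<K. (-1) ^ p * int (c' p))"
    proof -
      have "(\<Sum>p<K. (-1) ^ p * int (c' p)) + (\<Sum>p<K. (-1) ^ p * int (c' (Suc p))) = 0"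
        unfolding sum_alternating_shift by (simp add: van eqs(4))
      then show ?thesis by linarith
    qed
    finally show "e - f = (\<Sum>p<K. (-1) ^ p * int (b' p + c' p))"
      by (simp add: algebra_simps sum.distrib)
  qed (use eqs(3) in blast, simp add: van)
qed

lemma has_euler_char_absolute:
  assumes "has_euler_char X S e" "has_euler_char (subtopology X S) {} f"
  shows "has_euler_char X {} (e + f)"
proof -
  obtain a b c where abc:
    "\<forall>p. relhom_rank p (subtopology X S) {} = c (Suc p) + a p"
    "\<forall>p. relhom_rank p X {} = a p + b p" "\<forall>p. relhom_rank p X S = b p + c p" "c 0 = (0::enat)"
    using relhom_rank_exact[of X S] by blast
  obtain r N where r: "\<forall>p. relhom_rank p X S = enat (r p)" "\<forall>p\<ge>N. r p = 0"
    "\<forall>M\<ge>N. e = (\<Sum>p<M. (-1) ^ p * int (r p))"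
    using has_euler_charD[OF assms(1)] by blast
  obtain s M where s: "\<forall>p. relhom_rank p (subtopology X S) {} = enat (s p)" "\<forall>p\<ge>M. s p = 0"
    "\<forall>K\<ge>M. f = (\<Sum>p<K. (-1) ^ p * int (s p))"
    using has_euler_charD[OF assms(2)] by blast
  have "\<exists>i. a p = enat i" "\<exists>i. b p = enat i" "\<exists>i. c p = enat i" for p
    using abc(1,3) r(1) s(1) by (metis enat_add_finite)+
  then obtain a' b' c' where e: "\<And>p. a p = enat (a' p)" "\<And>p. b p = enat (b' p)" "\<And>p. c p = enat (c' p)"
    using enat_choice[of a] enat_choice[of b] enat_choice[of c] by blast
  have eqs: "s p = c' (Suc p) + a' p" "r p = b' p + c' p" "relhom_rank p X {} = enat (a' p + b' p)" "c' 0 = 0" for p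
    using spec[OF abc(1), of p] spec[OF abc(2), of p] spec[OF abc(3), of p] abc(4) spec[OF r(1), of p] spec[OF s(1), of p] by (auto simp: e zero_enat_def)
  define K where "K = max N M"
  have van: "b' p = 0" "a' p = 0" "c' p = 0" if "p \<ge> K" for p
    using that spec[OF r(2), of p] spec[OF s(2), of p] eqs(1)[of p] eqs(2)[of p] by (simp_all add: K_def)
  show ?thesis
  proof (rule has_euler_charI[of _ _ "\<lambda>p. a' p + b' p" K])
    have "e + f = (\<Sum>p<K. (-1) ^ p * int (a' p)) + (\<Sum>p<K. (-1) ^ p * int (b' p)) +
        ((\<Sum>p<K. (-1) ^ p * int (c' p)) + (\<Sum>p<K. (-1) ^ p * int (c' (Suc p))))"
      using spec[OF r(3), of K] spec[OF s(3), of K]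
      by (simp add: K_def eqs algebra_simps sum.distrib)
    also have "\<dots> = (\<Sum>p<K. (-1) ^ p * int (a' p)) + (\<Sum>p<K. (-1) ^ p * int (b' p))"
      using van[of K] eqs(4) by (simp add: sum_alternating_shift)
    finally show "e + f = (\<Sum>p<K. (-1) ^ p * int (a' p + b' p))"
      by (simp add: algebra_simps sum.distrib)
  qed (use eqs(3) in blast, simp add: van)
qed

lemma has_euler_char_relative_iso:
  assumes "\<And>p. \<exists>h. h \<in> iso (relative_homology_group (int p) X S) (relative_homology_group (int p) Y T)"
    and "has_euler_char X S e"
  shows "has_euler_char Y T e"
proof -
  have "relhom_rank p X S = relhom_rank p Y T" for p
    using assms(1)[of p] by (metis ab_rank_iso abelian_relative_homology_group)
  then show ?thesis using assms(2) by (simp add: has_euler_char_def finite_ranks_def)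
qed

text \<open>Cutting \<open>V - U\<close> out of the pair of \<open>U \<union> V\<close> and
  \<open>V\<close> leaves the pair of \<open>U\<close> and \<open>U \<inter> V\<close>. Excision
  applies because \<open>V - U\<close> is closed in the union and lies in the open set
  \<open>V\<close>; hence both pairs have the value \<open>a - c\<close>, and adding that of
  \<open>V\<close> gives the claim.\<close>

proposition has_euler_char_Un_open:
  assumes "openin X U" "openin X V"
    and "has_euler_char (subtopology X U) {} a" "has_euler_char (subtopology X V) {} b"
    and "has_euler_char (subtopology X (U \<inter> V)) {} c"
  shows "has_euler_char (subtopology X (U \<union> V)) {} (a + b - c)"
proof -
  let ?Y = "subtopology X (U \<union> V)"
  have UV: "U \<subseteq> topspace X" "V \<subseteq> topspace X" using assms openin_subset by auto
  have sub: "subtopology (subtopology X U) (U \<inter> V) = subtopology X (U \<inter> V)"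
    by (simp add: subtopology_subtopology)
  have 1: "has_euler_char (subtopology X U) (U \<inter> V) (a - c)"
    by (intro has_euler_char_relative) (use assms sub in auto)
  have openY: "openin ?Y U" "openin ?Y V"
    using assms by (auto simp: openin_subtopology_Int openin_open_subtopology openin_Un)
  have top: "topspace ?Y = U \<union> V" using UV by auto
  have "closedin ?Y (U \<union> V - U)" using openY(1) top by (metis closedin_def closedin_diff closedin_topspace)
  then have "?Y closure_of (V - U) \<subseteq> ?Y interior_of V"
    using openY by (simp add: closure_of_closedin interior_of_openin Un_Diff)
  then have exc: "hom_induced p (subtopology ?Y (U \<union> V - (V - U))) (V - (V - U)) (subtopology ?Y (U \<union> V)) V id
      \<in> iso (relative_homology_group p (subtopology ?Y (U \<union> V - (V - U))) (V - (V - U)))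
          (relative_homology_group p (subtopology ?Y (U \<union> V)) V)" for p
    by (rule homology_excision_axiom) auto
  have eqs: "U \<union> V - (V - U) = U" "V - (V - U) = U \<inter> V" by auto
  have subs: "subtopology ?Y U = subtopology X U" "subtopology ?Y (U \<union> V) = ?Y" "subtopology ?Y V = subtopology X V"
    by (simp_all add: subtopology_subtopology Int_absorb1)
  have "has_euler_char ?Y V (a - c)"
    using exc unfolding eqs subs by (intro has_euler_char_relative_iso[OF _ 1]) blast
  then have "has_euler_char ?Y {} (a - c + b)"
    by (rule has_euler_char_absolute) (use assms subs in auto)
  then show ?thesis by (simp add: algebra_simps)
qed

lemma has_euler_char_empty:
  assumes "topspace X = {}"
  shows "has_euler_char X {} 0"
proof (rule has_euler_charI[where r = "\<lambda>_. 0" and N = 0])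
  show "relhom_rank p X {} = enat 0" for p
    unfolding zero_enat_def[symmetric]
    by (intro ab_rank_trivial trivial_homology_group_empty assms abelian_relative_homology_group)
qed simp_all

lemma has_euler_char_contractible:
  assumes "contractible_space X" "topspace X \<noteq> {}"
  shows "has_euler_char X {} 1"
proof (rule has_euler_charI[where r = "\<lambda>p. if p = 0 then 1 else 0" and N = 1])
  show "relhom_rank p X {} = enat (if p = 0 then 1 else 0)" for p
  proof (cases "p = 0")
    case True
    have "homology_group 0 X \<cong> integer_group"
      using assms by (simp add: isomorphic_integer_zeroth_homology_group contractible_imp_path_connected_space)
    then have "relhom_rank 0 X {} = 1"
      using ab_rank_integer_group by (metis ab_rank_iso abelian_integer_group abelian_homology_group ex_in_conv is_iso_def of_nat_0)
    then show ?thesis using True by (simp add: one_enat_def)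
  next
    case False
    have "trivial_group (reduced_homology_group (int p) X)"
      using assms by (simp add: trivial_reduced_homology_group_contractible_space)
    then have "trivial_group (homology_group (int p) X)"
      using False by (simp add: un_reduced_homology_group)
    then show ?thesis using False by (simp add: ab_rank_trivial zero_enat_def[symmetric])
  qed
qed simp_all

section \<open>Rational cohomology as the dual of homology\<close>

text \<open>The Kronecker pairing of a rational cochain with an integral chain.\<close>

definition cochain_eval :: "('s \<Rightarrow> rat) \<Rightarrow> ('s \<Rightarrow>\<^sub>0 int) \<Rightarrow> rat" where
  "cochain_eval f c = (\<Sum>s\<in>Poly_Mapping.keys c. of_int (Poly_Mapping.lookup c s) * f s)"

lemma frag_cmul_diff: "frag_cmul k (a - b) = frag_cmul k a - frag_cmul k b"
  by (metis add_diff_cancel_right' diff_add_cancel frag_cmul_distrib2)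

lemma cochain_eval_superset:
  assumes "finite A" "Poly_Mapping.keys c \<subseteq> A"
  shows "cochain_eval f c = (\<Sum>s\<in>A. of_int (Poly_Mapping.lookup c s) * f s)"
  unfolding cochain_eval_def using assms
  by (intro sum.mono_neutral_left) (auto simp: in_keys_iff)

lemma cochain_eval_add: "cochain_eval f (a + b) = cochain_eval f a + cochain_eval f b"
proof -
  let ?A = "Poly_Mapping.keys a \<union> Poly_Mapping.keys b"
  have "Poly_Mapping.keys (a + b) \<subseteq> ?A" by (rule keys_add)
  then show ?thesis
    by (simp add: cochain_eval_superset[of ?A] lookup_add distrib_right sum.distrib)
qed

lemma cochain_eval_cmul: "cochain_eval f (frag_cmul k a) = of_int k * cochain_eval f a"
proof -
  have "cochain_eval f (frag_cmul k a) =
      (\<Sum>s\<in>Poly_Mapping.keys a. of_int (Poly_Mapping.lookup (frag_cmul k a) s) * f s)"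
    by (intro cochain_eval_superset) (auto intro: subsetD[OF keys_cmul])
  then show ?thesis by (simp add: cochain_eval_def sum_distrib_left mult.assoc)
qed

lemma cochain_eval_0 [simp]: "cochain_eval f 0 = 0"
  by (simp add: cochain_eval_def)

lemma cochain_eval_of [simp]: "cochain_eval f (frag_of s) = f s"
  by (simp add: cochain_eval_def)

lemma cochain_eval_diff: "cochain_eval f (a - b) = cochain_eval f a - cochain_eval f b"
  by (metis add_diff_cancel_right' cochain_eval_add diff_add_cancel)

lemma cochain_eval_sum: "cochain_eval f (sum g I) = (\<Sum>i\<in>I. cochain_eval f (g i))"
  by (induction I rule: infinite_finite_induct) (auto simp: cochain_eval_add)

lemma cochain_eval_lincomb:
  "cochain_eval (\<lambda>s. \<Sum>g\<in>S. c g * g s) z = (\<Sum>g\<in>S. c g * cochain_eval g z)"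
  unfolding cochain_eval_def sum_distrib_left by (subst sum.swap) (simp add: mult_ac)

lemma cochain_eval_diff_left: "cochain_eval (\<lambda>s. f s - g s) z = cochain_eval f z - cochain_eval g z"
  by (simp add: cochain_eval_def right_diff_distrib sum_subtractf)

lemma cochain_eval_cong:
  "(\<And>s. s \<in> Poly_Mapping.keys c \<Longrightarrow> f s = g s) \<Longrightarrow> cochain_eval f c = cochain_eval g c"
  by (auto simp: cochain_eval_def)

lemma common_denominator:
  fixes r :: "'b \<Rightarrow> rat"
  assumes "finite t"
  shows "\<exists>N::int. N > 0 \<and> (\<forall>b\<in>t. \<exists>n::int. of_int N * r b = of_int n)"
  using assms
proof (induction t)
  case (insert x t)
  then obtain N :: int where N: "N > 0" "\<forall>b\<in>t. \<exists>n::int. of_int N * r b = of_int n" by auto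
  obtain a d where q: "quotient_of (r x) = (a, d)" by fastforce
  then have d: "d > 0" "r x = of_int a / of_int d"
    using quotient_of_denom_pos quotient_of_div by auto
  have "of_int (N * d) * r x = of_int (N * a)" using d by simp
  moreover have "\<exists>n::int. of_int (N * d) * r b = of_int n" if bt: "b \<in> t" for b
  proof -
    obtain n :: int where n: "of_int N * r b = of_int n" using bspec[OF N(2) bt] by (elim exE)
    have "of_int (N * d) * r b = of_int d * (of_int N * r b)" by (simp add: mult_ac)
    also have "\<dots> = of_int (d * n)" by (simp only: n of_int_mult)
    finally show ?thesis by (rule exI)
  qed
  moreover have "N * d > 0" using N d by simp
  ultimately show ?case by (metis insert_iff)
qed (auto intro: exI[of _ 1])

lemma sum_fun_apply: "(\<Sum>i\<in>I. f i) x = (\<Sum>i\<in>I. f i x :: 'b :: comm_monoid_add)"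
  by (induction I rule: infinite_finite_induct) auto

text \<open>
  The additive group of rational numbers is injective. Here the extension is found with a basis of the rational
  span of the subgroup.
\<close>

lemma additive_functional_extends:
  fixes \<phi> :: "('s \<Rightarrow>\<^sub>0 int) \<Rightarrow> rat"
  assumes H: "0 \<in> H" "\<And>a b. a \<in> H \<Longrightarrow> b \<in> H \<Longrightarrow> a + b \<in> H" "\<And>k a. a \<in> H \<Longrightarrow> frag_cmul k a \<in> H"
    and add: "\<And>a b. a \<in> H \<Longrightarrow> b \<in> H \<Longrightarrow> \<phi> (a + b) = \<phi> a + \<phi> b"
  shows "\<exists>f. \<forall>h\<in>H. \<phi> h = cochain_eval f h"
proof -
  interpret V: vector_space "\<lambda>q (g::'s \<Rightarrow> rat) x. q * g x"
    by unfold_locales (auto simp: fun_eq_iff algebra_simps)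
  interpret R: vector_space "\<lambda>(q::rat) (g::rat). q * g"
    by unfold_locales (auto simp: algebra_simps)
  interpret VR: vector_space_pair "\<lambda>q (g::'s \<Rightarrow> rat) x. q * g x" "\<lambda>(q::rat) (g::rat). q * g"
    by unfold_locales
  have \<phi>0: "\<phi> 0 = 0" using add[of 0 0] H(1) by simp
  have \<phi>sum: "\<phi> (sum g I) = (\<Sum>i\<in>I. \<phi> (g i)) \<and> sum g I \<in> H" if "\<And>i. i \<in> I \<Longrightarrow> g i \<in> H" for g and I :: "('s \<Rightarrow> rat) set"
    using that by (induction I rule: infinite_finite_induct) (auto simp: \<phi>0 H add)
  have \<phi>nat: "\<phi> (frag_cmul (int n) a) = of_nat n * \<phi> a" if "a \<in> H" for n a
    by (induction n) (auto simp: \<phi>0 H add that frag_cmul_distrib distrib_right)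
  have \<phi>cmul: "\<phi> (frag_cmul k a) = of_int k * \<phi> a" if "a \<in> H" for k a
  proof (cases "k \<ge> 0")
    case True
    then show ?thesis using \<phi>nat[OF that, of "nat k"] by simp
  next
    case False
    have "frag_cmul k a + frag_cmul (- k) a = 0" by (simp flip: frag_cmul_distrib)
    then have "\<phi> (frag_cmul k a) + \<phi> (frag_cmul (- k) a) = 0"
      using add[of "frag_cmul k a" "frag_cmul (- k) a"] H(3) that \<phi>0 by simp
    then show ?thesis using \<phi>nat[OF that, of "nat (- k)"] False by (simp add: of_nat_nat)
  qed
  define \<iota> where "\<iota> c = (\<lambda>s. of_int (Poly_Mapping.lookup c s) :: rat)" for c :: "'s \<Rightarrow>\<^sub>0 int"
  have \<iota>inj: "c = c'" if "\<iota> c = \<iota> c'" for c c'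
    using that by (intro poly_mapping_eqI) (auto simp: \<iota>_def fun_eq_iff)
  \<comment> \<open>A rational basis of the span of \<open>H\<close>, chosen among the integral
    chains so that \<open>\<phi>\<close> prescribes the values on it.\<close>
  obtain B where B: "B \<subseteq> \<iota> ` H" "V.independent B" "\<iota> ` H \<subseteq> V.span B"
    by (rule V.maximal_independent_subset)
  define h where "h b = (SOME c. c \<in> H \<and> \<iota> c = b)" for b
  have h: "h b \<in> H" "\<iota> (h b) = b" if "b \<in> B" for b
    using B(1) that someI_ex[of "\<lambda>c. c \<in> H \<and> \<iota> c = b"] by (auto simp: h_def)
  obtain L where L: "Vector_Spaces.linear (\<lambda>q (g::'s \<Rightarrow> rat) x. q * g x) (\<lambda>(q::rat) (g::rat). q * g) L"
    and LB: "\<forall>b\<in>B. L b = \<phi> (h b)"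
  proof -
    have "\<exists>L. Vector_Spaces.linear (\<lambda>q (g::'s \<Rightarrow> rat) x. q * g x) (\<lambda>(q::rat) (g::rat). q * g) L \<and>
        (\<forall>b\<in>B. L b = \<phi> (h b))"
      by (rule VR.linear_independent_extend[OF B(2)])
    then show thesis using that by blast
  qed
  interpret L: Vector_Spaces.linear "\<lambda>q (g::'s \<Rightarrow> rat) x. q * g x" "\<lambda>(q::rat) (g::rat). q * g" L
    by (rule L)
  \<comment> \<open>Chains have finite support, so the values of \<open>L\<close> at point masses
    determine \<open>L\<close> on all of them.\<close>
  define f where "f s = L (\<lambda>x. if x = s then 1 else 0)" for s
  have Lf: "L (\<iota> c) = cochain_eval f c" for c
  proof -
    have "\<iota> c = (\<Sum>s\<in>Poly_Mapping.keys c. (\<lambda>x. of_int (Poly_Mapping.lookup c s) * (if x = s then 1 else 0)))"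
      by (rule ext) (auto simp: \<iota>_def sum_fun_apply in_keys_iff sum.delta if_distrib cong: if_cong)
    then have "L (\<iota> c) = (\<Sum>s\<in>Poly_Mapping.keys c. of_int (Poly_Mapping.lookup c s) * f s)"
      by (simp only: L.sum L.scale f_def)
    then show ?thesis by (simp add: cochain_eval_def)
  qed
  have "\<phi> c = cochain_eval f c" if c: "c \<in> H" for c
  proof -
    have "\<iota> c \<in> V.span B" using B(3) c by blast
    then obtain t r where t: "finite t" "t \<subseteq> B" "\<iota> c = (\<Sum>b\<in>t. (\<lambda>x. r b * b x))"
      unfolding V.span_explicit by blast
    \<comment> \<open>The expansion of \<open>c\<close> in the basis has rational coefficients, to
      which additivity of \<open>\<phi>\<close> says nothing. A common denominator turns it into an
      identity of integral chains in \<open>H\<close>.\<close>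
    obtain N :: int where N: "N > 0" "\<forall>b\<in>t. \<exists>n::int. of_int N * r b = of_int n"
      using common_denominator[OF t(1)] by blast
    then obtain n where n: "\<And>b. b \<in> t \<Longrightarrow> of_int N * r b = of_int (n b)" by metis
    have "\<iota> (frag_cmul N c) = \<iota> (\<Sum>b\<in>t. frag_cmul (n b) (h b))"
    proof
      fix x
      have "\<iota> c x = (\<Sum>b\<in>t. r b * b x)" by (simp add: t(3) sum_fun_apply)
      then have "\<iota> (frag_cmul N c) x = (\<Sum>b\<in>t. (of_int N * r b) * b x)"
        by (simp add: \<iota>_def sum_distrib_left mult.assoc)
      also have "\<dots> = (\<Sum>b\<in>t. of_int (n b) * \<iota> (h b) x)"
        using n h t(2) by (intro sum.cong) auto
      also have "\<dots> = \<iota> (\<Sum>b\<in>t. frag_cmul (n b) (h b)) x"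
        by (simp add: \<iota>_def lookup_sum)
      finally show "\<iota> (frag_cmul N c) x = \<iota> (\<Sum>b\<in>t. frag_cmul (n b) (h b)) x" .
    qed
    then have eq: "frag_cmul N c = (\<Sum>b\<in>t. frag_cmul (n b) (h b))" by (rule \<iota>inj)
    have "of_int N * \<phi> c = \<phi> (frag_cmul N c)" using c by (simp add: \<phi>cmul)
    also have "\<dots> = (\<Sum>b\<in>t. \<phi> (frag_cmul (n b) (h b)))"
      unfolding eq using h t(2) H(3) by (intro conjunct1[OF \<phi>sum]) auto
    also have "\<dots> = (\<Sum>b\<in>t. of_int (n b) * cochain_eval f (h b))"
      using h t(2) LB by (intro sum.cong) (auto simp: \<phi>cmul subset_iff simp flip: Lf)
    also have "\<dots> = cochain_eval f (frag_cmul N c)"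
      unfolding eq by (simp add: cochain_eval_sum cochain_eval_cmul)
    finally show ?thesis using N(1) by (simp add: cochain_eval_cmul)
  qed
  then show ?thesis by blast
qed

section \<open>Evaluation of cocycles and coboundaries on cycles\<close>

lemma coboundary_eval:
  assumes "singular_chain (Suc p) X c"
  shows "cochain_eval (coboundary p X f) c = cochain_eval f (chain_boundary (Suc p) c)"
proof -
  have "chain_boundary (Suc p) c =
      (\<Sum>s\<in>Poly_Mapping.keys c. frag_cmul (Poly_Mapping.lookup c s)
        (\<Sum>k\<le>Suc p. frag_cmul ((-1) ^ k) (frag_of (singular_face (Suc p) k s))))"
    by (simp only: chain_boundary_def frag_extend_def) simp
  then have "cochain_eval f (chain_boundary (Suc p) c) =
      (\<Sum>s\<in>Poly_Mapping.keys c. of_int (Poly_Mapping.lookup c s) *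
        (\<Sum>k\<le>Suc p. (-1) ^ k * f (singular_face (Suc p) k s)))"
    by (simp only: cochain_eval_sum cochain_eval_cmul cochain_eval_of of_int_power of_int_minus of_int_1)
  also have "\<dots> = cochain_eval (coboundary p X f) c"
    unfolding cochain_eval_def coboundary_def using assms
    by (intro sum.cong) (auto simp: singular_chain_def)
  finally show ?thesis ..
qed

lemma cocycle_eval_boundary:
  assumes "f \<in> rat_cocycles p X" "singular_relboundary p X {} b"
  shows "cochain_eval f b = 0"
proof -
  obtain d where d: "singular_chain (Suc p) X d" "chain_boundary (Suc p) d = b"
    using assms(2) by (auto simp: singular_boundary)
  then have "cochain_eval f b = cochain_eval (\<lambda>_. 0) d"
    using assms(1) coboundary_eval[OF d(1), of f] by (simp add: rat_cocycles_def)
  then show ?thesis by (simp add: cochain_eval_def)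
qed

lemma coboundary_eval_cycle:
  assumes "f \<in> rat_coboundaries p X" "singular_relcycle p X {} z"
  shows "cochain_eval f z = 0"
proof (cases p)
  case 0
  then show ?thesis using assms by (auto simp: rat_coboundaries_def cochain_eval_def)
next
  case (Suc q)
  then obtain g where "f = coboundary q X g" using assms by (auto simp: rat_coboundaries_def)
  then show ?thesis using assms(2) Suc by (simp add: coboundary_eval singular_cycle)
qed

text \<open>Vanishing on cycles makes \<open>f\<close> factor through the boundary map as a
  functional \<open>\<phi>\<close> on boundaries, and an extension of \<open>\<phi>\<close> to all
  chains is a primitive of \<open>f\<close>. In degree 0 every chain is a cycle and \<open>f\<close>
  itself vanishes.\<close>

lemma cochain_in_coboundaries:
  assumes f: "f \<in> rat_cochains p X" and z: "\<And>z. singular_relcycle p X {} z \<Longrightarrow> cochain_eval f z = 0"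
  shows "f \<in> rat_coboundaries p X"
proof (cases p)
  case 0
  have "f s = 0" for s
  proof (cases "singular_simplex p X s")
    case True
    then have "singular_relcycle p X {} (frag_of s)"
      using 0 by (simp add: singular_cycle singular_chain_of chain_boundary_def)
    then show ?thesis using z[of "frag_of s"] by simp
  qed (use f in \<open>auto simp: rat_cochains_def\<close>)
  then show ?thesis using 0 by (auto simp: rat_coboundaries_def)
next
  case (Suc q)
  define H where "H = chain_boundary p ` singular_chain_set p X"
  \<comment> \<open>The chosen preimage does not matter: two preimages differ by a cycle, on which
    \<open>f\<close> vanishes.\<close>
  define \<phi> where "\<phi> b = cochain_eval f (SOME c. singular_chain p X c \<and> chain_boundary p c = b)" for b
  have \<phi>: "\<phi> (chain_boundary p c) = cochain_eval f c" if c: "singular_chain p X c" for c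
  proof -
    define d where "d = (SOME d. singular_chain p X d \<and> chain_boundary p d = chain_boundary p c)"
    have d: "singular_chain p X d" "chain_boundary p d = chain_boundary p c"
      using someI[of "\<lambda>d. singular_chain p X d \<and> chain_boundary p d = chain_boundary p c" c] c
      by (auto simp: d_def)
    have "singular_relcycle p X {} (d - c)"
      using c d by (simp add: singular_cycle singular_chain_diff chain_boundary_diff)
    from z[OF this] show ?thesis by (simp add: \<phi>_def d_def cochain_eval_diff)
  qed
  have "\<exists>g. \<forall>h\<in>H. \<phi> h = cochain_eval g h"
  proof (rule additive_functional_extends)
    show "0 \<in> H" unfolding H_def by (rule image_eqI[of _ _ 0]) auto
    show "a + b \<in> H" if "a \<in> H" "b \<in> H" for a b
      using that unfolding H_def by (auto simp flip: chain_boundary_add intro: singular_chain_add)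
    show "frag_cmul k a \<in> H" if "a \<in> H" for k a
      using that unfolding H_def by (auto simp flip: chain_boundary_cmul intro: singular_chain_cmul)
    show "\<phi> (a + b) = \<phi> a + \<phi> b" if "a \<in> H" "b \<in> H" for a b
      using that unfolding H_def
      by (auto simp: \<phi> cochain_eval_add singular_chain_add simp flip: chain_boundary_add)
  qed
  then obtain g where g: "\<And>h. h \<in> H \<Longrightarrow> \<phi> h = cochain_eval g h" by blast
  \<comment> \<open>The extension has arbitrary values on maps that are not simplices of
    \<open>X\<close>, where a cochain has to vanish.\<close>
  define g' where "g' s = (if singular_simplex q X s then g s else 0)" for s
  have "coboundary q X g' s = f s" for s
  proof (cases "singular_simplex p X s")
    case True
    then have c: "singular_chain p X (frag_of s)" by (simp add: singular_chain_of)
    have "coboundary q X g' s = cochain_eval g' (chain_boundary p (frag_of s))"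
      using coboundary_eval[of q X "frag_of s" g'] c Suc by simp
    also have "\<dots> = cochain_eval g (chain_boundary p (frag_of s))"
      using singular_chain_boundary[OF c] Suc
      by (intro cochain_eval_cong) (auto simp: g'_def singular_chain_def)
    also have "\<dots> = f s" using g \<phi>[OF c] c by (simp add: H_def)
    finally show ?thesis .
  qed (use f Suc in \<open>auto simp: rat_cochains_def coboundary_def\<close>)
  then have "f = coboundary q X g'" by auto
  moreover have "g' \<in> rat_cochains q X" by (auto simp: rat_cochains_def g'_def)
  ultimately show ?thesis using Suc by (auto simp: rat_coboundaries_def)
qed

text \<open>A matrix trace computes the cardinality of a basis.\<close>

lemma cohomology_basis_card_unique:
  assumes S: "cohomology_basis p X S" and T: "cohomology_basis p X T"
  shows "card S = card T"
proof -
  \<comment> \<open>A cochain is a coboundary exactly if it vanishes on cycles, so a cohomology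
    class may be replaced by its values on cycles, extended by 0. Classes become honest functions
    and linear relations hold pointwise.\<close>
  define ev where "ev f = (\<lambda>z. if singular_relcycle p X {} z then cochain_eval f z else 0)" for f
  have kills: "f \<in> rat_coboundaries p X \<longleftrightarrow> (\<forall>z. ev f z = 0)" if "f \<in> rat_cochains p X" for f
    using that cochain_in_coboundaries coboundary_eval_cycle by (force simp: ev_def)
  have finS: "finite S" "finite T" using S T by (auto simp: cohomology_basis_def)
  have coch: "f \<in> rat_cochains p X" if "f \<in> S \<or> f \<in> T" for f
    using that S T by (auto simp: cohomology_basis_def rat_cocycles_def)
  have lin: "ev (\<lambda>s. \<Sum>g\<in>A. c g * g s) z = (\<Sum>g\<in>A. c g * ev g z)" for A c z
    by (simp add: ev_def cochain_eval_lincomb)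
  have coeff: "\<exists>c. \<forall>z. ev f z = (\<Sum>g\<in>A. c g * ev g z)"
    if A: "cohomology_basis p X A" and f: "f \<in> rat_cocycles p X" for A f
  proof -
    obtain c where "(\<lambda>s. f s - (\<Sum>g\<in>A. c g * g s)) \<in> rat_coboundaries p X"
      using A f unfolding cohomology_basis_def by blast
    then have "ev (\<lambda>s. f s - (\<Sum>g\<in>A. c g * g s)) z = 0" for z
      using coboundary_eval_cycle by (force simp: ev_def)
    moreover have "ev (\<lambda>s. f s - (\<Sum>g\<in>A. c g * g s)) z = ev f z - (\<Sum>g\<in>A. c g * ev g z)" for z
      by (simp add: ev_def cochain_eval_diff_left cochain_eval_lincomb)
    ultimately have "\<forall>z. ev f z = (\<Sum>g\<in>A. c g * ev g z)" by simp
    then show ?thesis by (intro exI[of _ c])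
  qed
  have indep: "c f = d f"
    if "cohomology_basis p X A" "\<forall>z. (\<Sum>g\<in>A. c g * ev g z) = (\<Sum>g\<in>A. d g * ev g z)" "f \<in> A" for A c d f
  proof -
    have "(\<lambda>s. \<Sum>g\<in>A. (c g - d g) * g s) \<in> rat_coboundaries p X"
    proof (subst kills)
      show "(\<lambda>s. \<Sum>g\<in>A. (c g - d g) * g s) \<in> rat_cochains p X"
        using that(1) by (auto simp: rat_cochains_def cohomology_basis_def rat_cocycles_def subset_iff intro!: sum.neutral)
      show "\<forall>z. ev (\<lambda>s. \<Sum>g\<in>A. (c g - d g) * g s) z = 0"
        using that(2) unfolding lin by (simp add: left_diff_distrib sum_subtractf)
    qed
    then have "\<forall>g\<in>A. c g - d g = 0"
    proof -
      have "\<forall>c. (\<lambda>s. \<Sum>g\<in>A. c g * g s) \<in> rat_coboundaries p X \<longrightarrow> (\<forall>g\<in>A. c g = 0)"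
        using that(1) unfolding cohomology_basis_def by blast
      from mp[OF spec[OF this, of "\<lambda>g. c g - d g"]] show ?thesis
        using \<open>(\<lambda>s. \<Sum>g\<in>A. (c g - d g) * g s) \<in> rat_coboundaries p X\<close> by blast
    qed
    then show ?thesis using that(3) by simp
  qed
  have "\<forall>f\<in>S. \<exists>c. \<forall>z. ev f z = (\<Sum>g\<in>T. c g * ev g z)"
    using coeff[OF T] S by (auto simp: cohomology_basis_def)
  then obtain M where M: "\<And>f z. f \<in> S \<Longrightarrow> ev f z = (\<Sum>g\<in>T. M f g * ev g z)" by metis
  have "\<forall>f\<in>T. \<exists>c. \<forall>z. ev f z = (\<Sum>g\<in>S. c g * ev g z)"
    using coeff[OF S] T by (auto simp: cohomology_basis_def)
  then obtain N where N: "\<And>f z. f \<in> T \<Longrightarrow> ev f z = (\<Sum>g\<in>S. N f g * ev g z)" by metis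
  have trace: "(\<Sum>h\<in>B. P f h * Q h f) = (1::rat)"
    if P: "\<And>f z. f \<in> A \<Longrightarrow> ev f z = (\<Sum>g\<in>B. P f g * ev g z)"
      and Q: "\<And>f z. f \<in> B \<Longrightarrow> ev f z = (\<Sum>g\<in>A. Q f g * ev g z)"
      and A: "cohomology_basis p X A" and f: "f \<in> A" for A B P Q f
  proof -
    have fin: "finite A" using A by (simp add: cohomology_basis_def)
    have "(\<Sum>g\<in>A. (\<Sum>h\<in>B. P f h * Q h g) * ev g z) = (\<Sum>g\<in>A. (if g = f then 1 else 0) * ev g z)" for z
    proof -
      have "(\<Sum>g\<in>A. (\<Sum>h\<in>B. P f h * Q h g) * ev g z) = (\<Sum>h\<in>B. P f h * (\<Sum>g\<in>A. Q h g * ev g z))"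
        unfolding sum_distrib_left sum_distrib_right by (subst sum.swap) (simp add: mult.assoc)
      also have "\<dots> = ev f z" using P[OF f] Q by simp
      also have "\<dots> = (\<Sum>g\<in>A. (if g = f then 1 else 0) * ev g z)"
        using fin f by (simp add: if_distrib[of "\<lambda>x. x * _"] sum.delta cong: if_cong)
      finally show ?thesis .
    qed
    from indep[OF A allI[OF this] f] show ?thesis by simp
  qed
  \<comment> \<open>The base changes \<open>M\<close> and \<open>N\<close> are mutually inverse, so
    the diagonal entries of both products are 1; the two traces agree by exchanging the
    sums.\<close>
  have "of_nat (card S) = (\<Sum>f\<in>S. \<Sum>h\<in>T. M f h * N h f)"
    using trace[OF M N S] by simp
  also have "\<dots> = (\<Sum>h\<in>T. \<Sum>f\<in>S. N h f * M f h)"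
    by (subst sum.swap) (simp add: mult.commute)
  also have "\<dots> = of_nat (card T)"
    using trace[OF N M T] by simp
  finally show ?thesis by (simp only: of_nat_eq_iff)
qed

text \<open>A rational form of universal coefficients. The \<open>g i\<close> are independent modulo
  boundaries and generate every cycle up to a nonzero multiple, so each cycle has rational
  coordinates with respect to them. The coordinate functionals, extended from cycles to chains, are
  cocycles dual to the \<open>g i\<close>, and a cocycle is determined modulo coboundaries by its
  values on the \<open>g i\<close>.\<close>

lemma cohomology_basis_dual:
  fixes g :: "nat \<Rightarrow> 'a chain"
  assumes I: "finite I" and cyc: "\<And>i. i \<in> I \<Longrightarrow> singular_relcycle p X {} (g i)"
    and ind: "\<And>n i. singular_relboundary p X {} (\<Sum>i\<in>I. frag_cmul (n i) (g i)) \<Longrightarrow> i \<in> I \<Longrightarrow> n i = 0"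
    and gen: "\<And>z. singular_relcycle p X {} z \<Longrightarrow>
      \<exists>k n. k \<noteq> 0 \<and> singular_relboundary p X {} (frag_cmul k z - (\<Sum>i\<in>I. frag_cmul (n i) (g i)))"
  shows "\<exists>S. cohomology_basis p X S \<and> card S = card I"
proof -
  let ?Z = "\<lambda>z. singular_relcycle p X {} z" and ?B = "\<lambda>z. singular_relboundary p X {} z"
  let ?G = "\<lambda>n. \<Sum>i\<in>I. frag_cmul (n i) (g i)"
  have Gadd: "?G (\<lambda>i. m i + n i) = ?G m + ?G n" for m n
    by (simp add: frag_cmul_distrib sum.distrib)
  have Gcmul: "frag_cmul k (?G n) = ?G (\<lambda>i. k * n i)" for k n
    by (simp add: frag_cmul_sum)
  obtain k n where kn: "\<And>z. ?Z z \<Longrightarrow> k z \<noteq> 0 \<and> ?B (frag_cmul (k z) z - ?G (n z))"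
    using gen by metis
  \<comment> \<open>The \<open>j\<close>-th rational coordinate of the class of \<open>z\<close>; by
    \<open>\<phi>eq\<close> it does not depend on the multiple \<open>k z\<close>.\<close>
  define \<phi> where "\<phi> j z = (of_int (n z j) / of_int (k z) :: rat)" for j z
  have \<phi>eq: "\<phi> j z = of_int (m j) / of_int l"
    if z: "?Z z" and l: "l \<noteq> 0" "?B (frag_cmul l z - ?G m)" and j: "j \<in> I" for z l m j
  proof -
    \<comment> \<open>Cross-multiplying two relations for \<open>z\<close> eliminates
      \<open>z\<close>, and independence then compares the coefficients.\<close>
    have "?B (frag_cmul l (frag_cmul (k z) z - ?G (n z)) - frag_cmul (k z) (frag_cmul l z - ?G m))"
      using kn[OF z] l by (blast intro: singular_relboundary_diff singular_relboundary_cmul)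
    also have "frag_cmul l (frag_cmul (k z) z - ?G (n z)) - frag_cmul (k z) (frag_cmul l z - ?G m) =
       ?G (\<lambda>i. k z * m i - l * n z i)"
    proof -
      have "?G (\<lambda>i. k z * m i - l * n z i) = ?G (\<lambda>i. k z * m i) - ?G (\<lambda>i. l * n z i)"
        using Gadd[of "\<lambda>i. k z * m i - l * n z i" "\<lambda>i. l * n z i"] by (simp add: eq_diff_eq)
      then show ?thesis by (simp only: frag_cmul_diff Gcmul) (simp add: mult.commute)
    qed
    finally have "k z * m j - l * n z j = 0" by (rule ind[OF _ j])
    then have "rat_of_int (k z) * of_int (m j) = of_int l * of_int (n z j)"
      by (simp flip: of_int_mult)
    then show ?thesis using kn[OF z] l by (simp add: \<phi>_def field_simps)
  qed
  have "\<exists>f. \<forall>z\<in>{z. ?Z z}. \<phi> j z = cochain_eval f z" if j: "j \<in> I" for j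
  proof (rule additive_functional_extends)
    show "\<phi> j (a + b) = \<phi> j a + \<phi> j b" if "a \<in> {z. ?Z z}" "b \<in> {z. ?Z z}" for a b
    proof -
      have ab: "?Z a" "?Z b" using that by auto
      have "?B (frag_cmul (k b) (frag_cmul (k a) a - ?G (n a)) + frag_cmul (k a) (frag_cmul (k b) b - ?G (n b)))"
        using kn ab by (blast intro: singular_relboundary_add singular_relboundary_cmul)
      also have "frag_cmul (k b) (frag_cmul (k a) a - ?G (n a)) + frag_cmul (k a) (frag_cmul (k b) b - ?G (n b)) =
          frag_cmul (k a * k b) (a + b) - ?G (\<lambda>i. k b * n a i + k a * n b i)"
        by (simp only: frag_cmul_diff frag_cmul_distrib2 Gadd flip: Gcmul) (simp add: mult.commute)
      finally have "\<phi> j (a + b) = of_int (k b * n a j + k a * n b j) / of_int (k a * k b)"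
        using ab kn j by (intro \<phi>eq) (auto simp: singular_relcycle_add)
      also have "\<dots> = \<phi> j a + \<phi> j b"
        using kn[OF ab(1)] kn[OF ab(2)] by (simp add: \<phi>_def field_simps)
      finally show ?thesis .
    qed
  qed (auto simp: singular_relcycle_add singular_relcycle_cmul)
  then obtain f where f: "\<And>j z. j \<in> I \<Longrightarrow> ?Z z \<Longrightarrow> \<phi> j z = cochain_eval (f j) z"
    by (metis mem_Collect_eq)
  define f' where "f' j = (\<lambda>s. if singular_simplex p X s then f j s else 0)" for j
  have f': "cochain_eval (f' j) z = \<phi> j z" if "j \<in> I" "?Z z" for j z
    unfolding f[OF that] using that(2)
    by (intro cochain_eval_cong) (auto simp: f'_def singular_cycle singular_chain_def)
  have \<phi>B: "\<phi> j z = 0" if "?B z" "j \<in> I" for j z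
    using \<phi>eq[of z 1 "\<lambda>_. 0" j] that by (simp add: singular_relboundary_imp_relcycle)
  have coc: "f' j \<in> rat_cocycles p X" if j: "j \<in> I" for j
  proof -
    have "coboundary p X (f' j) s = 0" for s
    proof (cases "singular_simplex (Suc p) X s")
      case True
      then have c: "singular_chain (Suc p) X (frag_of s)" by (simp add: singular_chain_of)
      then have b: "?B (chain_boundary (Suc p) (frag_of s))" by (auto simp: singular_boundary)
      have "coboundary p X (f' j) s = cochain_eval (f' j) (chain_boundary (Suc p) (frag_of s))"
        using coboundary_eval[OF c] by simp
      also have "\<dots> = 0"
        using f'[OF j] \<phi>B[OF b j] b by (simp add: singular_relboundary_imp_relcycle)
      finally show ?thesis .
    qed (simp add: coboundary_def)
    then show ?thesis by (auto simp: rat_cocycles_def rat_cochains_def f'_def)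
  qed
  have dual: "cochain_eval (f' j) (g i) = (if i = j then 1 else 0)" if "i \<in> I" "j \<in> I" for i j
  proof -
    have "?G (\<lambda>l. if l = i then 1 else 0) = g i"
      using I that by (simp add: if_distrib[of "\<lambda>x. frag_cmul x _"] cong: if_cong)
    then have "\<phi> j (g i) = of_int (if j = i then 1 else 0) / of_int 1"
      using that cyc by (intro \<phi>eq) auto
    then show ?thesis using f'[OF that(2) cyc[OF that(1)]] by simp
  qed
  have inj: "inj_on f' I"
  proof
    fix i j assume "i \<in> I" "j \<in> I" "f' i = f' j"
    then show "i = j" using dual[of i i] dual[of i j] by (auto split: if_splits)
  qed
  have "cohomology_basis p X (f' ` I)"
    unfolding cohomology_basis_def
  proof (intro conjI allI ballI impI)
    show "finite (f' ` I)" using I by simp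
    show "f' ` I \<subseteq> rat_cocycles p X" using coc by auto
    show "c h = 0" if cb: "(\<lambda>s. \<Sum>h\<in>f' ` I. c h * h s) \<in> rat_coboundaries p X" and h: "h \<in> f' ` I" for c h
    proof -
      obtain j where j: "j \<in> I" "h = f' j" using h by auto
      have "0 = cochain_eval (\<lambda>s. \<Sum>h\<in>f' ` I. c h * h s) (g j)"
        using coboundary_eval_cycle[OF cb cyc[OF j(1)]] by simp
      also have "\<dots> = (\<Sum>i\<in>I. c (f' i) * cochain_eval (f' i) (g j))"
        unfolding cochain_eval_lincomb using inj by (simp add: sum.reindex)
      also have "\<dots> = (\<Sum>i\<in>I. if j = i then c (f' i) else 0)"
        using j(1) by (intro sum.cong) (auto simp: dual)
      also have "\<dots> = c h" using I j by simp
      finally show ?thesis by simp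
    qed
    show "\<exists>c. (\<lambda>s. h s - (\<Sum>h'\<in>f' ` I. c h' * h' s)) \<in> rat_coboundaries p X" if h: "h \<in> rat_cocycles p X" for h
    \<comment> \<open>In a dual basis, the coefficients of \<open>h\<close> are its values on the
      cycles \<open>g i\<close>.\<close>
    proof (intro exI[of _ "\<lambda>h'. cochain_eval h (g (the_inv_into I f' h'))"] cochain_in_coboundaries)
      let ?h = "\<lambda>s. h s - (\<Sum>h'\<in>f' ` I. cochain_eval h (g (the_inv_into I f' h')) * h' s)"
      show "?h \<in> rat_cochains p X"
        using h coc by (auto simp: rat_cochains_def rat_cocycles_def f'_def intro!: sum.neutral)
      fix z assume z: "?Z z"
      have "of_int (k z) * cochain_eval h z = cochain_eval h (frag_cmul (k z) z)"
        by (simp add: cochain_eval_cmul)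
      also have "\<dots> = cochain_eval h (?G (n z))"
        using cocycle_eval_boundary[OF h conjunct2[OF kn[OF z]]] by (simp add: cochain_eval_diff)
      also have "\<dots> = (\<Sum>i\<in>I. of_int (n z i) * cochain_eval h (g i))"
        by (simp add: cochain_eval_sum cochain_eval_cmul)
      finally have "cochain_eval h z = (\<Sum>i\<in>I. of_int (n z i) * cochain_eval h (g i)) / of_int (k z)"
        using kn[OF z] by (simp add: eq_divide_eq mult.commute)
      also have "\<dots> = (\<Sum>i\<in>I. cochain_eval h (g i) * \<phi> i z)"
        unfolding sum_divide_distrib \<phi>_def by (intro sum.cong) auto
      finally have "cochain_eval h z = (\<Sum>i\<in>I. cochain_eval h (g i) * \<phi> i z)" .
      moreover have "cochain_eval (\<lambda>s. \<Sum>h'\<in>f' ` I. cochain_eval h (g (the_inv_into I f' h')) * h' s) z =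
          (\<Sum>i\<in>I. cochain_eval h (g i) * \<phi> i z)"
      proof -
        have "cochain_eval (\<lambda>s. \<Sum>h'\<in>f' ` I. cochain_eval h (g (the_inv_into I f' h')) * h' s) z =
            (\<Sum>i\<in>I. cochain_eval h (g (the_inv_into I f' (f' i))) * cochain_eval (f' i) z)"
          unfolding cochain_eval_lincomb by (subst sum.reindex[OF inj]) simp
        also have "\<dots> = (\<Sum>i\<in>I. cochain_eval h (g i) * \<phi> i z)"
          by (intro sum.cong refl) (simp only: the_inv_into_f_f[OF inj] f'[OF _ z])
        finally show ?thesis .
      qed
      ultimately show "cochain_eval ?h z = 0" unfolding cochain_eval_diff_left by linarith
    qed
  qed
  then show ?thesis using inj by (intro exI[of _ "f' ` I"]) (simp add: card_image)
qed

lemma finprod_relcycle_group: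
  assumes "finite I" "\<And>i. i \<in> I \<Longrightarrow> singular_relcycle p X S (g i)"
  shows "finprod (relcycle_group p X S) (\<lambda>i. g i [^]\<^bsub>relcycle_group p X S\<^esub> (n i :: int)) I =
    (\<Sum>i\<in>I. frag_cmul (n i) (g i))"
proof -
  interpret Z: comm_group "relcycle_group p X S" by simp
  have pow: "z [^]\<^bsub>relcycle_group p X S\<^esub> (m::int) = frag_cmul m z" if z: "singular_relcycle p X S z" for z m
  proof -
    have "z \<in> carrier (relcycle_group p X S)" using z by simp
    then have "z [^]\<^bsub>relcycle_group p X S\<^esub> m = z [^]\<^bsub>chain_group p X\<^esub> m"
      unfolding relcycle_group_def by (intro group.int_pow_subgroup_generated group_chain_group)
    also have "\<dots> = frag_cmul m z"
      using z unfolding chain_group_def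
      by (intro int_pow_free_Abelian_group) (auto simp: singular_relcycle_def singular_chain_def)
    finally show ?thesis .
  qed
  show ?thesis using assms
  proof (induction I)
    case (insert x I)
    have "finprod (relcycle_group p X S) (\<lambda>i. g i [^]\<^bsub>relcycle_group p X S\<^esub> (n i :: int)) (insert x I) =
       g x [^]\<^bsub>relcycle_group p X S\<^esub> n x \<otimes>\<^bsub>relcycle_group p X S\<^esub>
       finprod (relcycle_group p X S) (\<lambda>i. g i [^]\<^bsub>relcycle_group p X S\<^esub> (n i :: int)) I"
      using insert by (intro Z.finprod_insert) (auto simp: pow singular_relcycle_cmul)
    then show ?case using insert by (simp add: pow)
  qed simp
qed

text \<open>Cycles representing an independent family of maximal size satisfy both hypotheses of the
  dual basis: maximality gives each cycle a nonzero multiple in their span modulo boundaries.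
  Uniqueness of the cardinality enters because \<open>betti\<close> is a definite
  description.\<close>

proposition betti_eq_rank:
  assumes "ab_rank (homology_group (int p) X) (carrier (homology_group (int p) X)) = enat d"
  shows "(\<exists>S. cohomology_basis p X S) \<and> betti p X = d"
proof -
  let ?H = "homology_group (int p) X" and ?C = "relcycle_group p X {}"
  interpret H: comm_group ?H by (rule abelian_relative_homology_group)
  interpret C: comm_group ?C by simp
  define q where "q z = homologous_rel_set p X {} z" for z :: "'a chain"
  have qr: "q = (\<lambda>z. singular_relboundary_set p X {} #>\<^bsub>?C\<^esub> z)"
    by (simp add: q_def[abs_def] right_coset_singular_relboundary)
  have "q \<in> hom ?C ?H"
    unfolding qr nontrivial_relative_homology_group
    by (intro normal.r_coset_hom_Mod normal_subgroup_singular_relboundary_relcycle)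
  then interpret q: group_hom ?C ?H q
    by (simp add: group_hom_def group_hom_axioms_def)
  have q1: "q z = \<one>\<^bsub>?H\<^esub> \<longleftrightarrow> singular_relboundary p X {} z" for z
    by (simp add: q_def homologous_rel_set_eq_relboundary)
  have qsum: "q (\<Sum>i\<in>I. frag_cmul (n i) (g i)) = finprod ?H (\<lambda>i. q (g i) [^]\<^bsub>?H\<^esub> n i) I"
    if "finite I" "\<And>i. i \<in> I \<Longrightarrow> singular_relcycle p X {} (g i)" for I :: "nat set" and n g
    using q.hom_finprod_int_pow[OF C.comm_group_axioms H.comm_group_axioms, of g I n] that
    by (simp add: finprod_relcycle_group)
  obtain u :: "nat \<Rightarrow> 'a chain set" and I
    where u: "H.indep_family u I" "u \<in> I \<rightarrow> carrier ?H" "card I = d"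
    using H.ab_rank_attained[OF assms] by blast
  have fin: "finite I" using u by (simp add: H.indep_family_def)
  have "\<forall>i\<in>I. \<exists>z. singular_relcycle p X {} z \<and> u i = q z"
    using u(2) by (auto simp: carrier_relative_homology_group q_def Pi_iff)
  then obtain g where g: "\<And>i. i \<in> I \<Longrightarrow> singular_relcycle p X {} (g i)" "\<And>i. i \<in> I \<Longrightarrow> u i = q (g i)"
    by metis
  have fp: "finprod ?H (\<lambda>i. u i [^]\<^bsub>?H\<^esub> (n i :: int)) I = q (\<Sum>i\<in>I. frag_cmul (n i) (g i))" for n
  proof -
    have "q (\<Sum>i\<in>I. frag_cmul (n i) (g i)) = finprod ?H (\<lambda>i. q (g i) [^]\<^bsub>?H\<^esub> n i) I"
      by (rule qsum[OF fin]) (rule g(1))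
    also have "\<dots> = finprod ?H (\<lambda>i. u i [^]\<^bsub>?H\<^esub> (n i :: int)) I"
      using g u(2) by (intro H.finprod_cong') (auto simp: Pi_iff)
    finally show ?thesis ..
  qed
  have "\<exists>S. cohomology_basis p X S \<and> card S = card I"
  proof (rule cohomology_basis_dual[OF fin g(1)])
    show "n i = 0" if "singular_relboundary p X {} (\<Sum>i\<in>I. frag_cmul (n i) (g i))" "i \<in> I" for n i
      using H.indep_familyD[OF u(1), of n i, unfolded fp q1] that by blast
    show "\<exists>k n. k \<noteq> 0 \<and> singular_relboundary p X {} (frag_cmul k z - (\<Sum>i\<in>I. frag_cmul (n i) (g i)))"
      if z: "singular_relcycle p X {} z" for z
    proof -
      have rk: "ab_rank ?H (carrier ?H) \<le> enat (card I)" using assms u(3) by simp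
      have qz: "q z \<in> carrier ?H" using z by (intro q.hom_closed) simp
      obtain k :: int and n :: "nat \<Rightarrow> int" where kn: "k \<noteq> 0" "q z [^]\<^bsub>?H\<^esub> k = finprod ?H (\<lambda>i. u i [^]\<^bsub>?H\<^esub> n i) I"
        by (rule H.indep_family_maximal[OF u(1) qz subset_refl u(2) rk])
      have "q (frag_cmul k z) = q z [^]\<^bsub>?H\<^esub> k"
        using qsum[of "{0}" "\<lambda>_. z" "\<lambda>_. k"] z qz H.r_one[OF H.int_pow_closed[OF qz, of k]]
        by (simp add: H.finprod_insert)
      then have "q (frag_cmul k z) = q (\<Sum>i\<in>I. frag_cmul (n i) (g i))" using kn by (simp add: fp)
      then have "homologous_rel p X {} (frag_cmul k z) (\<Sum>i\<in>I. frag_cmul (n i) (g i))"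
      proof -
        assume eq: "q (frag_cmul k z) = q (\<Sum>i\<in>I. frag_cmul (n i) (g i))"
        have "(\<Sum>i\<in>I. frag_cmul (n i) (g i)) \<in> q (\<Sum>i\<in>I. frag_cmul (n i) (g i))"
          by (simp add: q_def)
        then show ?thesis unfolding eq[symmetric] by (simp add: q_def)
      qed
      then show ?thesis using kn(1) by (auto simp: homologous_rel_def)
    qed
  qed
  then obtain S where S: "cohomology_basis p X S" "card S = d" using u(3) by auto
  have "betti p X = d"
    unfolding betti_def
  proof (rule the_equality)
    show "\<exists>S. cohomology_basis p X S \<and> card S = d" using S by blast
    show "d' = d" if "\<exists>S. cohomology_basis p X S \<and> card S = d'" for d'
      using that S(2) cohomology_basis_card_unique[OF S(1)] by auto
  qed
  then show ?thesis using S by blast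
qed

section \<open>Euler characteristics of open covers\<close>

lemma euler_characteristic_eq:
  assumes "has_euler_char X {} e"
  shows "finite_total_cohomology X \<and> euler_characteristic X = e"
proof -
  obtain r where r: "\<And>p. relhom_rank p X {} = enat (r p)" "finite {p. r p \<noteq> 0}"
    and e: "e = (\<Sum>p | r p \<noteq> 0. (-1) ^ p * int (r p))"
    using assms by (auto simp: has_euler_char_def finite_ranks_def)
  have "(\<exists>S. cohomology_basis p X S) \<and> betti p X = r p" for p
    using r(1) by (rule betti_eq_rank)
  then show ?thesis
    using r(2) e by (simp add: finite_total_cohomology_def euler_characteristic_def)
qed

lemma has_euler_char_disjoint_contractible:
  assumes "finite I"
    and "\<And>i. i \<in> I \<Longrightarrow> openin X (K i) \<and> K i \<noteq> {} \<and> contractible_space (subtopology X (K i))"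
    and "disjoint_family_on K I"
  shows "has_euler_char (subtopology X (\<Union>i\<in>I. K i)) {} (int (card I))"
  using assms
proof (induction I)
  case empty
  then show ?case by (simp add: has_euler_char_empty)
next
  case (insert i I)
  have i: "openin X (K i)" "K i \<noteq> {}" "contractible_space (subtopology X (K i))"
    using insert.prems by auto
  have 1: "has_euler_char (subtopology X (K i)) {} 1"
    using i openin_subset[OF i(1)] by (intro has_euler_char_contractible) auto
  have 2: "has_euler_char (subtopology X (\<Union>i\<in>I. K i)) {} (int (card I))"
    using insert by (auto simp: disjoint_family_on_def)
  have disj: "K i \<inter> (\<Union>i\<in>I. K i) = {}"
    using insert.prems(2) insert.hyps(2) by (auto simp: disjoint_family_on_def)
  have 3: "has_euler_char (subtopology X (K i \<inter> (\<Union>i\<in>I. K i))) {} 0"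
    by (intro has_euler_char_empty) (simp add: disj)
  have "has_euler_char (subtopology X (K i \<union> (\<Union>i\<in>I. K i))) {} (1 + int (card I) - 0)"
    using insert.prems by (intro has_euler_char_Un_open i(1) 1 2 3) auto
  then show ?case using insert.hyps by simp
qed

text \<open>The expansion of \<open>2 ^ r * (1 - 1 / 2) ^ card c\<close> over the subsets of
  \<open>c\<close>; the bound on \<open>card c\<close> keeps the truncated subtraction exact. It
  says that the contributions of all faces of a cone add up to the number of pieces of its
  chart.\<close>

lemma sum_Pow_faces:
  assumes "finite c" "card c \<le> r"
  shows "(\<Sum>d\<in>Pow c. (-1) ^ card d * 2 ^ (r - card d)) = (2::int) ^ (r - card c)"
  using assms
proof (induction c arbitrary: r)
  case (insert a c)
  have r: "r > 0" "card c \<le> r - 1" using insert by auto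
  have "(\<Sum>d\<in>Pow (insert a c). (-1) ^ card d * 2 ^ (r - card d)) =
      (\<Sum>d\<in>Pow c. (-1) ^ card d * 2 ^ (r - card d)) +
      (\<Sum>d\<in>insert a ` Pow c. (-1) ^ card d * 2 ^ (r - card d) :: int)"
    unfolding Pow_insert using insert by (intro sum.union_disjoint) auto
  also have "(\<Sum>d\<in>insert a ` Pow c. (-1) ^ card d * 2 ^ (r - card d) :: int) =
      (\<Sum>d\<in>Pow c. (-1) ^ card (insert a d) * 2 ^ (r - card (insert a d)))"
  proof (intro sum.reindex_cong[where l = "insert a"] inj_onI)
    show "x = y" if "x \<in> Pow c" "y \<in> Pow c" "insert a x = insert a y" for x y
      using that insert.hyps(2) by (metis PowD insert_ident subsetD)
  qed auto
  also have "\<dots> = (\<Sum>d\<in>Pow c. - ((-1) ^ card d * 2 ^ (r - 1 - card d)))"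
  proof (rule sum.cong)
    fix d assume "d \<in> Pow c"
    then have "card (insert a d) = Suc (card d)"
      using insert by (auto intro!: card_insert_disjoint dest: finite_subset)
    then show "(-1) ^ card (insert a d) * 2 ^ (r - card (insert a d)) = (- ((-1) ^ card d * 2 ^ (r - 1 - card d)) :: int)"
      by simp
  qed simp
  also have "\<dots> = - (2 ^ (r - 1 - card c))"
    using insert.IH[OF r(2)] by (simp add: sum_negf)
  also have "(\<Sum>d\<in>Pow c. (-1) ^ card d * 2 ^ (r - card d)) = (2::int) ^ (r - card c)"
    using insert by (intro insert.IH) auto
  finally have "(\<Sum>d\<in>Pow (insert a c). (-1) ^ card d * 2 ^ (r - card d)) =
      (2::int) ^ (r - card c) - 2 ^ (r - 1 - card c)" by simp
  also have "r - card c = Suc (r - 1 - card c)" using r by simp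
  also have "r - 1 - card c = r - card (insert a c)" using insert r by simp
  finally show ?case by simp
qed simp

text \<open>
  The sets \<open>U c\<close> are the charts of the cones \<open>c\<close>, each homotopy equivalent to \<open>2 ^ (r - card c)\<close> points. Adding
  the cones of a simplicial fan in an order that starts with the faces shows that each of them contributes
  \<open>(-1) ^ card c * 2 ^ (r - card c)\<close> to the Euler characteristic.
\<close>

proposition has_euler_char_fan:
  fixes U :: "'b set \<Rightarrow> 'a set"
  assumes "finite G"
    and down: "\<And>c d. c \<in> G \<Longrightarrow> d \<subseteq> c \<Longrightarrow> d \<in> G"
    and fin: "\<And>c. c \<in> G \<Longrightarrow> finite c \<and> card c \<le> r"
    and opn: "\<And>c. c \<in> G \<Longrightarrow> openin X (U c)"
    and int: "\<And>c d. c \<in> G \<Longrightarrow> d \<in> G \<Longrightarrow> U c \<inter> U d = U (c \<inter> d)"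
    and chi: "\<And>c. c \<in> G \<Longrightarrow> has_euler_char (subtopology X (U c)) {} (2 ^ (r - card c))"
  shows "has_euler_char (subtopology X (\<Union>c\<in>G. U c)) {} (\<Sum>c\<in>G. (-1) ^ card c * 2 ^ (r - card c))"
  using assms
proof (induction "card G" arbitrary: G rule: less_induct)
  case less
  show ?case
  proof (cases "G = {}")
    case True
    then show ?thesis by (simp add: has_euler_char_empty)
  next
    case False
    \<comment> \<open>A maximal cone is removed: what remains is still closed under faces, and every
      remaining cone meets it in a proper face.\<close>
    then obtain c where c: "c \<in> G" and max: "\<forall>d\<in>G. c \<subseteq> d \<longrightarrow> c = d"
      using finite_has_maximal[OF less.prems(1)] by blast
    have mono: "U d \<subseteq> U c" if "d \<subseteq> c" for d
      using less.prems(5)[of d c] less.prems(2)[OF c that] c that by (auto simp: Int_absorb2)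
    have Pow: "Pow c \<subseteq> G" using less.prems(2) c by blast
    show ?thesis
    proof (cases "G = Pow c")
      case True
      have "(\<Union>d\<in>G. U d) = U c" using True mono by auto
      then show ?thesis
        using less.prems(3,6)[OF c] sum_Pow_faces[of c r] by (simp add: True)
    next
      case ne: False
      let ?e = "\<lambda>c. (-1) ^ card c * 2 ^ (r - card c) :: int"
      define P where "P = Pow c - {c}"
      have finP: "finite P" using less.prems(3)[OF c] by (simp add: P_def)
      have 1: "has_euler_char (subtopology X (\<Union>d\<in>G - {c}. U d)) {} (\<Sum>d\<in>G - {c}. ?e d)"
      proof (rule less.hyps)
        show "card (G - {c}) < card G" using less.prems(1) c by (rule card_Diff1_less)
        show "d \<in> G - {c}" if "b \<in> G - {c}" "d \<subseteq> b" for b d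
          using that less.prems(2)[of b d] max by auto
      qed (use less.prems in auto)
      have 2: "has_euler_char (subtopology X (\<Union>d\<in>P. U d)) {} (\<Sum>d\<in>P. ?e d)"
      proof (rule less.hyps)
        show "card P < card G" using less.prems(1) Pow c by (intro psubset_card_mono) (auto simp: P_def)
        show "d \<in> P" if "b \<in> P" "d \<subseteq> b" for b d using that by (auto simp: P_def)
      qed (use less.prems finP Pow in \<open>auto simp: P_def subset_iff\<close>)
      have 3: "has_euler_char (subtopology X (U c)) {} (\<Sum>d\<in>Pow c. ?e d)"
        using less.prems(3,6)[OF c] sum_Pow_faces[of c r] by simp
      \<comment> \<open>The new chart meets the union of the old ones in the charts of the proper
        faces of \<open>c\<close>, whose value is known by induction.\<close>
      have int: "(\<Union>d\<in>G - {c}. U d) \<inter> U c = (\<Union>d\<in>P. U d)"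
      proof
        show "(\<Union>d\<in>G - {c}. U d) \<inter> U c \<subseteq> (\<Union>d\<in>P. U d)"
        proof
          fix x assume "x \<in> (\<Union>d\<in>G - {c}. U d) \<inter> U c"
          then obtain d where x: "x \<in> U c" "x \<in> U d" and d: "d \<in> G" "d \<noteq> c" by blast
          have "x \<in> U (d \<inter> c)" using less.prems(5)[OF d(1) c] x by blast
          moreover have "d \<inter> c \<in> P" using max d by (auto simp: P_def)
          ultimately show "x \<in> (\<Union>d\<in>P. U d)" by blast
        qed
        show "(\<Union>d\<in>P. U d) \<subseteq> (\<Union>d\<in>G - {c}. U d) \<inter> U c"
          using mono Pow by (auto simp: P_def)
      qed
      have "has_euler_char (subtopology X ((\<Union>d\<in>G - {c}. U d) \<union> U c)) {}
          ((\<Sum>d\<in>G - {c}. ?e d) + (\<Sum>d\<in>Pow c. ?e d) - (\<Sum>d\<in>P. ?e d))"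
        using less.prems(4) c by (intro has_euler_char_Un_open 1 3) (auto simp: int 2)
      moreover have "(\<Union>d\<in>G - {c}. U d) \<union> U c = (\<Union>d\<in>G. U d)" using c by auto
      moreover have "(\<Sum>d\<in>Pow c. ?e d) - (\<Sum>d\<in>P. ?e d) = ?e c"
        using sum.remove[of "Pow c" c ?e] less.prems(3)[OF c] by (simp add: P_def)
      moreover have "(\<Sum>d\<in>G. ?e d) = ?e c + (\<Sum>d\<in>G - {c}. ?e d)"
        using c less.prems(1) by (rule sum.remove[rotated])
      ultimately show ?thesis by (simp add: algebra_simps)
    qed
  qed
qed

section \<open>Euler numbers\<close>

lemma higher_deriv_has_fps_expansion:
  fixes f :: "'a::{banach,real_normed_field} \<Rightarrow> 'a"
  assumes "f has_fps_expansion F"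
  shows "(deriv ^^ n) f has_fps_expansion (fps_deriv ^^ n) F"
  by (induction n) (auto intro: has_fps_expansion_deriv assms)

lemma fps_nth_0_funpow_deriv: "fps_nth ((fps_deriv ^^ n) F) 0 = fact n * (fps_nth F n :: 'a :: field_char_0)"
proof (induction n arbitrary: F)
  case (Suc n)
  have "fps_nth ((fps_deriv ^^ Suc n) F) 0 = fps_nth ((fps_deriv ^^ n) (fps_deriv F)) 0"
    by (simp only: funpow_Suc_right comp_apply)
  then show ?case by (simp add: Suc mult_ac)
qed simp

lemma euler_number_eq: "euler_number n = fact n * fps_nth (fps_tan 1) n"
proof -
  have "(deriv ^^ n) (tan :: real \<Rightarrow> real) has_fps_expansion (fps_deriv ^^ n) (fps_tan 1)"
    by (intro higher_deriv_has_fps_expansion has_fps_expansion_tan')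
  then have "(deriv ^^ n) (tan :: real \<Rightarrow> real) 0 = fps_nth ((fps_deriv ^^ n) (fps_tan 1)) 0"
    unfolding has_fps_expansion_def by (auto dest: eventually_nhds_x_imp_x simp: eval_fps_at_0)
  then show ?thesis by (simp add: euler_number_def fps_nth_0_funpow_deriv)
qed

text \<open>This is \<open>\<i> * tan x = (exp (2 * \<i> * x) - 1) / (exp (2 * \<i> * x) +
  1)\<close> without division. It follows from the exponential forms of sine and cosine after
  multiplication by \<open>exp (\<i> * x)\<close>.\<close>

lemma fps_tan_exp: "fps_const \<i> * fps_tan 1 * (fps_exp (2 * \<i>) + 1) = fps_exp (2 * \<i>) - 1"
proof -
  let ?E = "fps_exp \<i> :: complex fps" and ?F = "fps_exp (- \<i>) :: complex fps"
  have EF: "?E * ?F = 1" "?E * ?E = fps_exp (2 * \<i>)"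
    by (simp_all flip: fps_exp_add_mult)
  have sin: "fps_sin (1::complex) * fps_const (2 * \<i>) = ?E - ?F"
    by (simp add: fps_sin_fps_exp_ii)
  have cos: "fps_cos (1::complex) * 2 = ?E + ?F"
    by (simp add: fps_cos_fps_exp_ii numeral_fps_const)
  have "fps_tan (1::complex) * fps_cos 1 = fps_sin 1"
    by (simp add: fps_tan_def)
  then have "fps_tan 1 * (fps_cos 1 * 2) * fps_const \<i> = fps_sin (1::complex) * fps_const (2 * \<i>)"
    by (simp add: numeral_fps_const mult_ac flip: fps_const_mult)
  then have "fps_const \<i> * fps_tan 1 * (?E + ?F) * ?E = (?E - ?F) * ?E"
    unfolding sin cos by (simp add: mult_ac)
  moreover have "(?E + ?F) * ?E = fps_exp (2 * \<i>) + 1" "(?E - ?F) * ?E = fps_exp (2 * \<i>) - 1"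
    using EF by (simp_all add: algebra_simps)
  ultimately show ?thesis by (simp only: mult.assoc)
qed

lemma fps_tan_convolution:
  "(\<Sum>i\<le>n. fps_nth (fps_tan 1) i * fps_nth (fps_cos 1) (n - i)) = fps_nth (fps_sin (1::'a::field_char_0)) n"
proof -
  have "fps_tan 1 * fps_cos (1::'a) = fps_sin 1"
    by (simp add: fps_tan_def)
  then show ?thesis by (metis fps_mult_nth atLeast0AtMost)
qed

text \<open>The product \<open>tan * cos = sin\<close> is a recursion for the coefficients over
  either field: its data are real, and the cosine has constant term 1.\<close>

lemma fps_nth_fps_tan_of_real: "fps_nth (fps_tan 1) n = complex_of_real (fps_nth (fps_tan 1) n)"
proof (induction n rule: less_induct)
  case (less n)
  have cs: "fps_nth (fps_cos (1::complex)) n = complex_of_real (fps_nth (fps_cos 1) n)"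
    "fps_nth (fps_sin (1::complex)) n = complex_of_real (fps_nth (fps_sin 1) n)" for n
    by (auto simp: fps_cos_def fps_sin_def)
  have "(\<Sum>i\<le>n. fps_nth (fps_tan 1) i * fps_nth (fps_cos (1::complex)) (n - i)) =
      complex_of_real (fps_nth (fps_sin 1) n)"
    unfolding fps_tan_convolution by (rule cs)
  also have "\<dots> = (\<Sum>i\<le>n. complex_of_real (fps_nth (fps_tan 1) i) * fps_nth (fps_cos 1) (n - i))"
    by (simp add: cs flip: fps_tan_convolution)
  finally show ?case using less by (simp flip: lessThan_Suc_atMost)
qed

text \<open>
  As \<open>tan x = - \<i> tanh (\<i> x)\<close> and \<open>tanh x (exp (2 x) + 1) = exp (2 x) - 1\<close>, the recurrence determines
  the derivatives of \<open>tanh\<close> at \<open>0\<close>.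
\<close>

proposition tangent_recurrence:
  fixes T :: "nat \<Rightarrow> real"
  assumes rec: "\<And>n. n > 0 \<Longrightarrow> T n + (\<Sum>k\<le>n. of_nat (n choose k) * 2 ^ (n - k) * T k) = 2 ^ n"
    and T0: "T 0 = 0"
  shows "T n = (if even n then 0 else (-1) ^ ((n - 1) div 2) * euler_number n)"
proof -
  define t where "t = (fps_tan 1 :: complex fps)"
  \<comment> \<open>The \<open>n\<close>-th derivative at 0 of \<open>\<i> * tan (x / \<i>)\<close>,
    which is \<open>tanh x\<close>.\<close>
  define U where "U n = \<i> * fact n * fps_nth t n / \<i> ^ n" for n
  have tU: "\<i> * fps_nth t n = U n * \<i> ^ n / fact n" for n by (simp add: U_def)
  have Urec: "U n + (\<Sum>k\<le>n. of_nat (n choose k) * 2 ^ (n - k) * U k) = 2 ^ n" if "n > 0" for n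
  proof -
    have "fps_const \<i> * (t * fps_exp (2 * \<i>)) + fps_const \<i> * t = fps_exp (2 * \<i>) - 1"
      using fps_tan_exp by (simp add: t_def algebra_simps)
    then have "\<i> * fps_nth (t * fps_exp (2 * \<i>)) n + \<i> * fps_nth t n = fps_nth (fps_exp (2 * \<i>) - 1) n"
      by (metis fps_add_nth fps_mult_left_const_nth)
    then have "\<i> * fps_nth t n + (\<Sum>k\<le>n. \<i> * fps_nth t k * ((2 * \<i>) ^ (n - k) / fact (n - k))) = (2 * \<i>) ^ n / fact n"
      using that by (simp add: fps_mult_nth atLeast0AtMost mult.assoc sum_distrib_left add.commute)
    then have "fact n / \<i> ^ n * (\<i> * fps_nth t n + (\<Sum>k\<le>n. \<i> * fps_nth t k * ((2 * \<i>) ^ (n - k) / fact (n - k)))) = 2 ^ n"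
      by (simp add: power_mult_distrib)
    moreover have "fact n / \<i> ^ n * (\<i> * fps_nth t k * ((2 * \<i>) ^ (n - k) / fact (n - k))) =
        of_nat (n choose k) * 2 ^ (n - k) * U k" if "k \<le> n" for k
    proof -
      have "\<i> ^ n = \<i> ^ k * \<i> ^ (n - k)" using that by (simp flip: power_add)
      then show ?thesis
        unfolding tU using that by (simp add: binomial_fact power_mult_distrib)
    qed
    ultimately show ?thesis
      by (simp add: distrib_left sum_distrib_left tU)
  qed
  \<comment> \<open>The recurrence contains the \<open>n\<close>-th term twice and otherwise only
    earlier terms, so it determines the sequence from its value at 0.\<close>
  have "of_real (T n) = U n" for n
  proof (induction n rule: less_induct)
    case (less n)
    show ?case
    proof (cases "n = 0")
      case False
      have "of_real (T n + (\<Sum>k\<le>n. of_nat (n choose k) * 2 ^ (n - k) * T k)) =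
          U n + (\<Sum>k\<le>n. of_nat (n choose k) * 2 ^ (n - k) * U k)"
        using False Urec[of n] by (simp only: rec) simp
      then show ?thesis using less by (simp flip: lessThan_Suc_atMost)
    qed (simp add: T0 U_def t_def fps_tan_def)
  qed
  from this[of n] have T: "of_real (T n) * \<i> ^ n = \<i> * complex_of_real (euler_number n)"
    by (simp add: U_def t_def euler_number_eq fps_nth_fps_tan_of_real)
  \<comment> \<open>For even \<open>n\<close> the power of \<open>\<i>\<close> is real, so a real
    number equals an imaginary one and both vanish; for odd \<open>n\<close> one factor
    \<open>\<i>\<close> cancels and leaves the sign.\<close>
  show ?thesis
  proof (cases "even n")
    case True
    then obtain m where m: "n = 2 * m" by (elim evenE)
    have "of_real (T n * (- 1) ^ m) = \<i> * complex_of_real (euler_number n)"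
      using T by (simp add: m power_mult)
    then have "T n * (-1) ^ m = 0"
      by (metis Re_complex_of_real Re_i_times Im_complex_of_real neg_0_equal_iff_equal)
    then show ?thesis using True by simp
  next
    case False
    then obtain m where m: "n = 2 * m + 1" by (elim oddE)
    have "\<i> * of_real (T n * (- 1) ^ m) = \<i> * complex_of_real (euler_number n)"
      using T by (simp add: m power_mult mult_ac del: power_mult_distrib) (simp flip: power_mult add: mult_ac power_mult[of _ 2 m])
    then have "T n * (- 1) ^ m = euler_number n"
      by (simp only: mult_cancel_left of_real_eq_iff) simp
    then have "T n * ((- 1) ^ m * (-1) ^ m) = (-1) ^ m * euler_number n"
      by (metis mult.assoc mult.commute)
    then show ?thesis using False by (simp add: m flip: power_mult_distrib)
  qed
qed

section \<open>Counting flags of sets\<close>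

text \<open>The simplices of the barycentric subdivision of the boundary of the simplex on
  \<open>B\<close>, with the empty one included; for \<open>B = UNIV\<close> the empty flag belongs
  to the cone that consists of the origin.\<close>

definition flags_in :: "'b set \<Rightarrow> 'b set set set" where
  "flags_in B = {c. (\<forall>A\<in>c. A \<noteq> {} \<and> A \<subset> B) \<and> (\<forall>A\<in>c. \<forall>A'\<in>c. A \<subseteq> A' \<or> A' \<subseteq> A)}"

lemma finite_flags_in:
  assumes "finite B"
  shows "finite (flags_in B)"
proof (rule finite_subset)
  show "flags_in B \<subseteq> Pow (Pow B)" unfolding flags_in_def by blast
qed (simp add: assms)

lemma finite_flag:
  assumes "finite B" "c \<in> flags_in B"
  shows "finite c"
proof (rule finite_subset)
  show "c \<subseteq> Pow B" using assms(2) unfolding flags_in_def by blast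
qed (simp add: assms(1))

lemma flags_in_subset: "c \<in> flags_in B \<Longrightarrow> d \<subseteq> c \<Longrightarrow> d \<in> flags_in B"
  unfolding flags_in_def mem_Collect_eq by (meson subsetD)

text \<open>Cardinalities along a chain are distinct and lie strictly between 0 and
  \<open>card B\<close>.\<close>

lemma flags_in_card:
  assumes "finite B" "c \<in> flags_in B"
  shows "card c \<le> card B - 1"
proof -
  have inj: "inj_on card c"
  proof (rule inj_onI)
    fix A A' assume A: "A \<in> c" "A' \<in> c" "card A = card A'"
    have "A \<subseteq> B" "A' \<subseteq> B" "A \<subseteq> A' \<or> A' \<subseteq> A" using A assms(2) unfolding flags_in_def by blast+
    then show "A = A'"
      using A(3) card_subset_eq[of A' A] card_subset_eq[of A A'] finite_subset[OF _ assms(1)] by metis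
  qed
  have "card ` c \<subseteq> {1..<card B}"
  proof
    fix k assume "k \<in> card ` c"
    then obtain A where A: "A \<in> c" "k = card A" by blast
    then have "A \<noteq> {}" "A \<subset> B" "finite A"
      using assms finite_subset[of A B] by (simp_all add: flags_in_def psubset_eq)
    then show "k \<in> {1..<card B}"
      using A assms(1) by (simp add: Suc_le_eq card_gt_0_iff psubset_card_mono)
  qed
  then have "card (card ` c) \<le> card {1..<card B}" by (intro card_mono) auto
  then show ?thesis using inj by (simp add: card_image)
qed

lemma flags_in_decompose:
  assumes "finite B"
  shows "flags_in B = insert {} (\<Union>A\<in>{A. A \<noteq> {} \<and> A \<subset> B}. insert A ` flags_in A)"
proof
  show "flags_in B \<subseteq> insert {} (\<Union>A\<in>{A. A \<noteq> {} \<and> A \<subset> B}. insert A ` flags_in A)"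
  proof
    fix c assume c: "c \<in> flags_in B"
    show "c \<in> insert {} (\<Union>A\<in>{A. A \<noteq> {} \<and> A \<subset> B}. insert A ` flags_in A)"
    proof (cases "c = {}")
      case False
      have "finite c" using c assms finite_flag by blast
      then obtain A where A: "A \<in> c" "\<forall>A'\<in>c. A \<subseteq> A' \<longrightarrow> A = A'"
        using finite_has_maximal[of c] False by blast
      have nest: "\<forall>A\<in>c. A \<noteq> {} \<and> A \<subset> B" "\<forall>A\<in>c. \<forall>A'\<in>c. A \<subseteq> A' \<or> A' \<subseteq> A"
        using c by (simp_all add: flags_in_def)
      have "A' \<subset> A" if "A' \<in> c" "A' \<noteq> A" for A'
      proof -
        have "A \<subseteq> A' \<or> A' \<subseteq> A" by (rule bspec[OF bspec[OF nest(2) A(1)] that(1)])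
        moreover have "\<not> A \<subseteq> A'" using A(2) that by metis
        ultimately show ?thesis using that(2) by (simp add: psubset_eq)
      qed
      then have "c - {A} \<in> flags_in A"
        unfolding flags_in_def using nest by simp
      moreover have "c = insert A (c - {A})" using A by auto
      moreover have "A \<noteq> {} \<and> A \<subset> B" by (rule bspec[OF nest(1) A(1)])
      ultimately show ?thesis by blast
    qed simp
  qed
  show "insert {} (\<Union>A\<in>{A. A \<noteq> {} \<and> A \<subset> B}. insert A ` flags_in A) \<subseteq> flags_in B"
  proof -
    have "insert A c \<in> flags_in B" if "A \<noteq> {}" "A \<subset> B" "c \<in> flags_in A" for A c
      using that unfolding flags_in_def by (simp add: psubset_eq) blast
    moreover have "{} \<in> flags_in B" by (simp add: flags_in_def)
    ultimately show ?thesis by blast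
  qed
qed

lemma sum_flags_in:
  assumes "finite B"
  shows "(\<Sum>c\<in>flags_in B. x ^ card c) =
    1 + (\<Sum>A | A \<noteq> {} \<and> A \<subset> B. x * (\<Sum>c\<in>flags_in A. x ^ card c :: 'a :: comm_semiring_1))"
proof -
  let ?I = "{A. A \<noteq> {} \<and> A \<subset> B}"
  have finI: "finite ?I" using assms by (auto intro: rev_finite_subset[of "Pow B"])
  have fin: "finite A" if "A \<in> ?I" for A using that assms finite_subset by auto
  have top: "A \<notin> c" "A \<in> insert A c" "\<And>A'. A' \<in> insert A c \<Longrightarrow> A' \<subseteq> A" if "c \<in> flags_in A" for A :: "'b set" and c
    using that unfolding flags_in_def by blast+
  have finc: "finite c" if "c \<in> flags_in A" "A \<in> ?I" for A c
    using that(1) by (rule finite_flag[OF fin[OF that(2)]])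
  have "(\<Sum>c\<in>flags_in B. x ^ card c) =
      x ^ card ({} :: 'b set set) + (\<Sum>c\<in>(\<Union>A\<in>?I. insert A ` flags_in A). x ^ card c)"
    unfolding flags_in_decompose[OF assms]
    using finI fin by (intro sum.insert) (auto simp: finite_flags_in)
  also have "(\<Sum>c\<in>(\<Union>A\<in>?I. insert A ` flags_in A). x ^ card c) =
      (\<Sum>A\<in>?I. \<Sum>c\<in>insert A ` flags_in A. x ^ card c)"
  proof (intro sum.UNION_disjoint finI ballI impI)
    show "finite (insert A ` flags_in A)" if "A \<in> ?I" for A
      using fin[OF that] by (simp add: finite_flags_in)
    show "insert A ` flags_in A \<inter> insert A' ` flags_in A' = {}" if "A \<noteq> A'" for A A' :: "'b set"
    proof -
      \<comment> \<open>\<open>A\<close> can be recovered as the largest member, so flags with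
        different largest members are different.\<close>
      have False if "insert A c = insert A' c'" "c \<in> flags_in A" "c' \<in> flags_in A'" for c c'
      proof -
        have "A \<subseteq> A'" using top(2)[OF that(2)] unfolding that(1) by (rule top(3)[OF that(3)])
        moreover have "A' \<subseteq> A" using top(2)[OF that(3)] unfolding that(1)[symmetric] by (rule top(3)[OF that(2)])
        ultimately show False using \<open>A \<noteq> A'\<close> by simp
      qed
      then show ?thesis unfolding disjoint_iff by (metis imageE)
    qed
  qed
  also have "\<dots> = (\<Sum>A\<in>?I. x * (\<Sum>c\<in>flags_in A. x ^ card c))"
  proof (rule sum.cong)
    fix A assume A: "A \<in> ?I"
    have inj: "inj_on (insert A) (flags_in A)"
    proof (rule inj_onI)
      fix c c' assume "c \<in> flags_in A" "c' \<in> flags_in A" "insert A c = insert A c'"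
      then show "c = c'" using top(1)[of c A] top(1)[of c' A] by (metis insert_ident)
    qed
    have "(\<Sum>c\<in>insert A ` flags_in A. x ^ card c) = (\<Sum>c\<in>flags_in A. x ^ card (insert A c))"
      by (subst sum.reindex[OF inj]) simp
    also have "\<dots> = (\<Sum>c\<in>flags_in A. x * x ^ card c)"
      using finc[OF _ A] top(1) by (intro sum.cong refl) simp
    finally show "(\<Sum>c\<in>insert A ` flags_in A. x ^ card c) = x * (\<Sum>c\<in>flags_in A. x ^ card c)"
      by (simp add: sum_distrib_left)
  qed simp
  finally show ?thesis by simp
qed

lemma sum_Pow_card:
  assumes "finite B"
  shows "(\<Sum>A\<in>Pow B. g (card A)) = (\<Sum>k\<le>card B. of_nat (card B choose k) * (g k :: 'a :: comm_semiring_1))"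
proof -
  have "(\<Sum>A\<in>Pow B. g (card A)) = (\<Sum>k\<le>card B. \<Sum>A\<in>{A\<in>Pow B. card A = k}. g (card A))"
    using assms by (subst sum.group) (auto simp: card_mono)
  also have "\<dots> = (\<Sum>k\<le>card B. of_nat (card B choose k) * g k)"
  proof (rule sum.cong)
    fix k
    have "card {A\<in>Pow B. card A = k} = card B choose k"
      using n_subsets[OF assms, of k] by (simp add: Pow_def)
    then show "(\<Sum>A\<in>{A\<in>Pow B. card A = k}. g (card A)) = of_nat (card B choose k) * g k"
      by simp
  qed simp
  finally show ?thesis .
qed

text \<open>The number of flags in a set of size \<open>n\<close>, each member weighted by
  \<open>- 1 / 2\<close>, which is \<open>(-1) ^ card c * 2 ^ (r - card c)\<close> divided by
  \<open>2 ^ r\<close>. The index \<open>k\<close> is the size of the largest member, and the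
  summand 1 is the empty flag.\<close>

fun flag_sum :: "nat \<Rightarrow> real" where
  "flag_sum n = 1 - (\<Sum>k\<in>{1..<n}. of_nat (n choose k) * flag_sum k) / 2"

declare flag_sum.simps [simp del]

lemma sum_flags_in_eq_flag_sum:
  assumes "finite B"
  shows "(\<Sum>c\<in>flags_in B. (- 1 / 2) ^ card c) = flag_sum (card B)"
  using assms
proof (induction "card B" arbitrary: B rule: less_induct)
  case less
  let ?g = "\<lambda>k. if 1 \<le> k \<and> k < card B then flag_sum k else 0"
  have "(\<Sum>A | A \<noteq> {} \<and> A \<subset> B. (- 1 / 2) * (\<Sum>c\<in>flags_in A. (- 1 / 2) ^ card c)) =
      (\<Sum>A | A \<noteq> {} \<and> A \<subset> B. (- 1 / 2) * ?g (card A))"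
  proof (rule sum.cong)
    fix A assume "A \<in> {A. A \<noteq> {} \<and> A \<subset> B}"
    then have A: "A \<noteq> {}" "A \<subset> B" "finite A" using less.prems finite_subset by auto
    then have "card A < card B" "1 \<le> card A"
      using less.prems by (auto simp: psubset_card_mono Suc_le_eq card_gt_0_iff)
    then show "(- 1 / 2) * (\<Sum>c\<in>flags_in A. (- 1 / 2) ^ card c) = (- 1 / 2) * ?g (card A)"
      using less.hyps[of A] A by simp
  qed simp
  also have "\<dots> = (- 1 / 2) * (\<Sum>A | A \<noteq> {} \<and> A \<subset> B. ?g (card A))"
    by (simp only: sum_distrib_left)
  also have "(\<Sum>A | A \<noteq> {} \<and> A \<subset> B. ?g (card A)) = (\<Sum>A\<in>Pow B. ?g (card A))"
    using less.prems by (intro sum.mono_neutral_left) auto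
  also have "\<dots> = (\<Sum>k\<le>card B. of_nat (card B choose k) * ?g k)"
    using less.prems by (rule sum_Pow_card)
  also have "\<dots> = (\<Sum>k\<in>{1..<card B}. of_nat (card B choose k) * ?g k)"
    by (rule sum.mono_neutral_right) auto
  also have "\<dots> = (\<Sum>k\<in>{1..<card B}. of_nat (card B choose k) * flag_sum k)"
    by (rule sum.cong) auto
  finally show ?case
    unfolding sum_flags_in[OF less.prems] flag_sum.simps[of "card B"] by simp
qed

proposition sum_flags_in_euler_number:
  assumes "finite B" "B \<noteq> {}"
  shows "(\<Sum>c\<in>flags_in B. (-1) ^ card c * 2 ^ (card B - 1 - card c)) =
    (if even (card B) then 0 else (-1) ^ ((card B - 1) div 2) * euler_number (card B))"
proof -
  \<comment> \<open>The factor restores the powers of 2 for rank \<open>n - 1\<close>. The value 0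
    at \<open>n = 0\<close> is that of the hyperbolic tangent; the formula itself would give
    1.\<close>
  define T where "T n = (if n = 0 then 0 else 2 ^ (n - 1) * flag_sum n)" for n
  have rec: "T n + (\<Sum>k\<le>n. of_nat (n choose k) * 2 ^ (n - k) * T k) = 2 ^ n" if n: "n > 0" for n
  proof -
    \<comment> \<open>The term \<open>k = n\<close> is the second copy of \<open>T n\<close>; the
      terms strictly between reproduce the recursion of \<open>flag_sum\<close>.\<close>
    have "(\<Sum>k\<le>n. of_nat (n choose k) * 2 ^ (n - k) * T k) =
        (\<Sum>k\<in>insert n {1..<n}. of_nat (n choose k) * 2 ^ (n - k) * T k)"
      using n by (intro sum.mono_neutral_right) (auto simp: T_def)
    also have "\<dots> = T n + (\<Sum>k\<in>{1..<n}. of_nat (n choose k) * 2 ^ (n - k) * T k)"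
      by (subst sum.insert) auto
    also have "(\<Sum>k\<in>{1..<n}. of_nat (n choose k) * 2 ^ (n - k) * T k) =
        (\<Sum>k\<in>{1..<n}. 2 ^ (n - 1) * (of_nat (n choose k) * flag_sum k))"
    proof (rule sum.cong)
      fix k assume k: "k \<in> {1..<n}"
      have "2 ^ (n - k) * 2 ^ (k - 1) = (2 :: real) ^ (n - 1)"
        using k by (simp flip: power_add)
      then show "of_nat (n choose k) * 2 ^ (n - k) * T k = 2 ^ (n - 1) * (of_nat (n choose k) * flag_sum k)"
        using k by (simp add: T_def mult_ac)
    qed simp
    also have "\<dots> = 2 ^ (n - 1) * (2 - 2 * flag_sum n)"
    proof -
      have "(\<Sum>k\<in>{1..<n}. of_nat (n choose k) * flag_sum k) = 2 - 2 * flag_sum n"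
        using flag_sum.simps[of n] by linarith
      then show ?thesis by (simp only: sum_distrib_left[symmetric])
    qed
    finally have "T n + (\<Sum>k\<le>n. of_nat (n choose k) * 2 ^ (n - k) * T k) = 2 * 2 ^ (n - 1)"
      using n by (simp add: T_def algebra_simps)
    then show ?thesis using n by (simp flip: power_Suc)
  qed
  have card: "card B > 0" using assms by (simp add: card_gt_0_iff)
  have "(-1) ^ card c * 2 ^ (card B - 1 - card c) = 2 ^ (card B - 1) * (- 1 / 2 :: real) ^ card c"
    if c: "c \<in> flags_in B" for c
  proof -
    have "card c \<le> card B - 1"
      by (rule flags_in_card[OF assms(1) c])
    then have "2 ^ (card B - 1) = 2 ^ (card B - 1 - card c) * (2 :: real) ^ card c"
      by (simp flip: power_add)
    then show ?thesis unfolding power_divide by (simp del: diff_Suc_eq_diff_pred)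
  qed
  then have "(\<Sum>c\<in>flags_in B. (-1) ^ card c * 2 ^ (card B - 1 - card c)) = 2 ^ (card B - 1) * flag_sum (card B)"
    by (simp add: sum_distrib_left flip: sum_flags_in_eq_flag_sum[OF assms(1)])
  also have "\<dots> = T (card B)" using card by (simp add: T_def)
  also have "\<dots> = (if even (card B) then 0 else (-1) ^ ((card B - 1) div 2) * euler_number (card B))"
    by (rule tangent_recurrence[OF rec]) (auto simp: T_def)
  finally show ?thesis .
qed

section \<open>The Coxeter fan of type \<open>A\<close>\<close>

definition zero_sum :: "(real ^ 'n) set" where
  "zero_sum = {v. (\<Sum>i\<in>UNIV. v $ i) = 0}"

definition part_sum :: "real ^ 'n \<Rightarrow> 'n set \<Rightarrow> real" where
  "part_sum m A = (\<Sum>i\<in>A. m $ i)"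

text \<open>The orthogonal projection of the 0-1 vector of \<open>A\<close> to the hyperplane
  \<open>zero_sum\<close>. For proper nonempty \<open>A\<close> it is a Weyl conjugate of a
  fundamental weight and generates a ray of the fan; pairing with it gives partial sums of
  coordinates.\<close>

definition indvec :: "'n::finite set \<Rightarrow> real ^ 'n" where
  "indvec A = (\<chi> i. (if i \<in> A then 1 else 0) - card A / CARD('n))"

lemma subspace_zero_sum: "subspace zero_sum"
  by (auto simp: subspace_def zero_sum_def sum.distrib simp flip: sum_distrib_left)

lemma indvec_nth: "indvec A $ i = (if i \<in> A then 1 else 0) - card A / CARD('n)" for A :: "'n::finite set"
  by (simp add: indvec_def)

lemma indvec_in_zero_sum: "indvec A \<in> zero_sum"
  by (simp add: zero_sum_def indvec_def sum_subtractf sum.If_cases)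

lemma inner_indvec:
  fixes m :: "real ^ 'n::finite"
  assumes "m \<in> zero_sum"
  shows "m \<bullet> indvec A = part_sum m A"
proof -
  have "m \<bullet> indvec A = (\<Sum>i\<in>UNIV. (if i \<in> A then m $ i else 0) - (card A / CARD('n)) * m $ i)"
    unfolding inner_vec_def indvec_nth by (intro sum.cong) (auto simp: algebra_simps)
  also have "\<dots> = (\<Sum>i\<in>UNIV. (if i \<in> A then m $ i else 0)) - (card A / CARD('n)) * (\<Sum>i\<in>UNIV. m $ i)"
    by (simp only: sum_subtractf sum_distrib_left)
  also have "\<dots> = part_sum m A"
    using assms by (simp add: zero_sum_def part_sum_def sum.If_cases)
  finally show ?thesis .
qed

lemma axis_diff_in_zero_sum: "axis i 1 - axis j 1 \<in> (zero_sum :: (real ^ 'n::finite) set)"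
  by (simp add: zero_sum_def sum_subtractf axis_def)

lemma inner_axis_diff: "v \<bullet> (axis i 1 - axis j 1) = v $ i - v $ j" for v :: "real ^ 'n::finite"
  by (simp add: inner_diff_right inner_axis)

lemma zero_sum_expansion:
  fixes v :: "real ^ 'n::finite"
  assumes "v \<in> zero_sum"
  shows "v = (\<Sum>i\<in>UNIV. (v $ i) *\<^sub>R (axis i 1 - axis k 1))"
proof -
  have "(\<Sum>i\<in>UNIV. (v $ i) *\<^sub>R (axis i 1 - axis k 1)) =
      (\<Sum>i\<in>UNIV. (v $ i) *\<^sub>R axis i 1) - (\<Sum>i\<in>UNIV. v $ i) *\<^sub>R axis k (1::real)"
    by (simp add: scaleR_diff_right sum_subtractf scaleR_sum_left)
  also have "(\<Sum>i\<in>UNIV. (v $ i) *\<^sub>R axis i 1) = v"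
    using basis_expansion[of v] by (simp add: scalar_mult_eq_scaleR)
  finally show ?thesis using assms by (simp add: zero_sum_def)
qed

section \<open>The weight lattice and its dual\<close>

lemma span_type_A_roots: "span type_A_roots = (zero_sum :: (real ^ 'n::finite) set)"
proof
  show "span type_A_roots \<subseteq> (zero_sum :: (real ^ 'n) set)"
    by (rule span_minimal[OF _ subspace_zero_sum]) (auto simp: type_A_roots_def axis_diff_in_zero_sum)
  show "(zero_sum :: (real ^ 'n) set) \<subseteq> span type_A_roots"
  proof
    fix v :: "real ^ 'n" assume v: "v \<in> zero_sum"
    fix k :: 'n
    have "axis i 1 - axis k 1 \<in> span (type_A_roots :: (real ^ 'n) set)" for i
    proof (cases "i = k")
      case False
      then show ?thesis by (intro span_base) (auto simp: type_A_roots_def)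
    qed (simp add: span_zero)
    then have "(\<Sum>i\<in>UNIV. (v $ i) *\<^sub>R (axis i 1 - axis k 1)) \<in> span (type_A_roots :: (real ^ 'n) set)"
      by (intro span_sum span_scale)
    then show "v \<in> span type_A_roots" using zero_sum_expansion[OF v, of k] by simp
  qed
qed

lemma weight_lattice_type_A:
  "weight_lattice (type_A_roots :: (real ^ 'n::finite) set) = {v \<in> zero_sum. \<forall>i j. v $ i - v $ j \<in> \<int>}"
proof -
  have "(\<forall>\<alpha>\<in>type_A_roots. v \<bullet> \<alpha> \<in> \<int>) \<longleftrightarrow> (\<forall>i j. v $ i - v $ j \<in> \<int>)" for v :: "real ^ 'n"
  proof
    assume *: "\<forall>\<alpha>\<in>type_A_roots. v \<bullet> \<alpha> \<in> \<int>"
    show "\<forall>i j. v $ i - v $ j \<in> \<int>"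
    proof (intro allI)
      fix i j
      show "v $ i - v $ j \<in> \<int>"
      proof (cases "i = j")
        case False
        then have "v \<bullet> (axis i 1 - axis j 1) \<in> \<int>" using * by (auto simp: type_A_roots_def)
        then show ?thesis by (simp add: inner_axis_diff)
      qed simp
    qed
  qed (auto simp: type_A_roots_def inner_axis_diff)
  then show ?thesis by (simp add: weight_lattice_def span_type_A_roots)
qed

lemma indvec_in_weight_lattice: "indvec A \<in> weight_lattice type_A_roots"
  by (auto simp: weight_lattice_type_A indvec_in_zero_sum indvec_nth)

lemma span_weight_lattice_type_A:
  "span (weight_lattice type_A_roots) = (zero_sum :: (real ^ 'n::finite) set)"
proof
  show "span (weight_lattice type_A_roots) \<subseteq> (zero_sum :: (real ^ 'n) set)"
    by (rule span_minimal[OF _ subspace_zero_sum]) (auto simp: weight_lattice_type_A)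
  have "type_A_roots \<subseteq> weight_lattice (type_A_roots :: (real ^ 'n) set)"
  proof
    fix v :: "real ^ 'n" assume "v \<in> type_A_roots"
    then obtain i j where v: "v = axis i 1 - axis j 1" by (auto simp: type_A_roots_def)
    have int: "(axis i 1 :: real ^ 'n) $ k \<in> \<int>" for i k by (simp add: axis_def)
    show "v \<in> weight_lattice type_A_roots"
      unfolding weight_lattice_type_A v
      by (auto simp: axis_diff_in_zero_sum intro!: Ints_diff int)
  qed
  then show "(zero_sum :: (real ^ 'n) set) \<subseteq> span (weight_lattice type_A_roots)"
    unfolding span_type_A_roots[symmetric] by (rule span_mono)
qed

text \<open>The dual of the weight lattice is the root lattice. Pairing with the weight
  \<open>indvec {i}\<close> reads off the coordinate \<open>i\<close>; conversely, an integral
  vector of sum 0 is an integral combination of roots, and these pair integrally with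
  weights.\<close>

lemma dual_weight_lattice_type_A:
  "dual_lattice (weight_lattice (type_A_roots :: (real ^ 'n::finite) set)) = {m \<in> zero_sum. \<forall>i. m $ i \<in> \<int>}"
proof (rule subset_antisym; rule subsetI)
  fix m :: "real ^ 'n" assume "m \<in> dual_lattice (weight_lattice type_A_roots)"
  then have m: "m \<in> zero_sum" "\<And>v. v \<in> weight_lattice type_A_roots \<Longrightarrow> m \<bullet> v \<in> \<int>"
    by (auto simp: dual_lattice_def span_weight_lattice_type_A)
  have "m $ i \<in> \<int>" for i
    using m(2)[OF indvec_in_weight_lattice, of "{i}"] by (simp add: inner_indvec[OF m(1)] part_sum_def)
  then show "m \<in> {m \<in> zero_sum. \<forall>i. m $ i \<in> \<int>}" using m(1) by simp
next
  fix m :: "real ^ 'n" assume m: "m \<in> {m \<in> zero_sum. \<forall>i. m $ i \<in> \<int>}"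
  have "m \<bullet> v \<in> \<int>" if v: "v \<in> weight_lattice type_A_roots" for v
  proof -
    fix k
    have "m \<bullet> v = (\<Sum>i\<in>UNIV. (m $ i) *\<^sub>R (axis i 1 - axis k 1)) \<bullet> v"
      using m by (subst (1) zero_sum_expansion[of m k]) auto
    also have "\<dots> = (\<Sum>i\<in>UNIV. m $ i * (v $ i - v $ k))"
      by (simp add: inner_sum_right inner_commute[of _ v] inner_axis_diff)
    also have "\<dots> \<in> \<int>"
      using m v by (intro Ints_sum Ints_mult) (auto simp: weight_lattice_type_A)
    finally show ?thesis .
  qed
  then show "m \<in> dual_lattice (weight_lattice type_A_roots)"
    using m by (auto simp: dual_lattice_def span_weight_lattice_type_A)
qed

section \<open>Cones of flags and their faces\<close>

abbreviation flags :: "'n::finite set set set" where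
  "flags \<equiv> flags_in UNIV"

text \<open>For a flag \<open>c\<close> this is the cone spanned by the vectors
  \<open>indvec A\<close> with \<open>A\<close> in \<open>c\<close>, encoded as the vectors that are
  monotone for the total preorder which \<open>c\<close> induces on the indices. In this form
  membership only compares coordinates.\<close>

definition flag_cone :: "'n::finite set set \<Rightarrow> (real ^ 'n) set" where
  "flag_cone c = {u \<in> zero_sum. \<forall>i j. (\<forall>A\<in>c. j \<in> A \<longrightarrow> i \<in> A) \<longrightarrow> u $ j \<le> u $ i}"

text \<open>The proper nonempty superlevel sets of the coordinates of \<open>u\<close>, which label
  the smallest cone of the fan containing \<open>u\<close>.\<close>

definition flag_of :: "real ^ 'n::finite \<Rightarrow> 'n set set" where
  "flag_of u = {A. A \<noteq> {} \<and> A \<noteq> UNIV \<and> (\<forall>i\<in>A. \<forall>j. j \<notin> A \<longrightarrow> u $ j < u $ i)}"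

lemma flags_nested: "c \<in> flags \<Longrightarrow> A \<in> c \<Longrightarrow> B \<in> c \<Longrightarrow> A \<subseteq> B \<or> B \<subseteq> A"
  by (simp add: flags_in_def)

lemma flags_proper: "c \<in> flags \<Longrightarrow> A \<in> c \<Longrightarrow> A \<noteq> {} \<and> A \<noteq> UNIV"
  by (simp add: flags_in_def psubset_eq)

lemma flag_ofD: "A \<in> flag_of u \<Longrightarrow> i \<in> A \<Longrightarrow> j \<notin> A \<Longrightarrow> u $ j < u $ i"
  by (simp add: flag_of_def)

lemma flag_ofI:
  "A \<noteq> {} \<Longrightarrow> A \<noteq> UNIV \<Longrightarrow> (\<And>i j. i \<in> A \<Longrightarrow> j \<notin> A \<Longrightarrow> u $ j < u $ i) \<Longrightarrow> A \<in> flag_of u"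
  by (simp add: flag_of_def)

lemma flag_of_in_flags: "flag_of u \<in> flags"
proof -
  have "A \<subseteq> B \<or> B \<subseteq> A" if A: "A \<in> flag_of u" and B: "B \<in> flag_of u" for A B
  proof (rule ccontr)
    assume "\<not> (A \<subseteq> B \<or> B \<subseteq> A)"
    then obtain a b where "a \<in> A" "a \<notin> B" "b \<in> B" "b \<notin> A" by blast
    then show False using flag_ofD[OF A, of a b] flag_ofD[OF B, of b a] by simp
  qed
  moreover have "A \<noteq> {} \<and> A \<subset> UNIV" if "A \<in> flag_of u" for A
    using that by (simp add: flag_of_def psubset_eq)
  ultimately show ?thesis unfolding flags_in_def by simp
qed

text \<open>If \<open>u $ i < u $ j\<close>, the superlevel set at height \<open>u $ j\<close>
  contains \<open>j\<close> but not \<open>i\<close>. Thus the flag of \<open>u\<close> remembers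
  exactly the preorder of its coordinates.\<close>

lemma flag_of_le_iff: "(\<forall>A\<in>flag_of u. j \<in> A \<longrightarrow> i \<in> A) \<longleftrightarrow> u $ j \<le> u $ i"
proof
  assume *: "\<forall>A\<in>flag_of u. j \<in> A \<longrightarrow> i \<in> A"
  show "u $ j \<le> u $ i"
  proof (rule ccontr)
    assume "\<not> u $ j \<le> u $ i"
    then have "{k. u $ j \<le> u $ k} \<in> flag_of u" by (intro flag_ofI) auto
    then have "i \<in> {k. u $ j \<le> u $ k}" using * by force
    then show False using \<open>\<not> u $ j \<le> u $ i\<close> by simp
  qed
next
  assume "u $ j \<le> u $ i"
  then show "\<forall>A\<in>flag_of u. j \<in> A \<longrightarrow> i \<in> A" using flag_ofD[of _ u j i] by force
qed

lemma in_flag_cone_flag_of: "u \<in> zero_sum \<Longrightarrow> u \<in> flag_cone (flag_of u)"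
  by (simp add: flag_cone_def flag_of_le_iff)

lemma flag_coneD: "u \<in> flag_cone c \<Longrightarrow> (\<And>A. A \<in> c \<Longrightarrow> j \<in> A \<Longrightarrow> i \<in> A) \<Longrightarrow> u $ j \<le> u $ i"
  by (simp add: flag_cone_def)

lemma flag_cone_zero_sum: "u \<in> flag_cone c \<Longrightarrow> u \<in> zero_sum"
  by (simp add: flag_cone_def)

lemma flag_cone_mono: "c' \<subseteq> c \<Longrightarrow> flag_cone c' \<subseteq> flag_cone c"
  unfolding flag_cone_def by (auto simp: subset_iff)

lemma chain_Inter_Union:
  assumes "finite S" "S \<noteq> {}" "S \<subseteq> c" "\<And>A B. A \<in> c \<Longrightarrow> B \<in> c \<Longrightarrow> A \<subseteq> B \<or> B \<subseteq> A"
  shows "\<Inter>S \<in> c \<and> \<Union>S \<in> c"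
  using assms(1-3)
proof (induction S rule: finite_ne_induct)
  case (insert A S)
  then have "A \<in> c" "\<Inter>S \<in> c" "\<Union>S \<in> c" by auto
  then show ?case
    using assms(4)[of A "\<Inter>S"] assms(4)[of A "\<Union>S"] by (auto simp: Int_absorb1 Int_absorb2 Un_absorb1 Un_absorb2)
qed simp

text \<open>Any point inside a superlevel set \<open>A\<close> is separated from any point outside
  by some member of \<open>c\<close>. For fixed \<open>i\<close> in \<open>A\<close>, the
  intersection of those separating members lies between \<open>i\<close> and \<open>A\<close>, and
  the union over \<open>i\<close> is \<open>A\<close>; a finite chain is closed under both
  operations.\<close>

lemma flag_of_subset:
  fixes u :: "real ^ 'n::finite"
  assumes c: "c \<in> flags" and u: "u \<in> flag_cone c"
  shows "flag_of u \<subseteq> c"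
proof
  fix A assume A: "A \<in> flag_of u"
  then have ne: "A \<noteq> {}" "A \<noteq> UNIV" by (auto simp: flag_of_def)
  have chain: "B \<subseteq> B' \<or> B' \<subseteq> B" if "B \<in> c" "B' \<in> c" for B B' using flags_nested[OF c that] .
  have 1: "\<exists>B\<in>c. i \<in> B \<and> j \<notin> B" if "i \<in> A" "j \<notin> A" for i j
  proof (rule ccontr)
    assume "\<not> (\<exists>B\<in>c. i \<in> B \<and> j \<notin> B)"
    then have "u $ i \<le> u $ j" by (intro flag_coneD[OF u]) auto
    then show False using flag_ofD[OF A that] by simp
  qed
  have 2: "\<exists>B\<in>c. i \<in> B \<and> B \<subseteq> A" if i: "i \<in> A" for i
  proof -
    define S where "S = {B\<in>c. i \<in> B \<and> (\<exists>j. j \<notin> A \<and> j \<notin> B)}"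
    obtain j where "j \<notin> A" using ne by auto
    then have "S \<noteq> {}" using 1[OF i, of j] by (auto simp: S_def)
    then have "\<Inter>S \<in> c" using chain_Inter_Union[of S c] chain by (auto simp: S_def)
    moreover have "i \<in> \<Inter>S" by (auto simp: S_def)
    moreover have "\<Inter>S \<subseteq> A"
    proof
      fix j assume j: "j \<in> \<Inter>S"
      show "j \<in> A"
      proof (rule ccontr)
        assume "j \<notin> A"
        then obtain B where "B \<in> c" "i \<in> B" "j \<notin> B" using 1[OF i] by blast
        then have "B \<in> S" using \<open>j \<notin> A\<close> by (auto simp: S_def)
        then show False using j \<open>j \<notin> B\<close> by blast
      qed
    qed
    ultimately show ?thesis by blast
  qed
  define S where "S = {B\<in>c. B \<subseteq> A}"
  have "S \<noteq> {}" using 2 ne(1) by (auto simp: S_def)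
  then have "\<Union>S \<in> c" using chain_Inter_Union[of S c] chain by (auto simp: S_def)
  moreover have "\<Union>S = A" using 2 by (auto simp: S_def)
  ultimately show "A \<in> c" by simp
qed

lemma flag_cone_eqI: "c \<in> flags \<Longrightarrow> u \<in> zero_sum \<Longrightarrow> flag_of u \<subseteq> c \<Longrightarrow> u \<in> flag_cone c"
  using in_flag_cone_flag_of flag_cone_mono by blast

text \<open>The flag of a common vector lies in both \<open>c\<close> and \<open>d\<close>. Gluing
  along an intersection of cones thereby becomes gluing along the flag
  \<open>c \<inter> d\<close>.\<close>

lemma flag_cone_Int:
  assumes "c \<in> flags" "d \<in> flags"
  shows "flag_cone c \<inter> flag_cone d = flag_cone (c \<inter> d)"
proof
  show "flag_cone c \<inter> flag_cone d \<subseteq> flag_cone (c \<inter> d)"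
  proof
    fix u assume u: "u \<in> flag_cone c \<inter> flag_cone d"
    then have "flag_of u \<subseteq> c \<inter> d" using flag_of_subset[OF assms(1)] flag_of_subset[OF assms(2)] by blast
    then show "u \<in> flag_cone (c \<inter> d)"
      using u in_flag_cone_flag_of[OF flag_cone_zero_sum] flag_cone_mono by blast
  qed
  show "flag_cone (c \<inter> d) \<subseteq> flag_cone c \<inter> flag_cone d"
    using flag_cone_mono[of "c \<inter> d" c] flag_cone_mono[of "c \<inter> d" d] by blast
qed

text \<open>The sum of the ray generators, a vector in the relative interior of the cone. Its flag
  is \<open>c\<close> again, so different flags have different cones.\<close>

definition flag_vec :: "'n::finite set set \<Rightarrow> real ^ 'n" where
  "flag_vec c = (\<Sum>A\<in>c. indvec A)"

lemma flag_vec_diff: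
  "flag_vec c $ i - flag_vec c $ j = real (card {A\<in>c. i \<in> A}) - real (card {A\<in>c. j \<in> A})"
  for c :: "'n::finite set set"
proof -
  have fin: "finite c" by (rule finite_subset[of _ UNIV]) auto
  have "flag_vec c $ i = real (card {A\<in>c. i \<in> A}) - (\<Sum>A\<in>c. card A / CARD('n))" for i
    using fin by (simp add: flag_vec_def indvec_nth sum_subtractf sum.If_cases Int_def)
  then show ?thesis by simp
qed

lemma flag_vec_in_zero_sum: "flag_vec c \<in> zero_sum"
  unfolding flag_vec_def by (intro subspace_sum subspace_zero_sum indvec_in_zero_sum)

lemma card_flag_less:
  fixes c :: "'n::finite set set"
  assumes "c \<in> flags" "A \<in> c" "i \<in> A" "j \<notin> A"
  shows "card {B\<in>c. j \<in> B} < card {B\<in>c. i \<in> B}"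
proof (rule psubset_card_mono)
  have "i \<in> B" if "B \<in> c" "j \<in> B" for B
    using flags_nested[OF assms(1,2) that(1)] that(2) assms(3,4) by blast
  then show "{B\<in>c. j \<in> B} \<subset> {B\<in>c. i \<in> B}" using assms by blast
qed (auto intro: finite_subset[of _ UNIV])

lemma flag_of_flag_vec:
  assumes c: "c \<in> flags"
  shows "flag_of (flag_vec c) = c"
proof
  have "flag_vec c \<in> flag_cone c"
    unfolding flag_cone_def
  proof (intro CollectI conjI allI impI flag_vec_in_zero_sum)
    fix i j assume *: "\<forall>A\<in>c. j \<in> A \<longrightarrow> i \<in> A"
    have "card {A\<in>c. j \<in> A} \<le> card {A\<in>c. i \<in> A}"
      using * by (intro card_mono) (auto intro: finite_subset[of _ UNIV])
    then show "flag_vec c $ j \<le> flag_vec c $ i" using flag_vec_diff[of c i j] by linarith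
  qed
  then show "flag_of (flag_vec c) \<subseteq> c" by (rule flag_of_subset[OF c])
  show "c \<subseteq> flag_of (flag_vec c)"
  proof
    fix A assume A: "A \<in> c"
    show "A \<in> flag_of (flag_vec c)"
    proof (rule flag_ofI)
      fix i j assume "i \<in> A" "j \<notin> A"
      then have "card {B\<in>c. j \<in> B} < card {B\<in>c. i \<in> B}" by (rule card_flag_less[OF c A])
      then show "flag_vec c $ j < flag_vec c $ i" using flag_vec_diff[of c i j] by linarith
    qed (use flags_proper[OF c A] in auto)
  qed
qed

lemma flag_vec_in_flag_cone: "c \<in> flags \<Longrightarrow> flag_vec c \<in> flag_cone c"
  using in_flag_cone_flag_of[OF flag_vec_in_zero_sum, of c] flag_of_flag_vec[of c] by simp

lemma inj_on_flag_cone: "inj_on flag_cone flags"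
proof (rule inj_onI)
  fix c d :: "'n::finite set set" assume cd: "c \<in> flags" "d \<in> flags" "flag_cone c = flag_cone d"
  have "c \<subseteq> d" using flag_of_subset[OF cd(2), of "flag_vec c"] flag_vec_in_flag_cone[OF cd(1)] flag_of_flag_vec[OF cd(1)] cd(3) by simp
  moreover have "d \<subseteq> c" using flag_of_subset[OF cd(1), of "flag_vec d"] flag_vec_in_flag_cone[OF cd(2)] flag_of_flag_vec[OF cd(2)] cd(3) by simp
  ultimately show "c = d" by blast
qed

lemma convex_flag_cone: "convex (flag_cone c)"
proof -
  have "flag_cone c = zero_sum \<inter> (\<Inter>p\<in>{p. \<forall>A\<in>c. snd p \<in> A \<longrightarrow> fst p \<in> A}. {u. (axis (snd p) 1 - axis (fst p) 1) \<bullet> u \<le> 0})"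
    by (auto simp: flag_cone_def inner_commute[of "_ - _"] inner_axis_diff)
  then show ?thesis
    using subspace_imp_convex[OF subspace_zero_sum] by (auto intro!: convex_Int convex_INT convex_halfspace_le)
qed

text \<open>Both endpoints of a segment in the larger cone are weakly ordered in the same direction
  across each member of \<open>d\<close>. A strict step of one endpoint therefore survives at every
  inner point and cannot cancel, so the endpoints have no steps outside \<open>c\<close>.\<close>

lemma flag_cone_face:
  assumes c: "c \<in> flags" and d: "d \<in> flags" and cd: "c \<subseteq> d"
  shows "flag_cone c face_of flag_cone d"
  unfolding face_of_def
proof (intro conjI ballI impI)
  show "flag_cone c \<subseteq> flag_cone d" by (rule flag_cone_mono[OF cd])
  show "convex (flag_cone c)" by (rule convex_flag_cone)
  have key: "a \<in> flag_cone c"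
    if ab: "a \<in> flag_cone d" "b \<in> flag_cone d" and x: "x \<in> flag_cone c" "x \<in> open_segment a b" for a b x
  proof -
    obtain t where t: "0 < t" "t < 1" "x = (1 - t) *\<^sub>R a + t *\<^sub>R b"
      using x(2) by (auto simp: in_segment)
    have "flag_of a \<subseteq> flag_of x"
    proof
      fix A assume A: "A \<in> flag_of a"
      have Ad: "A \<in> d" using flag_of_subset[OF d ab(1)] A by blast
      show "A \<in> flag_of x"
      proof (rule flag_ofI)
        fix i j assume ij: "i \<in> A" "j \<notin> A"
        have "b $ j \<le> b $ i"
          by (rule flag_coneD[OF ab(2)]) (use flags_nested[OF d Ad] ij in blast)
        moreover have "a $ j < a $ i" by (rule flag_ofD[OF A ij])
        ultimately have "(1 - t) * a $ j + t * b $ j < (1 - t) * a $ i + t * b $ i"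
          using t by (intro add_less_le_mono mult_strict_left_mono mult_left_mono) auto
        then show "x $ j < x $ i" by (simp add: t(3))
      qed (use A in \<open>auto simp: flag_of_def\<close>)
    qed
    also have "\<dots> \<subseteq> c" by (rule flag_of_subset[OF c x(1)])
    finally show ?thesis by (rule flag_cone_eqI[OF c flag_cone_zero_sum[OF ab(1)]])
  qed
  fix a b x assume *: "a \<in> flag_cone d" "b \<in> flag_cone d" "x \<in> flag_cone c" "x \<in> open_segment a b"
  show "a \<in> flag_cone c" by (rule key[OF *])
  show "b \<in> flag_cone c" by (rule key[OF *(2,1,3)]) (use *(4) in \<open>simp add: open_segment_commute\<close>)
qed

text \<open>A nonempty face is the cone of the flag of one of its relative interior points
  \<open>w\<close>. Segments ending at \<open>w\<close> are prolonged beyond \<open>w\<close> twice: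
  within \<open>T\<close> to bound the flags of its points, and within the cone of \<open>d\<close>
  to apply the face property.\<close>

lemma flag_cone_faces:
  assumes d: "d \<in> flags" and T: "T face_of flag_cone d" "T \<noteq> {}"
  shows "\<exists>c\<in>flags. T = flag_cone c"
proof -
  have conv: "convex T" and sub: "T \<subseteq> flag_cone d" using T(1) by (auto simp: face_of_def)
  obtain w where w: "w \<in> rel_interior T" using T(2) conv rel_interior_eq_empty by blast
  then have wT: "w \<in> T" using rel_interior_subset by blast
  have wd: "w \<in> flag_cone d" "w \<in> zero_sum" using wT sub flag_cone_zero_sum by blast+
  have "T = flag_cone (flag_of w)"
  proof
    show "T \<subseteq> flag_cone (flag_of w)"
    proof
      fix u assume u: "u \<in> T"
      have ud: "u \<in> flag_cone d" using u sub by blast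
      \<comment> \<open>The segment from \<open>u\<close> to \<open>w\<close> is prolonged beyond
        \<open>w\<close>. The new point is still weakly ordered across \<open>A\<close>, which is
        impossible if \<open>u\<close> has a step at \<open>A\<close> and \<open>w\<close> has
        none.\<close>
      obtain e where e: "e > 1" "(1 - e) *\<^sub>R u + e *\<^sub>R w \<in> T"
        using convex_rel_interior_iff[OF conv T(2), of w] w u by auto
      have "flag_of u \<subseteq> flag_of w"
      proof
        fix A assume A: "A \<in> flag_of u"
        have Ad: "A \<in> d" using flag_of_subset[OF d ud] A by blast
        show "A \<in> flag_of w"
        proof (rule flag_ofI)
          fix i j assume ij: "i \<in> A" "j \<notin> A"
          have "(1 - e) *\<^sub>R u + e *\<^sub>R w \<in> flag_cone d" using e sub by blast
          then have "((1 - e) *\<^sub>R u + e *\<^sub>R w) $ j \<le> ((1 - e) *\<^sub>R u + e *\<^sub>R w) $ i"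
            by (rule flag_coneD) (use flags_nested[OF d Ad] ij in blast)
          then have "(e - 1) * (u $ i - u $ j) \<le> e * (w $ i - w $ j)" by (simp add: algebra_simps)
          moreover have "0 < (e - 1) * (u $ i - u $ j)" using e(1) flag_ofD[OF A ij] by simp
          ultimately have "0 < e * (w $ i - w $ j)" by linarith
          then show "w $ j < w $ i" using e(1) by (simp add: zero_less_mult_iff)
        qed (use A in \<open>auto simp: flag_of_def\<close>)
      qed
      then show "u \<in> flag_cone (flag_of w)"
        by (rule flag_cone_eqI[OF flag_of_in_flags flag_cone_zero_sum[OF ud]])
    qed
    show "flag_cone (flag_of w) \<subseteq> T"
    proof
      fix u assume u: "u \<in> flag_cone (flag_of w)"
      have ud: "u \<in> flag_cone d"
        using u flag_cone_mono[OF flag_of_subset[OF d wd(1)]] by blast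
      show "u \<in> T"
      proof (cases "u = w")
        case False
        \<comment> \<open>For small \<open>e\<close> the point
          \<open>w + e *\<^sub>R (w - u)\<close> keeps the finitely many strict inequalities between
          coordinates of \<open>w\<close>, while equal coordinates of \<open>w\<close> are also
          equal in \<open>u\<close>.\<close>
        have lim: "((\<lambda>e. e * (u $ i - u $ j)) \<longlongrightarrow> 0 * (u $ i - u $ j)) (at_right 0)" for i j
          by (intro tendsto_intros)
        have "\<forall>\<^sub>F e in at_right 0. w $ j < w $ i \<longrightarrow> e * (u $ i - u $ j) < w $ i - w $ j" for i j
          using order_tendstoD(2)[OF lim[of i j], of "w $ i - w $ j"] by (cases "w $ j < w $ i") auto
        then have "\<forall>\<^sub>F e in at_right 0. \<forall>i j. w $ j < w $ i \<longrightarrow> e * (u $ i - u $ j) < w $ i - w $ j"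
          by (simp add: eventually_all_finite)
        moreover have "\<forall>\<^sub>F e in at_right (0::real). e > 0"
          by (rule eventually_at_right_less)
        ultimately have ev: "\<forall>\<^sub>F e in at_right 0. e > 0 \<and> (\<forall>i j. w $ j < w $ i \<longrightarrow> e * (u $ i - u $ j) < w $ i - w $ j)"
          by (rule eventually_conj[rotated])
        obtain e where e': "e > 0 \<and> (\<forall>i j. w $ j < w $ i \<longrightarrow> e * (u $ i - u $ j) < w $ i - w $ j)"
          using eventually_happens'[OF trivial_limit_at_right_real ev] by (elim exE)
        have e: "e > 0" "\<And>i j. w $ j < w $ i \<Longrightarrow> e * (u $ i - u $ j) < w $ i - w $ j"
          using e' by simp_all
        define y where "y = w + e *\<^sub>R (w - u)"
        have "y \<in> flag_cone d"
          unfolding flag_cone_def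
        proof (intro CollectI conjI allI impI)
          show "y \<in> zero_sum" unfolding y_def using wd(2) flag_cone_zero_sum[OF u]
            by (intro subspace_add subspace_scale subspace_diff subspace_zero_sum)
          fix i j assume ij: "\<forall>A\<in>d. j \<in> A \<longrightarrow> i \<in> A"
          have le: "w $ j \<le> w $ i" by (rule flag_coneD[OF wd(1)]) (use ij in blast)
          have ju: "w $ j \<le> w $ i \<Longrightarrow> u $ j \<le> u $ i" for i j
            by (rule flag_coneD[OF u]) (use flag_of_le_iff[of w j i] in blast)
          show "y $ j \<le> y $ i"
          proof (cases "w $ j = w $ i")
            case True
            then have "u $ j = u $ i" using ju[of j i] ju[of i j] by simp
            then show ?thesis using True by (simp add: y_def)
          next
            case False
            then have "w $ j < w $ i" using le by simp
            from e(2)[OF this] have "e * (u $ i - u $ j) < w $ i - w $ j" .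
            moreover have "0 \<le> e * (w $ i - w $ j)" using e(1) le by simp
            moreover have "y $ i - y $ j = (w $ i - w $ j) + e * (w $ i - w $ j) - e * (u $ i - u $ j)"
              by (simp add: y_def algebra_simps)
            ultimately show ?thesis by linarith
          qed
        qed
        have "w \<in> open_segment u y"
        proof -
          \<comment> \<open>The solution of
            \<open>w = (1 - t) *\<^sub>R u + t *\<^sub>R y\<close>.\<close>
          define t where "t = 1 / (1 + e)"
          have t: "0 < t" "t < 1" "(1 - t) = t * e" using e(1) by (auto simp: t_def field_simps)
          have "(1 - t) *\<^sub>R u + t *\<^sub>R y = (t + t * e) *\<^sub>R w"
            unfolding y_def t(3) by (simp add: algebra_simps)
          also have "t + t * e = 1" using t(3) by simp
          finally have "w = (1 - t) *\<^sub>R u + t *\<^sub>R y" by simp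
          moreover have "u \<noteq> y"
          proof
            assume "u = y"
            then have "(1 + e) *\<^sub>R (w - u) = 0" by (simp add: y_def algebra_simps)
            then show False using False e(1) by simp
          qed
          ultimately show ?thesis using t by (auto simp: in_segment)
        qed
        then show ?thesis
          using T(1) ud \<open>y \<in> flag_cone d\<close> wT unfolding face_of_def by blast
      qed (use wT in simp)
    qed
  qed
  then show ?thesis using flag_of_in_flags by blast
qed

section \<open>Weyl chambers and their closures\<close>

lemma type_A_arrangement_complement:
  "span type_A_roots - (\<Union>\<alpha>\<in>type_A_roots. {v. \<alpha> \<bullet> v = 0}) =
    {v \<in> zero_sum. \<forall>i j. i \<noteq> j \<longrightarrow> v $ i \<noteq> (v :: real ^ 'n::finite) $ j}"
proof -
  have "(\<exists>\<alpha>\<in>type_A_roots. \<alpha> \<bullet> v = 0) \<longleftrightarrow> (\<exists>i j. i \<noteq> j \<and> v $ i = v $ j)" for v :: "real ^ 'n"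
  proof
    assume "\<exists>\<alpha>\<in>type_A_roots. \<alpha> \<bullet> v = 0"
    then obtain i j where "i \<noteq> j" "v \<bullet> (axis i 1 - axis j 1) = 0"
      by (auto simp: type_A_roots_def inner_commute)
    then show "\<exists>i j. i \<noteq> j \<and> v $ i = v $ j" by (auto simp: inner_axis_diff)
  next
    assume "\<exists>i j. i \<noteq> j \<and> v $ i = v $ j"
    then obtain i j where ij: "i \<noteq> j" "v $ i = v $ j" by blast
    then have "(axis i 1 - axis j 1) \<bullet> v = 0" by (simp add: inner_commute[of _ v] inner_axis_diff)
    moreover have "axis i 1 - axis j 1 \<in> (type_A_roots :: (real ^ 'n) set)"
      using ij(1) by (auto simp: type_A_roots_def)
    ultimately show "\<exists>\<alpha>\<in>type_A_roots. \<alpha> \<bullet> v = 0" by blast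
  qed
  then show ?thesis by (auto simp: span_type_A_roots)
qed

definition open_chamber :: "real ^ 'n::finite \<Rightarrow> (real ^ 'n) set" where
  "open_chamber v = {w \<in> zero_sum. \<forall>i j. v $ i < v $ j \<longrightarrow> w $ i < w $ j}"

lemma convex_open_chamber: "convex (open_chamber v)"
proof -
  have "open_chamber v = zero_sum \<inter>
      (\<Inter>p\<in>{p. v $ fst p < v $ snd p}. {u. (axis (fst p) 1 - axis (snd p) 1) \<bullet> u < 0})"
    by (auto simp: open_chamber_def inner_commute[of "_ - _"] inner_axis_diff)
  then show ?thesis
    using subspace_imp_convex[OF subspace_zero_sum] by (auto intro!: convex_Int convex_INT convex_halfspace_lt)
qed

lemma closed_flag_cone: "closed (flag_cone c)"
proof -
  have "flag_cone c = zero_sum \<inter> (\<Inter>p\<in>{p. \<forall>A\<in>c. snd p \<in> A \<longrightarrow> fst p \<in> A}. {u. (axis (snd p) 1 - axis (fst p) 1) \<bullet> u \<le> 0})"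
    by (auto simp: flag_cone_def inner_commute[of "_ - _"] inner_axis_diff)
  then show ?thesis
    using closed_subspace[OF subspace_zero_sum] by (auto intro!: closed_Int closed_INT closed_halfspace_le)
qed

lemma closure_open_chamber:
  fixes v :: "real ^ 'n::finite"
  assumes v: "v \<in> zero_sum" "\<And>i j. i \<noteq> j \<Longrightarrow> v $ i \<noteq> v $ j"
  shows "closure (open_chamber v) = flag_cone (flag_of v)"
proof
  show "closure (open_chamber v) \<subseteq> flag_cone (flag_of v)"
  proof (rule closure_minimal[OF _ closed_flag_cone])
    show "open_chamber v \<subseteq> flag_cone (flag_of v)"
    proof
      fix w assume w: "w \<in> open_chamber v"
      have "w $ j \<le> w $ i" if "v $ j \<le> v $ i" for i j
      proof (cases "i = j")
        case False
        then have "v $ j < v $ i" using that v(2)[of i j] by simp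
        then show ?thesis using w by (simp add: open_chamber_def less_imp_le)
      qed simp
      then show "w \<in> flag_cone (flag_of v)"
        using w by (simp add: flag_cone_def flag_of_le_iff open_chamber_def)
    qed
  qed
  show "flag_cone (flag_of v) \<subseteq> closure (open_chamber v)"
  proof
    fix w assume w: "w \<in> flag_cone (flag_of v)"
    show "w \<in> closure (open_chamber v)"
      unfolding closure_approachable
    proof (intro allI impI)
      fix e :: real assume e: "e > 0"
      \<comment> \<open>A small multiple of \<open>v\<close> added to \<open>w\<close> turns weak
        inequalities into strict ones. The \<open>+ 1\<close> covers \<open>v = 0\<close>, which
        occurs when there is only one coordinate.\<close>
      define t where "t = e / (norm v + 1)"
      have t: "t > 0" using e by (simp add: t_def add_nonneg_pos)
      have "norm v + 1 > 0" by (simp add: add_nonneg_pos)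
      then have "t * norm v < e" using e by (simp add: t_def field_simps)
      then have "dist (w + t *\<^sub>R v) w < e" using t by (simp add: dist_norm)
      moreover have "w + t *\<^sub>R v \<in> open_chamber v"
        unfolding open_chamber_def
      proof (intro CollectI conjI allI impI)
        show "w + t *\<^sub>R v \<in> zero_sum"
          using v(1) flag_cone_zero_sum[OF w] by (intro subspace_add subspace_scale subspace_zero_sum)
        fix i j assume ij: "v $ i < v $ j"
        have "w $ i \<le> w $ j"
          by (rule flag_coneD[OF w]) (use flag_of_le_iff[of v i j] ij in auto)
        moreover have "t * v $ i < t * v $ j" using t ij by simp
        ultimately show "(w + t *\<^sub>R v) $ i < (w + t *\<^sub>R v) $ j" by simp
      qed
      ultimately show "\<exists>y\<in>open_chamber v. dist y w < e" by blast
    qed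
  qed
qed

text \<open>The chamber is convex and hence connected. Conversely, if two coordinates changed their
  order within a connected set, an intermediate point would lie on the corresponding reflecting
  hyperplane.\<close>

lemma connected_component_open_chamber:
  fixes v :: "real ^ 'n::finite"
  defines "S \<equiv> {v \<in> zero_sum. \<forall>i j. i \<noteq> j \<longrightarrow> v $ i \<noteq> (v :: real ^ 'n::finite) $ j}"
  assumes v: "v \<in> S"
  shows "connected_component_set S v = open_chamber v"
proof
  have vv: "v \<in> zero_sum" "\<And>i j. i \<noteq> j \<Longrightarrow> v $ i \<noteq> v $ j" using v by (auto simp: S_def)
  have "open_chamber v \<subseteq> S"
  proof
    fix w assume w: "w \<in> open_chamber v"
    have "w $ i \<noteq> w $ j" if "i \<noteq> j" for i j
    proof -
      have "v $ i < v $ j \<or> v $ j < v $ i" using vv(2)[OF that] by linarith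
      then have "w $ i < w $ j \<or> w $ j < w $ i" using w by (auto simp: open_chamber_def)
      then show ?thesis by auto
    qed
    then show "w \<in> S" using w by (simp add: S_def open_chamber_def)
  qed
  then show "open_chamber v \<subseteq> connected_component_set S v"
    using vv(1) by (intro connected_component_maximal convex_connected convex_open_chamber) (auto simp: open_chamber_def)
  show "connected_component_set S v \<subseteq> open_chamber v"
  proof
    fix w assume w: "w \<in> connected_component_set S v"
    have T: "connected (connected_component_set S v)" "v \<in> connected_component_set S v"
      "connected_component_set S v \<subseteq> S"
      using v by (auto simp: connected_component_subset)
    have "w $ i < w $ j" if ij: "v $ i < v $ j" for i j
    proof (rule ccontr)
      assume "\<not> w $ i < w $ j"
      then have "(axis j 1 - axis i 1) \<bullet> w \<le> 0" "0 \<le> (axis j 1 - axis i 1) \<bullet> v"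
        using ij by (simp_all add: inner_commute[of "_ - _"] inner_axis_diff)
      then obtain z where z: "z \<in> connected_component_set S v" "(axis j 1 - axis i 1) \<bullet> z = 0"
        using connected_ivt_hyperplane[OF T(1) w T(2)] by blast
      have "i \<noteq> j" using ij by auto
      then show False
        using z T(3) by (auto simp: inner_commute[of "_ - _"] inner_axis_diff S_def)
    qed
    moreover have "w \<in> zero_sum" using w T(3) by (auto simp: S_def)
    ultimately show "w \<in> open_chamber v" by (simp add: open_chamber_def)
  qed
qed

lemma open_weyl_chambers_type_A:
  "open_weyl_chambers type_A_roots =
    open_chamber ` {v \<in> zero_sum. \<forall>i j. i \<noteq> j \<longrightarrow> v $ i \<noteq> (v :: real ^ 'n::finite) $ j}"
  unfolding open_weyl_chambers_def type_A_arrangement_complement components_def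
  by (rule image_cong[OF refl connected_component_open_chamber])

lemma generic_refinement:
  fixes c :: "'n::finite set set"
  assumes c: "c \<in> flags"
  shows "\<exists>v\<in>zero_sum. (\<forall>i j. i \<noteq> j \<longrightarrow> v $ i \<noteq> v $ j) \<and> c \<subseteq> flag_of v"
proof -
  obtain f where f: "bij_betw f (UNIV :: 'n set) {0..<CARD('n)}"
    using ex_bij_betw_finite_nat[of "UNIV :: 'n set"] by auto
  have flt: "f i < CARD('n)" for i using f by (auto simp: bij_betw_def)
  \<comment> \<open>A two-digit number in base \<open>CARD('n)\<close>: the leading digit counts the
    members of the flag through \<open>i\<close>, and the arbitrary numbering \<open>f\<close>
    breaks ties. Subtracting the mean \<open>s\<close> moves the vector into the hyperplane.\<close>
  define p where "p i = card {A\<in>c. i \<in> A} * CARD('n) + f i" for i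
  define s where "s = (\<Sum>i\<in>UNIV. real (p i)) / CARD('n)"
  define v :: "real ^ 'n" where "v = (\<chi> i. real (p i) - s)"
  have "v \<in> zero_sum" by (simp add: zero_sum_def v_def sum_subtractf s_def)
  moreover have "v $ i \<noteq> v $ j" if "i \<noteq> j" for i j
  proof
    assume "v $ i = v $ j"
    then have "p i mod CARD('n) = p j mod CARD('n)" by (simp add: v_def)
    then have "f i = f j" using flt by (simp add: p_def)
    then show False using f that by (auto simp: bij_betw_def inj_on_def)
  qed
  moreover have "c \<subseteq> flag_of v"
  proof
    fix A assume A: "A \<in> c"
    show "A \<in> flag_of v"
    proof (rule flag_ofI)
      fix i j assume ij: "i \<in> A" "j \<notin> A"
      have "card {B\<in>c. j \<in> B} + 1 \<le> card {B\<in>c. i \<in> B}"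
        using card_flag_less[OF c A ij] by simp
      then have "(card {B\<in>c. j \<in> B} + 1) * CARD('n) \<le> card {B\<in>c. i \<in> B} * CARD('n)"
        by (rule mult_le_mono1)
      then have "p j < p i" using flt[of j] by (simp add: p_def algebra_simps)
      then show "v $ j < v $ i" by (simp add: v_def)
    qed (use flags_proper[OF c A] in auto)
  qed
  ultimately show ?thesis by blast
qed

proposition coxeter_fan_type_A: "coxeter_fan (type_A_roots :: (real ^ 'n::finite) set) = flag_cone ` flags"
proof
  show "coxeter_fan (type_A_roots :: (real ^ 'n) set) \<subseteq> flag_cone ` flags"
  proof
    fix \<sigma> :: "(real ^ 'n) set" assume "\<sigma> \<in> coxeter_fan type_A_roots"
    then obtain v where v: "v \<in> zero_sum" "\<forall>i j. i \<noteq> j \<longrightarrow> v $ i \<noteq> v $ j" and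
      \<sigma>: "\<sigma> \<noteq> {}" "\<sigma> face_of closure (open_chamber v)"
      unfolding coxeter_fan_def open_weyl_chambers_type_A by auto
    have "\<sigma> face_of flag_cone (flag_of v)"
      using \<sigma>(2) closure_open_chamber[OF v(1)] v(2) by simp
    then show "\<sigma> \<in> flag_cone ` flags"
      using flag_cone_faces[OF flag_of_in_flags _ \<sigma>(1)] by blast
  qed
  show "flag_cone ` flags \<subseteq> coxeter_fan (type_A_roots :: (real ^ 'n) set)"
  proof (rule image_subsetI)
    fix c :: "'n set set" assume c: "c \<in> flags"
    obtain v where v: "v \<in> zero_sum" "\<forall>i j. i \<noteq> j \<longrightarrow> v $ i \<noteq> v $ j" "c \<subseteq> flag_of v"
      using generic_refinement[OF c] by blast
    have "flag_cone c face_of closure (open_chamber v)"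
      using flag_cone_face[OF c flag_of_in_flags v(3)] closure_open_chamber[OF v(1)] v(2) by simp
    moreover have "flag_cone c \<noteq> {}" using flag_vec_in_flag_cone[OF c] by blast
    moreover have "open_chamber v \<in> open_weyl_chambers type_A_roots"
      unfolding open_weyl_chambers_type_A using v by blast
    ultimately show "flag_cone c \<in> coxeter_fan type_A_roots"
      unfolding coxeter_fan_def by blast
  qed
qed

section \<open>Spaces of monoid homomorphisms\<close>

definition hom_space :: "'a::euclidean_space set \<Rightarrow> ('a \<Rightarrow> complex) topology" where
  "hom_space S = subtopology (product_topology (\<lambda>_. euclidean) S)
    {x. x 0 = 1 \<and> (\<forall>m\<in>S. \<forall>m'\<in>S. x (m + m') = x m * x m')}"

lemma affine_toric_eq_hom_space: "affine_toric N \<sigma> = hom_space (dual_monoid N \<sigma>)"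
  by (simp add: affine_toric_def hom_space_def)

lemma in_hom_space_iff:
  "x \<in> topspace (hom_space S) \<longleftrightarrow>
    x \<in> extensional S \<and> x 0 = 1 \<and> (\<forall>m\<in>S. \<forall>m'\<in>S. x (m + m') = x m * x m')"
  by (simp add: hom_space_def PiE_def)

lemma hom_space_0: "x \<in> topspace (hom_space S) \<Longrightarrow> x 0 = 1"
  by (simp add: in_hom_space_iff)

lemma hom_space_add: "x \<in> topspace (hom_space S) \<Longrightarrow> m \<in> S \<Longrightarrow> m' \<in> S \<Longrightarrow> x (m + m') = x m * x m'"
  by (simp add: in_hom_space_iff)

lemma hom_space_extensional: "x \<in> topspace (hom_space S) \<Longrightarrow> x \<in> extensional S"
  by (simp add: in_hom_space_iff)

lemma continuous_map_into_hom_space: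
  assumes "f \<in> topspace X \<rightarrow> topspace (hom_space S)" "\<And>m. m \<in> S \<Longrightarrow> continuous_map X euclidean (\<lambda>x. f x m)"
  shows "continuous_map X (hom_space S) f"
  unfolding hom_space_def continuous_map_in_subtopology
proof
  have ext: "f x \<in> extensional S" "f x \<in> {x. x 0 = 1 \<and> (\<forall>m\<in>S. \<forall>m'\<in>S. x (m + m') = x m * x m')}"
    if "x \<in> topspace X" for x
    using that assms(1) by (auto simp: Pi_iff in_hom_space_iff)
  show "continuous_map X (product_topology (\<lambda>_. euclidean) S) f"
    using assms(2) ext by (auto simp: continuous_map_componentwise)
  show "f \<in> topspace X \<rightarrow> {x. x 0 = 1 \<and> (\<forall>m\<in>S. \<forall>m'\<in>S. x (m + m') = x m * x m')}"
    using ext by blast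
qed

lemma continuous_map_hom_space_eval:
  assumes "m \<in> S"
  shows "continuous_map (hom_space S) euclidean (\<lambda>x. x m)"
  unfolding hom_space_def
  by (intro continuous_map_from_subtopology continuous_map_product_projection assms)

lemma continuous_map_euclidean_Pair:
  fixes f :: "'x \<Rightarrow> 'b::topological_space" and g :: "'x \<Rightarrow> 'c::topological_space"
  assumes f: "continuous_map X euclidean f" and g: "continuous_map X euclidean g"
  shows "continuous_map X euclidean (\<lambda>x. (f x, g x))"
  unfolding continuous_map_def
proof (intro conjI allI impI)
  fix W :: "('b \<times> 'c) set" assume "openin euclidean W"
  then have W: "open W" by simp
  show "openin X {x \<in> topspace X. (f x, g x) \<in> W}"
  proof (subst openin_subopen, intro ballI)
    fix x assume "x \<in> {x \<in> topspace X. (f x, g x) \<in> W}"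
    then have x: "x \<in> topspace X" "(f x, g x) \<in> W" by auto
    obtain A B where AB: "open A" "open B" "(f x, g x) \<in> A \<times> B" "A \<times> B \<subseteq> W"
      using open_prod_elim[OF W x(2)] by blast
    have "openin X ({y \<in> topspace X. f y \<in> A} \<inter> {y \<in> topspace X. g y \<in> B})"
      using AB by (intro openin_Int openin_continuous_map_preimage[OF f] openin_continuous_map_preimage[OF g])
        (simp_all add: AB(1,2))
    moreover have "x \<in> {y \<in> topspace X. f y \<in> A} \<inter> {y \<in> topspace X. g y \<in> B}"
      using x(1) AB(3) by auto
    moreover have "{y \<in> topspace X. f y \<in> A} \<inter> {y \<in> topspace X. g y \<in> B} \<subseteq> {x \<in> topspace X. (f x, g x) \<in> W}"
      using AB(4) by auto
    ultimately show "\<exists>T. openin X T \<and> x \<in> T \<and> T \<subseteq> {x \<in> topspace X. (f x, g x) \<in> W}" by blast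
  qed
qed simp

text \<open>The monoid \<open>S'\<close> arises from \<open>S\<close> by inverting the element \<open>m0\<close>.\<close>

locale localization =
  fixes S S' :: "'a::euclidean_space set" and m0 :: 'a
  assumes sub: "S \<subseteq> S'" and zero: "0 \<in> S"
    and add: "\<And>m m'. m \<in> S \<Longrightarrow> m' \<in> S \<Longrightarrow> m + m' \<in> S"
    and add': "\<And>m m'. m \<in> S' \<Longrightarrow> m' \<in> S' \<Longrightarrow> m + m' \<in> S'"
    and m0: "m0 \<in> S" and neg: "- m0 \<in> S'"
    and inverts: "\<And>m. m \<in> S' \<Longrightarrow> \<exists>k::nat. m + real k *\<^sub>R m0 \<in> S"
begin

lemma restrict_in:
  assumes "z \<in> topspace (hom_space S')"
  shows "restrict z S \<in> topspace (hom_space S)"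
  unfolding in_hom_space_iff
proof (intro conjI ballI)
  show "restrict z S 0 = 1" using zero hom_space_0[OF assms] by simp
  show "restrict z S (m + m') = restrict z S m * restrict z S m'" if "m \<in> S" "m' \<in> S" for m m'
    using that add[OF that] hom_space_add[OF assms subsetD[OF sub] subsetD[OF sub]] by simp
qed simp

lemma continuous_map_restrict: "continuous_map (hom_space S') (hom_space S) (\<lambda>z. restrict z S)"
proof (rule continuous_map_into_hom_space)
  fix m assume m: "m \<in> S"
  then have "continuous_map (hom_space S') euclidean (\<lambda>z. z m)"
    using sub by (intro continuous_map_hom_space_eval) auto
  then show "continuous_map (hom_space S') euclidean (\<lambda>z. restrict z S m)" using m by simp
qed (simp add: Pi_iff restrict_in)

lemma nonzero:
  assumes "z \<in> topspace (hom_space S')"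
  shows "z m0 \<noteq> 0"
proof -
  have "z m0 * z (- m0) = z (m0 + - m0)"
    using hom_space_add[OF assms, of m0 "- m0"] m0 neg sub by auto
  then show ?thesis using hom_space_0[OF assms] by auto
qed

lemma multiple_in: "real k *\<^sub>R m0 \<in> S"
  by (induction k) (auto simp: zero scaleR_left_distrib intro!: add m0)

lemma hom_multiple:
  assumes "x \<in> topspace (hom_space S)"
  shows "x (real k *\<^sub>R m0) = x m0 ^ k"
proof (induction k)
  case (Suc k)
  have "x (real (Suc k) *\<^sub>R m0) = x (m0 + real k *\<^sub>R m0)" by (simp add: scaleR_left_distrib)
  also have "\<dots> = x m0 * x (real k *\<^sub>R m0)" by (rule hom_space_add[OF assms m0 multiple_in])
  finally show ?case using Suc by simp
qed (simp add: hom_space_0[OF assms])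

definition den :: "'a \<Rightarrow> nat" where
  "den m = (SOME k. m + real k *\<^sub>R m0 \<in> S)"

lemma den: "m \<in> S' \<Longrightarrow> m + real (den m) *\<^sub>R m0 \<in> S"
  unfolding den_def by (rule someI_ex[OF inverts])

definition extend :: "('a \<Rightarrow> complex) \<Rightarrow> 'a \<Rightarrow> complex" where
  "extend x = (\<lambda>m\<in>S'. x (m + real (den m) *\<^sub>R m0) / x m0 ^ den m)"

text \<open>The value of the fraction is independent of the exponent that clears the denominator, so
  \<open>den\<close> may be any choice.\<close>

lemma extend_eq:
  assumes x: "x \<in> topspace (hom_space S)" "x m0 \<noteq> 0" and m: "m \<in> S'" "m + real k *\<^sub>R m0 \<in> S"
  shows "extend x m = x (m + real k *\<^sub>R m0) / x m0 ^ k"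
proof -
  have "x (m + real k *\<^sub>R m0) * x m0 ^ den m = x ((m + real k *\<^sub>R m0) + real (den m) *\<^sub>R m0)"
    using hom_space_add[OF x(1) m(2) multiple_in] hom_multiple[OF x(1)] by simp
  also have "(m + real k *\<^sub>R m0) + real (den m) *\<^sub>R m0 = (m + real (den m) *\<^sub>R m0) + real k *\<^sub>R m0"
    by simp
  also have "x \<dots> = x (m + real (den m) *\<^sub>R m0) * x m0 ^ k"
    using hom_space_add[OF x(1) den[OF m(1)] multiple_in] hom_multiple[OF x(1)] by simp
  finally show ?thesis using x(2) m(1) by (simp add: extend_def field_simps)
qed

lemma extend_in:
  assumes x: "x \<in> topspace (hom_space S)" "x m0 \<noteq> 0"
  shows "extend x \<in> topspace (hom_space S')"
  unfolding in_hom_space_iff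
proof (intro conjI ballI)
  show "extend x \<in> extensional S'" by (simp add: extend_def)
  show "extend x 0 = 1"
    using extend_eq[OF x, of 0 0] zero sub hom_space_0[OF x(1)] by auto
  fix m m' assume m: "m \<in> S'" "m' \<in> S'"
  let ?k = "den m" and ?k' = "den m'"
  have eq: "(m + real ?k *\<^sub>R m0) + (m' + real ?k' *\<^sub>R m0) = (m + m') + real (?k + ?k') *\<^sub>R m0"
    by (simp add: scaleR_left_distrib)
  have "(m + m') + real (?k + ?k') *\<^sub>R m0 \<in> S"
    using add[OF den[OF m(1)] den[OF m(2)]] unfolding eq .
  then have "extend x (m + m') = x ((m + m') + real (?k + ?k') *\<^sub>R m0) / x m0 ^ (?k + ?k')"
    using m by (intro extend_eq[OF x] add')
  also have "x ((m + m') + real (?k + ?k') *\<^sub>R m0) = x (m + real ?k *\<^sub>R m0) * x (m' + real ?k' *\<^sub>R m0)"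
    unfolding eq[symmetric] by (rule hom_space_add[OF x(1) den[OF m(1)] den[OF m(2)]])
  finally show "extend x (m + m') = extend x m * extend x m'"
    using m by (simp add: extend_def power_add)
qed

lemma restrict_extend:
  assumes x: "x \<in> topspace (hom_space S)" "x m0 \<noteq> 0"
  shows "restrict (extend x) S = x"
proof
  fix m
  show "restrict (extend x) S m = x m"
  proof (cases "m \<in> S")
    case True
    then show ?thesis using extend_eq[OF x, of m 0] sub by auto
  next
    case False
    then show ?thesis using hom_space_extensional[OF x(1)] by (simp add: extensional_def)
  qed
qed

lemma extend_restrict:
  assumes z: "z \<in> topspace (hom_space S')"
  shows "extend (restrict z S) = z"
proof
  fix m
  show "extend (restrict z S) m = z m"
  proof (cases "m \<in> S'")
    case True
    have mult: "z (real k *\<^sub>R m0) = z m0 ^ k" for k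
      using hom_multiple[OF restrict_in[OF z], of k] multiple_in m0 by simp
    have "z (m + real (den m) *\<^sub>R m0) = z m * z (real (den m) *\<^sub>R m0)"
      using multiple_in sub by (intro hom_space_add[OF z True]) auto
    then show ?thesis
      using True den[OF True] m0 nonzero[OF z] by (simp add: extend_def mult)
  next
    case False
    then show ?thesis using hom_space_extensional[OF z] by (simp add: extend_def extensional_def)
  qed
qed

lemma restrict_inj:
  assumes "z \<in> topspace (hom_space S')" "z' \<in> topspace (hom_space S')" "restrict z S = restrict z' S"
  shows "z = z'"
proof -
  have "z = extend (restrict z S)" by (rule extend_restrict[OF assms(1), symmetric])
  also have "\<dots> = z'" unfolding assms(3) by (rule extend_restrict[OF assms(2)])
  finally show ?thesis .
qed

text \<open>Restriction identifies the localized space with the locus \<open>D\<close> where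
  \<open>m0\<close> does not vanish. This locus is open, and on it \<open>extend\<close> is a
  continuous inverse, being a quotient of coordinates.\<close>

lemma openin_restrict_image:
  assumes W: "openin (hom_space S') W"
  shows "openin (hom_space S) ((\<lambda>z. restrict z S) ` W)"
proof -
  define D where "D = {x \<in> topspace (hom_space S). x m0 \<in> - {0}}"
  have D: "openin (hom_space S) D"
    unfolding D_def
    by (rule openin_continuous_map_preimage[OF continuous_map_hom_space_eval[OF m0]]) auto
  have Dtop: "topspace (subtopology (hom_space S) D) = D"
    using openin_subset[OF D] by auto
  have ev: "continuous_map (subtopology (hom_space S) D) euclidean (\<lambda>x. x m)" if "m \<in> S" for m
    by (intro continuous_map_from_subtopology continuous_map_hom_space_eval that)
  have "continuous_map (subtopology (hom_space S) D) (hom_space S') extend"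
  proof (rule continuous_map_into_hom_space)
    show "extend \<in> topspace (subtopology (hom_space S) D) \<rightarrow> topspace (hom_space S')"
      unfolding Dtop using extend_in by (auto simp: D_def)
    fix m assume m: "m \<in> S'"
    have "continuous_map (subtopology (hom_space S) D) (top_of_set (UNIV \<times> - {0}))
        (\<lambda>x. (x (m + real (den m) *\<^sub>R m0), x m0))"
      unfolding continuous_map_in_subtopology
    proof
      show "continuous_map (subtopology (hom_space S) D) euclidean (\<lambda>x. (x (m + real (den m) *\<^sub>R m0), x m0))"
        using m m0 den[OF m] by (intro continuous_map_euclidean_Pair ev) auto
      show "(\<lambda>x. (x (m + real (den m) *\<^sub>R m0), x m0)) \<in> topspace (subtopology (hom_space S) D) \<rightarrow> UNIV \<times> - {0}"
        unfolding Dtop by (auto simp: D_def)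
    qed
    moreover have "continuous_map (top_of_set (UNIV \<times> - {0})) euclidean (\<lambda>(a, b :: complex). a / b ^ den m)"
      by (auto simp: split_beta intro!: continuous_intros)
    ultimately have "continuous_map (subtopology (hom_space S) D) euclidean
        ((\<lambda>(a, b). a / b ^ den m) \<circ> (\<lambda>x. (x (m + real (den m) *\<^sub>R m0), x m0)))"
      by (rule continuous_map_compose)
    then show "continuous_map (subtopology (hom_space S) D) euclidean (\<lambda>x. extend x m)"
      using m by (simp add: extend_def o_def)
  qed
  then have "openin (subtopology (hom_space S) D) {x \<in> topspace (subtopology (hom_space S) D). extend x \<in> W}"
    using W by (rule openin_continuous_map_preimage)
  then have "openin (hom_space S) {x \<in> D. extend x \<in> W}"
    unfolding Dtop using D openin_trans_full by blast
  also have "{x \<in> D. extend x \<in> W} = (\<lambda>z. restrict z S) ` W"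
  proof
    show "{x \<in> D. extend x \<in> W} \<subseteq> (\<lambda>z. restrict z S) ` W"
    proof
      fix x assume x: "x \<in> {x \<in> D. extend x \<in> W}"
      then have "x = restrict (extend x) S" by (intro restrict_extend[symmetric]) (simp_all add: D_def)
      then show "x \<in> (\<lambda>z. restrict z S) ` W" using x by blast
    qed
    show "(\<lambda>z. restrict z S) ` W \<subseteq> {x \<in> D. extend x \<in> W}"
    proof (rule image_subsetI)
      fix z assume z: "z \<in> W"
      then have zt: "z \<in> topspace (hom_space S')" using openin_subset[OF W] by auto
      show "restrict z S \<in> {x \<in> D. extend x \<in> W}"
        using restrict_in[OF zt] nonzero[OF zt] extend_restrict[OF zt] z m0 by (simp add: D_def)
    qed
  qed
  finally show ?thesis .
qed

end

section \<open>Dual monoids of the cones\<close>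

text \<open>The dual monoid of the cone, tested only on the ray generators \<open>indvec A\<close>,
  against which the pairing is a partial sum.\<close>

definition flag_monoid :: "'n::finite set set \<Rightarrow> (real ^ 'n) set" where
  "flag_monoid c = {m \<in> zero_sum. (\<forall>i. m $ i \<in> \<int>) \<and> (\<forall>A\<in>c. 0 \<le> part_sum m A)}"

lemma part_sum_add: "part_sum (m + m') A = part_sum m A + part_sum m' A"
  by (simp add: part_sum_def sum.distrib)

lemma part_sum_minus: "part_sum (- m) A = - part_sum m A"
  by (simp add: part_sum_def sum_negf)

lemma part_sum_scaleR: "part_sum (k *\<^sub>R m) A = k * part_sum m A"
  by (simp add: part_sum_def sum_distrib_left)

lemma part_sum_sum: "part_sum (\<Sum>i\<in>I. f i) A = (\<Sum>i\<in>I. part_sum (f i) A)"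
  unfolding part_sum_def by (simp add: sum.swap[of _ I])

lemma part_sum_0 [simp]: "part_sum 0 A = 0"
  by (simp add: part_sum_def)

lemma part_sum_axis_diff:
  "part_sum (axis i 1 - axis j 1) A = (if i \<in> A then 1 else 0) - (if j \<in> A then 1 else 0)" for A :: "'n::finite set"
  by (simp add: part_sum_def sum_subtractf axis_def)

lemma part_sum_Ints: "(\<And>i. m $ i \<in> \<int>) \<Longrightarrow> part_sum m A \<in> \<int>"
  unfolding part_sum_def by (intro Ints_sum)

text \<open>Subtracting a multiple of \<open>indvec A\<close> from \<open>u\<close> levels the step of \<open>u\<close> at \<open>A\<close>.\<close>

lemma inner_nonneg_on_cone:
  fixes m u :: "real ^ 'n::finite"
  assumes "m \<in> zero_sum" "u \<in> zero_sum" "\<And>A. A \<in> flag_of u \<Longrightarrow> 0 \<le> part_sum m A"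
  shows "0 \<le> m \<bullet> u"
  using assms(2,3)
proof (induction "card (flag_of u)" arbitrary: u rule: less_induct)
  case less
  show ?case
  proof (cases "flag_of u = {}")
    case True
    fix k
    have const: "u $ i = u $ k" for i
      using flag_of_le_iff[of u i k] flag_of_le_iff[of u k i] True by auto
    have "m \<bullet> u = (\<Sum>i\<in>UNIV. m $ i) * u $ k"
      unfolding inner_vec_def sum_distrib_right
    proof (rule sum.cong)
      show "m $ i \<bullet> u $ i = m $ i * u $ k" for i using const[of i] by simp
    qed simp
    then show ?thesis using assms(1) by (simp add: zero_sum_def)
  next
    case False
    then obtain A where A: "A \<in> flag_of u" by blast
    then have ne: "A \<noteq> {}" "- A \<noteq> {}" by (auto simp: flag_of_def)
    define lo where "lo = Min ((\<lambda>i. u $ i) ` A)"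
    define hi where "hi = Max ((\<lambda>i. u $ i) ` (- A))"
    have lo: "lo \<le> u $ i" if "i \<in> A" for i unfolding lo_def using that by simp
    have hi: "u $ j \<le> hi" if "j \<notin> A" for j unfolding hi_def using that by simp
    have "lo \<in> (\<lambda>i. u $ i) ` A" unfolding lo_def using ne by (intro Min_in) auto
    then obtain i0 where i0: "i0 \<in> A" "lo = u $ i0" by auto
    have "hi \<in> (\<lambda>i. u $ i) ` (- A)" unfolding hi_def using ne by (intro Max_in) auto
    then obtain j0 where j0: "j0 \<notin> A" "hi = u $ j0" by auto
    \<comment> \<open>The height of the step at \<open>A\<close>, from the highest value outside to
      the lowest inside. Subtracting exactly this amount removes \<open>A\<close> from the flag and
      creates no new member.\<close>
    define \<delta> where "\<delta> = lo - hi"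
    have \<delta>: "\<delta> > 0" using flag_ofD[OF A i0(1) j0(1)] by (simp add: \<delta>_def i0 j0)
    define u' where "u' = u - \<delta> *\<^sub>R indvec A"
    have diff: "u' $ i - u' $ j = u $ i - u $ j - \<delta> * ((if i \<in> A then 1 else 0) - (if j \<in> A then 1 else 0))" for i j
      by (simp add: u'_def indvec_nth algebra_simps)
    have sub: "flag_of u' \<subseteq> flag_of u - {A}"
    proof
      fix B assume B: "B \<in> flag_of u'"
      have "B \<in> flag_of u"
      proof (rule flag_ofI)
        fix i j assume ij: "i \<in> B" "j \<notin> B"
        have lt: "u' $ j < u' $ i" by (rule flag_ofD[OF B ij])
        show "u $ j < u $ i"
        proof (cases "j \<in> A \<and> i \<notin> A")
          case True
          then have "u $ j - u $ i \<ge> \<delta>" using lo[of j] hi[of i] by (simp add: \<delta>_def)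
          then show ?thesis using lt diff[of i j] True by simp
        next
          case False
          then show ?thesis using lt diff[of i j] \<delta> by (auto split: if_splits)
        qed
      qed (use B in \<open>auto simp: flag_of_def\<close>)
      moreover have "B \<noteq> A"
      proof
        assume "B = A"
        then have "u' $ j0 < u' $ i0" using flag_ofD[OF B] i0(1) j0(1) by blast
        then show False using diff[of i0 j0] i0 j0 by (simp add: \<delta>_def)
      qed
      ultimately show "B \<in> flag_of u - {A}" by blast
    qed
    have fin: "finite (flag_of u)" by (rule finite_subset[OF subset_UNIV]) simp
    have "card (flag_of u') \<le> card (flag_of u - {A})" using sub fin by (intro card_mono) auto
    also have "\<dots> < card (flag_of u)" using A fin by (intro card_Diff1_less)
    finally have "0 \<le> m \<bullet> u'"
      using sub less.prems
      by (intro less.hyps) (auto simp: u'_def intro!: subspace_diff subspace_scale subspace_zero_sum indvec_in_zero_sum)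
    moreover have "m \<bullet> u = m \<bullet> u' + \<delta> * part_sum m A"
      using assms(1) by (simp add: u'_def inner_diff_right inner_indvec)
    moreover have "0 \<le> \<delta> * part_sum m A" using less.prems(2)[OF A] \<delta> by simp
    ultimately show ?thesis by linarith
  qed
qed

lemma indvec_in_flag_cone: "A \<in> c \<Longrightarrow> indvec A \<in> flag_cone c"
  unfolding flag_cone_def by (auto simp: indvec_in_zero_sum indvec_nth)

lemma dual_monoid_flag_cone:
  fixes c :: "'n::finite set set"
  assumes c: "c \<in> flags"
  shows "dual_monoid (weight_lattice type_A_roots) (flag_cone c) = flag_monoid c"
proof
  show "dual_monoid (weight_lattice type_A_roots) (flag_cone c) \<subseteq> flag_monoid c"
  proof
    fix m assume "m \<in> dual_monoid (weight_lattice type_A_roots) (flag_cone c)"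
    then have m: "m \<in> zero_sum" "\<forall>i. m $ i \<in> \<int>" "\<forall>u\<in>flag_cone c. 0 \<le> m \<bullet> u"
      by (simp_all add: dual_monoid_def dual_weight_lattice_type_A)
    have "0 \<le> part_sum m A" if "A \<in> c" for A
      using bspec[OF m(3) indvec_in_flag_cone[OF that]] by (simp add: inner_indvec[OF m(1)])
    then show "m \<in> flag_monoid c" using m by (simp add: flag_monoid_def)
  qed
  show "flag_monoid c \<subseteq> dual_monoid (weight_lattice type_A_roots) (flag_cone c)"
  proof
    fix m assume "m \<in> flag_monoid c"
    then have m: "m \<in> zero_sum" "\<forall>i. m $ i \<in> \<int>" "\<forall>A\<in>c. 0 \<le> part_sum m A"
      by (simp_all add: flag_monoid_def)
    have "0 \<le> m \<bullet> u" if u: "u \<in> flag_cone c" for u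
      by (rule inner_nonneg_on_cone[OF m(1) flag_cone_zero_sum[OF u]])
        (use flag_of_subset[OF c u] m(3) in blast)
    then show "m \<in> dual_monoid (weight_lattice type_A_roots) (flag_cone c)"
      using m by (simp add: dual_monoid_def dual_weight_lattice_type_A)
  qed
qed

lemma flag_monoid_mono: "c' \<subseteq> c \<Longrightarrow> flag_monoid c \<subseteq> flag_monoid c'"
  by (auto simp: flag_monoid_def)

lemma flag_monoid_0: "0 \<in> flag_monoid c"
  by (simp add: flag_monoid_def zero_sum_def)

lemma flag_monoid_add: "m \<in> flag_monoid c \<Longrightarrow> m' \<in> flag_monoid c \<Longrightarrow> m + m' \<in> flag_monoid c"
  unfolding flag_monoid_def by (auto simp: part_sum_add intro: subspace_add[OF subspace_zero_sum])

lemma flag_monoid_sum: "(\<And>i. i \<in> I \<Longrightarrow> f i \<in> flag_monoid c) \<Longrightarrow> (\<Sum>i\<in>I. f i) \<in> flag_monoid c"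
  by (induction I rule: infinite_finite_induct) (auto simp: flag_monoid_0 flag_monoid_add)

section \<open>Dual vectors of a flag and localization at a face\<close>

lemma flag_new_element:
  assumes c: "c \<in> flags" and A: "A \<in> insert UNIV c"
  shows "\<exists>i\<in>A. \<forall>B\<in>c. B \<subset> A \<longrightarrow> i \<notin> B"
proof -
  \<comment> \<open>The members below \<open>A\<close> form a chain, so their union is one of them
    unless there are none; in both cases it misses a point of \<open>A\<close>.\<close>
  define S where "S = {B\<in>c. B \<subset> A}"
  have "\<Union>S \<subset> A"
  proof (cases "S = {}")
    case True
    then show ?thesis using flags_proper[OF c, of A] A by auto
  next
    case False
    have "\<Union>S \<in> S"
      using chain_Inter_Union[of S S] False flags_nested[OF c] by (auto simp: S_def)
    then show ?thesis by (simp add: S_def)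
  qed
  then obtain i where "i \<in> A" "i \<notin> \<Union>S" by blast
  then show ?thesis by (auto simp: S_def)
qed

text \<open>Smoothness of the fan: an integral vector dual to the rays of the cone. The root
  \<open>axis i 1 - axis j 1\<close> works if \<open>i\<close> lies in \<open>A\<close> but in no
  smaller member, and \<open>j\<close> lies in every larger member but not in
  \<open>A\<close>.\<close>

lemma flag_dual_root_exists:
  fixes c :: "'n::finite set set"
  assumes c: "c \<in> flags" and A: "A \<in> c"
  shows "\<exists>m\<in>zero_sum. (\<forall>i. m $ i \<in> \<int>) \<and> (\<forall>B\<in>c. part_sum m B = (if B = A then 1 else 0))"
proof -
  have chain: "B \<subseteq> B' \<or> B' \<subseteq> B" if "B \<in> c" "B' \<in> c" for B B' using flags_nested[OF c that] .
  have "\<exists>i\<in>A. \<forall>B\<in>c. B \<subset> A \<longrightarrow> i \<notin> B"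
    using A by (intro flag_new_element[OF c]) simp
  then obtain i where i: "i \<in> A" "\<And>B. B \<in> c \<Longrightarrow> B \<subset> A \<Longrightarrow> i \<notin> B" by blast
  have "\<exists>j. j \<notin> A \<and> (\<forall>B\<in>c. A \<subset> B \<longrightarrow> j \<in> B)"
  proof -
    define S where "S = {B\<in>c. A \<subset> B}"
    have "A \<subset> \<Inter>S"
    proof (cases "S = {}")
      case True
      then show ?thesis using flags_proper[OF c A] by auto
    next
      case False
      have "\<Inter>S \<in> S"
        using chain_Inter_Union[of S S] False chain by (auto simp: S_def)
      then show ?thesis by (simp add: S_def)
    qed
    then obtain j where "j \<notin> A" "j \<in> \<Inter>S" by blast
    then show ?thesis by (auto simp: S_def)
  qed
  then obtain j where j: "j \<notin> A" "\<And>B. B \<in> c \<Longrightarrow> A \<subset> B \<Longrightarrow> j \<in> B" by blast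
  have "part_sum (axis i 1 - axis j 1) B = (if B = A then 1 else 0)" if B: "B \<in> c" for B
  proof -
    consider "B = A" | "B \<subset> A" | "A \<subset> B" using chain[OF A B] by (auto simp: psubset_eq)
    then show ?thesis
    proof cases
      case 2
      then have "i \<notin> B" "j \<notin> B" using i(2)[OF B] j(1) by auto
      then show ?thesis using 2 by (auto simp: part_sum_axis_diff)
    next
      case 3
      then have "i \<in> B" "j \<in> B" using j(2)[OF B] i(1) by auto
      then show ?thesis using 3 by (auto simp: part_sum_axis_diff)
    qed (use i(1) j(1) in \<open>simp add: part_sum_axis_diff\<close>)
  qed
  moreover have "(axis i 1 - axis j 1 :: real ^ 'n) $ k \<in> \<int>" for k by (simp add: axis_def)
  ultimately show ?thesis using axis_diff_in_zero_sum by blast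
qed

text \<open>As a function on the chart of \<open>c\<close>, a coordinate whose zero set is the
  boundary divisor of the ray of \<open>A\<close>.\<close>

definition flag_root :: "'n::finite set set \<Rightarrow> 'n set \<Rightarrow> real ^ 'n" where
  "flag_root c A = (SOME m. m \<in> zero_sum \<and> (\<forall>i. m $ i \<in> \<int>) \<and> (\<forall>B\<in>c. part_sum m B = (if B = A then 1 else 0)))"

lemma flag_root:
  assumes "c \<in> flags" "A \<in> c"
  shows "flag_root c A \<in> zero_sum" "flag_root c A $ i \<in> \<int>"
    "B \<in> c \<Longrightarrow> part_sum (flag_root c A) B = (if B = A then 1 else 0)"
proof -
  have "\<exists>m. m \<in> zero_sum \<and> (\<forall>i. m $ i \<in> \<int>) \<and> (\<forall>B\<in>c. part_sum m B = (if B = A then 1 else 0))"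
    using flag_dual_root_exists[OF assms] by blast
  from someI_ex[OF this]
  show "flag_root c A \<in> zero_sum" "flag_root c A $ i \<in> \<int>"
    "B \<in> c \<Longrightarrow> part_sum (flag_root c A) B = (if B = A then 1 else 0)"
    unfolding flag_root_def by blast+
qed

lemma flag_root_in_monoid: "c \<in> flags \<Longrightarrow> A \<in> c \<Longrightarrow> flag_root c A \<in> flag_monoid c"
  unfolding flag_monoid_def using flag_root[of c A] by simp

text \<open>A linear form that vanishes on the rays of \<open>c\<close> in the face
  \<open>c'\<close> and equals 1 on the other rays. As a function on the chart it is the product of
  the coordinates that become invertible on the chart of the face.\<close>

definition flag_sep :: "'n::finite set set \<Rightarrow> 'n set set \<Rightarrow> real ^ 'n" where
  "flag_sep c c' = (\<Sum>A\<in>c - c'. flag_root c A)"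

lemma part_sum_flag_sep:
  assumes "c \<in> flags" "B \<in> c"
  shows "part_sum (flag_sep c c') B = (if B \<in> c' then 0 else 1)"
proof -
  have "part_sum (flag_sep c c') B = (\<Sum>A\<in>c - c'. if B = A then 1 else 0)"
    unfolding flag_sep_def part_sum_sum using assms by (intro sum.cong) (simp_all add: flag_root(3))
  also have "\<dots> = (if B \<in> c' then 0 else 1)" using assms by (simp add: sum.delta)
  finally show ?thesis .
qed

lemma localization_flag_monoid:
  fixes c :: "'n::finite set set"
  assumes c: "c \<in> flags" and c': "c' \<subseteq> c"
  shows "localization (flag_monoid c) (flag_monoid c') (flag_sep c c')"
proof
  show "flag_monoid c \<subseteq> flag_monoid c'" by (rule flag_monoid_mono[OF c'])
  show "0 \<in> flag_monoid c" by (rule flag_monoid_0)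
  show m0: "flag_sep c c' \<in> flag_monoid c"
    unfolding flag_sep_def by (intro flag_monoid_sum flag_root_in_monoid[OF c]) blast
  show "- flag_sep c c' \<in> flag_monoid c'"
    unfolding flag_monoid_def
  proof (intro CollectI conjI ballI allI)
    show "- flag_sep c c' \<in> zero_sum"
      using m0 by (intro subspace_neg subspace_zero_sum) (simp add: flag_monoid_def)
    show "(- flag_sep c c') $ i \<in> \<int>" for i using m0 by (simp add: flag_monoid_def)
    show "0 \<le> part_sum (- flag_sep c c') A" if "A \<in> c'" for A
      using part_sum_flag_sep[OF c subsetD[OF c' that], of c'] that by (simp add: part_sum_minus)
  qed
  show "\<exists>k::nat. m + real k *\<^sub>R flag_sep c c' \<in> flag_monoid c" if m: "m \<in> flag_monoid c'" for m
  proof -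
    have fin: "finite c" by (rule finite_subset[OF subset_UNIV]) simp
    \<comment> \<open>Large enough to compensate every negative partial sum; on the members of
      \<open>c'\<close> the separating element adds nothing, but there the sums are already
      nonnegative.\<close>
    define k where "k = nat \<lceil>\<Sum>A\<in>c. \<bar>part_sum m A\<bar>\<rceil>"
    have k: "- part_sum m A \<le> real k" if "A \<in> c" for A
    proof -
      have "- part_sum m A \<le> \<bar>part_sum m A\<bar>" by simp
      also have "\<dots> \<le> (\<Sum>A\<in>c. \<bar>part_sum m A\<bar>)" using that fin by (intro member_le_sum) auto
      also have "\<dots> \<le> real k" unfolding k_def by (rule real_nat_ceiling_ge)
      finally show ?thesis .
    qed
    have "m + real k *\<^sub>R flag_sep c c' \<in> flag_monoid c"
      unfolding flag_monoid_def
    proof (intro CollectI conjI ballI allI)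
      show "m + real k *\<^sub>R flag_sep c c' \<in> zero_sum"
        using m m0 by (intro subspace_add subspace_scale subspace_zero_sum) (simp_all add: flag_monoid_def)
      show "(m + real k *\<^sub>R flag_sep c c') $ i \<in> \<int>" for i
        using m m0 by (simp add: flag_monoid_def)
      show "0 \<le> part_sum (m + real k *\<^sub>R flag_sep c c') A" if A: "A \<in> c" for A
        using k[OF A] part_sum_flag_sep[OF c A, of c'] m
        by (auto simp: part_sum_add part_sum_scaleR flag_monoid_def split: if_splits)
    qed
    then show ?thesis ..
  qed
qed (auto intro: flag_monoid_add)

abbreviation flag_chart :: "'n::finite set set \<Rightarrow> (real ^ 'n \<Rightarrow> complex) topology" where
  "flag_chart c \<equiv> hom_space (flag_monoid c)"

lemma hom_space_flag_sum:
  assumes x: "x \<in> topspace (flag_chart c)" and f: "\<And>i. i \<in> I \<Longrightarrow> f i \<in> flag_monoid c"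
  shows "x (\<Sum>i\<in>I. f i) = (\<Prod>i\<in>I. x (f i))"
  using f
proof (induction I rule: infinite_finite_induct)
  case (insert i I)
  then show ?case by (simp add: hom_space_add[OF x] flag_monoid_sum)
qed (simp_all add: hom_space_0[OF x])

text \<open>Nonvanishing splits into one condition per inverted ray, so the conditions for two faces
  combine into the condition for their intersection.\<close>

lemma flag_sep_nonzero_iff:
  fixes c :: "'n::finite set set"
  assumes "c \<in> flags" "x \<in> topspace (flag_chart c)"
  shows "x (flag_sep c c') \<noteq> 0 \<longleftrightarrow> (\<forall>A\<in>c - c'. x (flag_root c A) \<noteq> 0)"
proof -
  have fin: "finite (c - c')" by (rule finite_subset[OF subset_UNIV]) simp
  have "x (flag_sep c c') = (\<Prod>A\<in>c - c'. x (flag_root c A))"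
    unfolding flag_sep_def
    by (rule hom_space_flag_sum[OF assms(2)]) (use flag_root_in_monoid[OF assms(1)] in blast)
  then show ?thesis using fin by simp
qed

section \<open>Gluing the charts\<close>

definition flag_gluing :: "(((real ^ 'n::finite) set \<times> (real ^ 'n \<Rightarrow> complex)) \<times> ((real ^ 'n) set \<times> (real ^ 'n \<Rightarrow> complex))) set" where
  "flag_gluing = toric_gluing (weight_lattice type_A_roots) (coxeter_fan type_A_roots)"

abbreviation flag_restrict :: "'n::finite set set \<Rightarrow> (real ^ 'n \<Rightarrow> complex) \<Rightarrow> (real ^ 'n \<Rightarrow> complex)" where
  "flag_restrict c z \<equiv> restrict z (flag_monoid c)"

lemma affine_toric_flag_cone:
  "c \<in> flags \<Longrightarrow> affine_toric (weight_lattice type_A_roots) (flag_cone c) = flag_chart c"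
  by (simp add: affine_toric_eq_hom_space dual_monoid_flag_cone)

lemma flags_Int: "c \<in> flags \<Longrightarrow> c \<inter> d \<in> flags"
  by (rule flags_in_subset) auto

lemma flag_gluing_iff:
  fixes c d :: "'n::finite set set"
  assumes c: "c \<in> flags" and d: "d \<in> flags"
  shows "((flag_cone c, x), (flag_cone d, y)) \<in> flag_gluing \<longleftrightarrow>
    (\<exists>z\<in>topspace (flag_chart (c \<inter> d)). x = flag_restrict c z \<and> y = flag_restrict d z)"
  using c d
  by (simp add: flag_gluing_def toric_gluing_def coxeter_fan_type_A flag_cone_Int affine_toric_flag_cone flags_Int dual_monoid_flag_cone)

lemma flag_gluingE:
  assumes "(P, Q) \<in> flag_gluing"
  obtains c d z :: "_" where "c \<in> flags" "d \<in> flags" "z \<in> topspace (flag_chart (c \<inter> d))"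
    "P = (flag_cone c, flag_restrict c z)" "Q = (flag_cone d, flag_restrict d z)"
proof -
  obtain \<sigma> x \<tau> y where PQ: "P = (\<sigma>, x)" "Q = (\<tau>, y)" by (metis surj_pair)
  then have "\<sigma> \<in> coxeter_fan type_A_roots" "\<tau> \<in> coxeter_fan type_A_roots"
    using assms by (auto simp: flag_gluing_def toric_gluing_def)
  then obtain c d where cd: "c \<in> flags" "d \<in> flags" "\<sigma> = flag_cone c" "\<tau> = flag_cone d"
    unfolding coxeter_fan_type_A by blast
  then show ?thesis
    using assms that unfolding PQ cd(3,4) flag_gluing_iff[OF cd(1,2)] by blast
qed

lemma flag_restrict_in:
  "c \<in> flags \<Longrightarrow> c' \<subseteq> c \<Longrightarrow> z \<in> topspace (flag_chart c') \<Longrightarrow> flag_restrict c z \<in> topspace (flag_chart c)"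
  by (rule localization.restrict_in[OF localization_flag_monoid])

lemma flag_restrict_inj:
  "c \<in> flags \<Longrightarrow> c' \<subseteq> c \<Longrightarrow> z \<in> topspace (flag_chart c') \<Longrightarrow> z' \<in> topspace (flag_chart c') \<Longrightarrow>
    flag_restrict c z = flag_restrict c z' \<Longrightarrow> z = z'"
  by (rule localization.restrict_inj[OF localization_flag_monoid])

lemma flag_restrict_restrict:
  "c' \<subseteq> c \<Longrightarrow> flag_restrict c (flag_restrict c' z) = flag_restrict c z"
  using flag_monoid_mono[of c' c] by (simp add: Int_absorb1)

lemma flag_restrict_same: "x \<in> topspace (flag_chart c) \<Longrightarrow> flag_restrict c x = x"
  by (rule extensional_restrict[OF hom_space_extensional])

lemma sym_flag_gluing: "sym flag_gluing"
proof (rule symI)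
  fix P Q :: "(real ^ 'n) set \<times> (real ^ 'n \<Rightarrow> complex)" assume "(P, Q) \<in> flag_gluing"
  then show "(Q, P) \<in> flag_gluing"
    by (elim flag_gluingE) (auto simp: flag_gluing_iff Int_commute)
qed

text \<open>
  If \<open>x\<close> extends to the charts of two faces of \<open>d\<close>, then it extends to the chart of their intersection:
  it does not vanish on the roots that have to be inverted.
\<close>

lemma trans_flag_gluing: "trans flag_gluing"
proof (rule transI)
  fix P Q R :: "(real ^ 'n) set \<times> (real ^ 'n \<Rightarrow> complex)"
  assume "(P, Q) \<in> flag_gluing" and QR: "(Q, R) \<in> flag_gluing"
  then obtain c d z where c: "c \<in> flags" and d: "d \<in> flags" and z: "z \<in> topspace (flag_chart (c \<inter> d))"
    and P: "P = (flag_cone c, flag_restrict c z)" and Q: "Q = (flag_cone d, flag_restrict d z)"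
    by (elim flag_gluingE)
  from QR obtain d' e w where d': "d' \<in> flags" and e: "e \<in> flags" and w: "w \<in> topspace (flag_chart (d' \<inter> e))"
    and Q': "Q = (flag_cone d', flag_restrict d' w)" and R: "R = (flag_cone e, flag_restrict e w)"
    by (elim flag_gluingE)
  have "d' = d" using Q Q' inj_onD[OF inj_on_flag_cone _ d' d] by simp
  with Q Q' w have w: "w \<in> topspace (flag_chart (d \<inter> e))" and zw: "flag_restrict d z = flag_restrict d w"
    by simp_all
  define y where "y = flag_restrict d z"
  have y: "y \<in> topspace (flag_chart d)" unfolding y_def by (rule flag_restrict_in[OF d _ z]) simp
  have nz: "v (flag_sep d b) \<noteq> 0 \<and> flag_restrict d v (flag_sep d b) \<noteq> 0"
    if "v \<in> topspace (flag_chart b)" "b \<subseteq> d" for v b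
    using localization.nonzero[OF localization_flag_monoid[OF d that(2)] that(1)]
      localization.m0[OF localization_flag_monoid[OF d that(2)]] by simp
  have "y (flag_sep d (c \<inter> d)) \<noteq> 0" using nz[OF z] by (simp add: y_def)
  then have 1: "\<forall>A\<in>d - (c \<inter> d). y (flag_root d A) \<noteq> 0" using flag_sep_nonzero_iff[OF d y] by simp
  have "y (flag_sep d (d \<inter> e)) \<noteq> 0" using nz[OF w] by (simp add: y_def zw)
  then have 2: "\<forall>A\<in>d - (d \<inter> e). y (flag_root d A) \<noteq> 0" using flag_sep_nonzero_iff[OF d y] by simp
  define f where "f = c \<inter> d \<inter> e"
  have "\<forall>A\<in>d - f. y (flag_root d A) \<noteq> 0" using 1 2 by (auto simp: f_def)
  then have y0: "y (flag_sep d f) \<noteq> 0" using flag_sep_nonzero_iff[OF d y] by simp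
  have fd: "f \<subseteq> d" by (auto simp: f_def)
  interpret L: localization "flag_monoid d" "flag_monoid f" "flag_sep d f"
    by (rule localization_flag_monoid[OF d fd])
  define z' where "z' = L.extend y"
  have z': "z' \<in> topspace (flag_chart f)" "flag_restrict d z' = y"
    unfolding z'_def using L.extend_in[OF y y0] L.restrict_extend[OF y y0] by simp_all
  \<comment> \<open>Restriction to the chart of \<open>d\<close> is injective, so the common
    extension \<open>z'\<close> induces the given point on each overlap.\<close>
  have *: "flag_restrict b z' = v"
    if b: "f \<subseteq> b" "b \<subseteq> d" and v: "v \<in> topspace (flag_chart b)" "flag_restrict d v = y" for b v
  proof (rule flag_restrict_inj[OF d b(2)])
    show "flag_restrict b z' \<in> topspace (flag_chart b)"
      using flags_in_subset[OF d b(2)] b(1) z'(1) by (rule flag_restrict_in)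
    show "flag_restrict d (flag_restrict b z') = flag_restrict d v"
      by (simp only: flag_restrict_restrict[OF b(2)] z'(2) v(2))
  qed (rule v(1))
  have fz: "flag_restrict (c \<inter> d) z' = z" by (rule *[OF _ _ z]) (auto simp: f_def y_def)
  have fw: "flag_restrict (d \<inter> e) z' = w" by (rule *[OF _ _ w]) (auto simp: f_def y_def zw)
  have "flag_restrict (c \<inter> e) z' \<in> topspace (flag_chart (c \<inter> e))"
    by (rule flag_restrict_in[OF flags_Int[OF c] _ z'(1)]) (auto simp: f_def)
  moreover have "flag_restrict c z = flag_restrict c (flag_restrict (c \<inter> e) z')"
  proof -
    have "flag_restrict c z = flag_restrict c (flag_restrict (c \<inter> d) z')" by (simp only: fz)
    also have "\<dots> = flag_restrict c z'" by (rule flag_restrict_restrict) simp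
    also have "\<dots> = flag_restrict c (flag_restrict (c \<inter> e) z')" by (rule flag_restrict_restrict[symmetric]) simp
    finally show ?thesis .
  qed
  moreover have "flag_restrict e w = flag_restrict e (flag_restrict (c \<inter> e) z')"
  proof -
    have "flag_restrict e w = flag_restrict e (flag_restrict (d \<inter> e) z')" by (simp only: fw)
    also have "\<dots> = flag_restrict e z'" by (rule flag_restrict_restrict) simp
    also have "\<dots> = flag_restrict e (flag_restrict (c \<inter> e) z')" by (rule flag_restrict_restrict[symmetric]) simp
    finally show ?thesis .
  qed
  ultimately show "(P, R) \<in> flag_gluing"
    unfolding P R flag_gluing_iff[OF c e] by blast
qed

lemma refl_flag_gluing:
  assumes "c \<in> flags" "x \<in> topspace (flag_chart c)"
  shows "((flag_cone c, x), (flag_cone c, x)) \<in> flag_gluing"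
  unfolding flag_gluing_iff[OF assms(1,1)] using assms(2) flag_restrict_same[OF assms(2)] by (intro bexI[of _ x]) simp_all

section \<open>The variety as a union of open charts\<close>

definition flag_variety :: "((real ^ 'n::finite) set \<times> (real ^ 'n \<Rightarrow> complex)) set topology" where
  "flag_variety = toric_variety (weight_lattice type_A_roots) (coxeter_fan type_A_roots)"

definition chart_point :: "'n::finite set set \<Rightarrow> (real ^ 'n \<Rightarrow> complex) \<Rightarrow> ((real ^ 'n) set \<times> (real ^ 'n \<Rightarrow> complex)) set" where
  "chart_point c x = flag_gluing `` {(flag_cone c, x)}"

lemma chart_point_eq_iff:
  assumes c: "c \<in> flags" and d: "d \<in> flags" and x: "x \<in> topspace (flag_chart c)" and y: "y \<in> topspace (flag_chart d)"
  shows "chart_point c x = chart_point d y \<longleftrightarrow>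
    (\<exists>z\<in>topspace (flag_chart (c \<inter> d)). x = flag_restrict c z \<and> y = flag_restrict d z)"
proof -
  have "chart_point c x = chart_point d y \<longleftrightarrow> ((flag_cone c, x), (flag_cone d, y)) \<in> flag_gluing"
  proof
    assume "chart_point c x = chart_point d y"
    moreover have "(flag_cone d, y) \<in> chart_point d y"
      using refl_flag_gluing[OF d y] by (simp add: chart_point_def)
    ultimately have "(flag_cone d, y) \<in> chart_point c x" by simp
    then show "((flag_cone c, x), (flag_cone d, y)) \<in> flag_gluing" by (simp add: chart_point_def)
  next
    assume g: "((flag_cone c, x), (flag_cone d, y)) \<in> flag_gluing"
    show "chart_point c x = chart_point d y"
      unfolding chart_point_def
    proof (intro subset_antisym subsetI)
      fix P assume "P \<in> flag_gluing `` {(flag_cone c, x)}"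
      then have "((flag_cone d, y), P) \<in> flag_gluing"
        using transD[OF trans_flag_gluing symD[OF sym_flag_gluing g]] by simp
      then show "P \<in> flag_gluing `` {(flag_cone d, y)}" by simp
    next
      fix P assume "P \<in> flag_gluing `` {(flag_cone d, y)}"
      then have "((flag_cone c, x), P) \<in> flag_gluing"
        using transD[OF trans_flag_gluing g] by simp
      then show "P \<in> flag_gluing `` {(flag_cone c, x)}" by simp
    qed
  qed
  then show ?thesis using flag_gluing_iff[OF c d] by simp
qed

lemma chart_point_restrict:
  assumes "c \<in> flags" "d \<subseteq> c" "z \<in> topspace (flag_chart d)"
  shows "chart_point c (flag_restrict c z) = chart_point d z"
proof -
  have d: "d \<in> flags" by (rule flags_in_subset[OF assms(1,2)])
  have cd: "c \<inter> d = d" using assms(2) by blast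
  show ?thesis
    unfolding chart_point_eq_iff[OF assms(1) d flag_restrict_in[OF assms] assms(3)] cd
    using assms(3) flag_restrict_same[OF assms(3)] by (intro bexI[of _ z]) simp_all
qed

lemma inj_on_chart_point:
  assumes c: "c \<in> flags"
  shows "inj_on (chart_point c) (topspace (flag_chart c))"
proof (rule inj_onI)
  fix x y assume xy: "x \<in> topspace (flag_chart c)" "y \<in> topspace (flag_chart c)" "chart_point c x = chart_point c y"
  then show "x = y" using chart_point_eq_iff[OF c c xy(1,2)] by auto
qed

lemma topspace_flag_sum:
  "topspace (sum_topology (affine_toric (weight_lattice type_A_roots)) (coxeter_fan type_A_roots)) =
    (\<Union>c\<in>flags. {flag_cone c} \<times> topspace (flag_chart c))"
proof -
  have "(\<Union>c\<in>flags. {flag_cone c} \<times> topspace (flag_chart c)) =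
      (\<Union>c\<in>flags. {flag_cone c} \<times> topspace (affine_toric (weight_lattice type_A_roots) (flag_cone c)))"
    by (intro SUP_cong refl) (simp add: affine_toric_flag_cone)
  also have "\<dots> = Sigma (flag_cone ` flags) (topspace \<circ> affine_toric (weight_lattice type_A_roots))"
    by auto
  finally show ?thesis unfolding topspace_sum_topology coxeter_fan_type_A ..
qed

lemma topspace_flag_variety:
  "topspace flag_variety = (\<Union>c\<in>flags. chart_point c ` topspace (flag_chart c))"
proof -
  have "topspace flag_variety = (\<Union>c\<in>flags. {flag_cone c} \<times> topspace (flag_chart c)) // flag_gluing"
    unfolding flag_variety_def toric_variety_def topspace_quotient_topology topspace_flag_sum flag_gluing_def ..
  also have "\<dots> = (\<lambda>p. flag_gluing `` {p}) ` (\<Union>c\<in>flags. {flag_cone c} \<times> topspace (flag_chart c))"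
    unfolding quotient_def by (rule UNION_singleton_eq_range)
  also have "\<dots> = (\<Union>c\<in>flags. (\<lambda>p. flag_gluing `` {p}) ` Pair (flag_cone c) ` topspace (flag_chart c))"
    unfolding image_UN by (intro SUP_cong refl arg_cong[of _ _ "image _"]) auto
  also have "\<dots> = (\<Union>c\<in>flags. chart_point c ` topspace (flag_chart c))"
    unfolding image_image chart_point_def ..
  finally show ?thesis .
qed

lemma openin_flag_variety:
  fixes U :: "((real ^ 'n::finite) set \<times> (real ^ 'n \<Rightarrow> complex)) set set"
  shows "openin flag_variety U \<longleftrightarrow> U \<subseteq> topspace flag_variety \<and>
    (\<forall>c\<in>flags. openin (flag_chart c) {x \<in> topspace (flag_chart c). chart_point c x \<in> U})"
proof -
  let ?S = "sum_topology (affine_toric (weight_lattice (type_A_roots :: (real ^ 'n) set))) (coxeter_fan type_A_roots)"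
  have img: "(\<forall>\<sigma>\<in>coxeter_fan type_A_roots. Q \<sigma>) \<longleftrightarrow> (\<forall>c\<in>flags. Q (flag_cone c))" for Q :: "(real ^ 'n) set \<Rightarrow> bool"
    unfolding coxeter_fan_type_A by blast
  have "openin flag_variety U \<longleftrightarrow> U \<subseteq> topspace flag_variety \<and>
      openin ?S {p \<in> topspace ?S. flag_gluing `` {p} \<in> U}"
    unfolding flag_variety_def toric_variety_def openin_quotient_topology topspace_quotient_topology
      flag_gluing_def ..
  also have "openin ?S {p \<in> topspace ?S. flag_gluing `` {p} \<in> U} \<longleftrightarrow>
      (\<forall>\<sigma>\<in>coxeter_fan type_A_roots. openin (affine_toric (weight_lattice type_A_roots) \<sigma>)
        {x. (\<sigma>, x) \<in> {p \<in> topspace ?S. flag_gluing `` {p} \<in> U}})"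
    unfolding openin_sum_topology topspace_sum_topology by simp
  also have "\<dots> \<longleftrightarrow> (\<forall>c\<in>flags. openin (flag_chart c) {x \<in> topspace (flag_chart c). chart_point c x \<in> U})"
    unfolding img
  proof (rule ball_cong[OF refl])
    fix c :: "'n set set" assume c: "c \<in> flags"
    have "{x. (flag_cone c, x) \<in> {p \<in> topspace ?S. flag_gluing `` {p} \<in> U}} =
        {x \<in> topspace (flag_chart c). chart_point c x \<in> U}"
      using c by (auto simp: coxeter_fan_type_A affine_toric_flag_cone chart_point_def)
    then show "openin (affine_toric (weight_lattice type_A_roots) (flag_cone c))
        {x. (flag_cone c, x) \<in> {p \<in> topspace ?S. flag_gluing `` {p} \<in> U}} \<longleftrightarrow>
        openin (flag_chart c) {x \<in> topspace (flag_chart c). chart_point c x \<in> U}"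
      using c by (simp add: affine_toric_flag_cone)
  qed
  finally show ?thesis .
qed

lemma continuous_map_chart_point:
  fixes c :: "'n::finite set set"
  assumes c: "c \<in> flags"
  shows "continuous_map (flag_chart c) flag_variety (chart_point c)"
  unfolding continuous_map_def
proof (intro conjI allI impI)
  show "chart_point c \<in> topspace (flag_chart c) \<rightarrow> topspace flag_variety"
    unfolding topspace_flag_variety using c by blast
  show "openin (flag_chart c) {x \<in> topspace (flag_chart c). chart_point c x \<in> U}"
    if "openin flag_variety U" for U
    using that c unfolding openin_flag_variety by blast
qed

text \<open>Seen in the chart of \<open>d\<close>, the image of \<open>W\<close> comes from the
  overlap: it is the preimage of \<open>W\<close> in the chart of \<open>c \<inter> d\<close>,
  pushed into the chart of \<open>d\<close> by restriction, which is open because it is a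
  localization.\<close>

lemma open_map_chart_point:
  fixes c :: "'n::finite set set"
  assumes c: "c \<in> flags"
  shows "open_map (flag_chart c) flag_variety (chart_point c)"
  unfolding open_map_def
proof (intro allI impI)
  fix W assume W: "openin (flag_chart c) W"
  have Wt: "W \<subseteq> topspace (flag_chart c)" by (rule openin_subset[OF W])
  show "openin flag_variety (chart_point c ` W)"
    unfolding openin_flag_variety
  proof (intro conjI ballI)
    show "chart_point c ` W \<subseteq> topspace flag_variety"
      unfolding topspace_flag_variety using Wt c by blast
    fix d :: "'n set set" assume d: "d \<in> flags"
    have Lc: "localization (flag_monoid c) (flag_monoid (c \<inter> d)) (flag_sep c (c \<inter> d))"
      by (rule localization_flag_monoid[OF c]) simp
    have Ld: "localization (flag_monoid d) (flag_monoid (c \<inter> d)) (flag_sep d (c \<inter> d))"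
      by (rule localization_flag_monoid[OF d]) simp
    let ?V = "{z \<in> topspace (flag_chart (c \<inter> d)). flag_restrict c z \<in> W}"
    have "openin (flag_chart (c \<inter> d)) ?V"
      by (rule openin_continuous_map_preimage[OF localization.continuous_map_restrict[OF Lc] W])
    then have "openin (flag_chart d) (flag_restrict d ` ?V)"
      by (rule localization.openin_restrict_image[OF Ld])
    also have "flag_restrict d ` ?V = {y \<in> topspace (flag_chart d). chart_point d y \<in> chart_point c ` W}"
    proof (intro subset_antisym subsetI)
      fix y assume "y \<in> flag_restrict d ` ?V"
      then obtain z where z: "z \<in> topspace (flag_chart (c \<inter> d))" "flag_restrict c z \<in> W" "y = flag_restrict d z"
        by blast
      have "chart_point d y = chart_point (c \<inter> d) z"
        unfolding z(3) by (rule chart_point_restrict[OF d _ z(1)]) simp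
      also have "\<dots> = chart_point c (flag_restrict c z)"
        by (rule chart_point_restrict[OF c _ z(1), symmetric]) simp
      finally have "chart_point d y \<in> chart_point c ` W" using z(2) by blast
      moreover have "y \<in> topspace (flag_chart d)"
        unfolding z(3) by (rule flag_restrict_in[OF d _ z(1)]) simp
      ultimately show "y \<in> {y \<in> topspace (flag_chart d). chart_point d y \<in> chart_point c ` W}" by simp
    next
      fix y assume "y \<in> {y \<in> topspace (flag_chart d). chart_point d y \<in> chart_point c ` W}"
      then obtain x where y: "y \<in> topspace (flag_chart d)" and x: "x \<in> W" "chart_point c x = chart_point d y"
        by (metis (mono_tags, lifting) imageE mem_Collect_eq)
      obtain z where "z \<in> topspace (flag_chart (c \<inter> d))" "x = flag_restrict c z" "y = flag_restrict d z"
        using chart_point_eq_iff[OF c d subsetD[OF Wt x(1)] y] x(2) by blast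
      then show "y \<in> flag_restrict d ` ?V" using x(1) by blast
    qed
    finally show "openin (flag_chart d) {y \<in> topspace (flag_chart d). chart_point d y \<in> chart_point c ` W}" .
  qed
qed

text \<open>Conjugation respects the gluing, which gives one inclusion for every point. The same
  inclusion for the conjugate point gives the other, since conjugating twice is the identity on
  representatives.\<close>

lemma toric_conj_chart_point:
  fixes c :: "'n::finite set set"
  assumes c: "c \<in> flags" and x: "x \<in> topspace (flag_chart c)"
  shows "toric_conj (weight_lattice type_A_roots) (chart_point c x) = chart_point c (flag_restrict c (cnj \<circ> x))"
proof -
  let ?cj = "\<lambda>(\<sigma>, x). (\<sigma>, restrict (cnj \<circ> x) (dual_monoid (weight_lattice type_A_roots) \<sigma>))"
  have cnj_in: "flag_restrict c (cnj \<circ> x) \<in> topspace (flag_chart c)" if "x \<in> topspace (flag_chart c)" for c :: "'n set set" and x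
    using that by (auto simp: in_hom_space_iff flag_monoid_0 flag_monoid_add)
  have sub: "?cj ` chart_point c x \<subseteq> chart_point c (flag_restrict c (cnj \<circ> x))"
    if x: "x \<in> topspace (flag_chart c)" for x
  proof (rule image_subsetI)
    fix P assume "P \<in> chart_point c x"
    then have "((flag_cone c, x), P) \<in> flag_gluing" by (simp add: chart_point_def)
    then obtain c' d z where cd: "c' \<in> flags" "d \<in> flags" and z: "z \<in> topspace (flag_chart (c' \<inter> d))"
      and eq: "(flag_cone c, x) = (flag_cone c', flag_restrict c' z)" and P: "P = (flag_cone d, flag_restrict d z)"
      by (elim flag_gluingE)
    have c': "c' = c" using eq inj_onD[OF inj_on_flag_cone _ cd(1) c] by simp
    have z: "z \<in> topspace (flag_chart (c \<inter> d))" using z c' by simp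
    have x': "x = flag_restrict c z" using eq c' by simp
    have cjP: "?cj P = (flag_cone d, flag_restrict d (cnj \<circ> flag_restrict d z))"
      unfolding P by (simp add: dual_monoid_flag_cone[OF cd(2)])
    have rr: "flag_restrict b (cnj \<circ> flag_restrict b z) = flag_restrict b (flag_restrict (c \<inter> d) (cnj \<circ> z))"
      if "c \<inter> d \<subseteq> b" for b
      using flag_monoid_mono[OF that] by (auto simp: fun_eq_iff)
    have "((flag_cone c, flag_restrict c (cnj \<circ> x)), ?cj P) \<in> flag_gluing"
      unfolding cjP flag_gluing_iff[OF c cd(2)] x'
      by (intro bexI[of _ "flag_restrict (c \<inter> d) (cnj \<circ> z)"] conjI rr cnj_in z) simp_all
    then show "?cj P \<in> chart_point c (flag_restrict c (cnj \<circ> x))" by (simp add: chart_point_def)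
  qed
  have idem: "flag_restrict c (cnj \<circ> flag_restrict c (cnj \<circ> x)) = x"
    using hom_space_extensional[OF x] by (auto simp: fun_eq_iff extensional_def)
  have "chart_point c (flag_restrict c (cnj \<circ> x)) \<subseteq> ?cj ` chart_point c x"
  proof
    fix P assume P: "P \<in> chart_point c (flag_restrict c (cnj \<circ> x))"
    then have "?cj P \<in> chart_point c x" using sub[OF cnj_in[OF x]] idem by auto
    then have "?cj (?cj P) \<in> ?cj ` chart_point c x" by (rule imageI)
    moreover have "?cj (?cj P) = P"
    proof -
      obtain d z where "d \<in> flags" "P = (flag_cone d, flag_restrict d z)"
        using P unfolding chart_point_def by (auto elim: flag_gluingE)
      then show ?thesis by (auto simp: dual_monoid_flag_cone fun_eq_iff)
    qed
    ultimately show "P \<in> ?cj ` chart_point c x" by (simp only:)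
  qed
  with sub[OF x] have "?cj ` chart_point c x = chart_point c (flag_restrict c (cnj \<circ> x))"
    by (rule subset_antisym)
  then show ?thesis unfolding toric_conj_def .
qed

section \<open>Contractible pieces of the real charts\<close>

lemma continuous_map_compose_Pair:
  fixes f :: "'z \<Rightarrow> 'b::topological_space" and g :: "'z \<Rightarrow> 'c::topological_space"
  assumes "continuous_map Z euclidean f" "continuous_map Z euclidean g"
    and D: "\<And>z. z \<in> topspace Z \<Longrightarrow> (f z, g z) \<in> D" and h: "continuous_on D h"
  shows "continuous_map Z euclidean (\<lambda>z. h (f z, g z))"
proof -
  have "continuous_map Z (top_of_set D) (\<lambda>z. (f z, g z))"
    unfolding continuous_map_in_subtopology using continuous_map_euclidean_Pair[OF assms(1,2)] D by blast
  moreover have "continuous_map (top_of_set D) euclidean h"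
    using h by simp
  ultimately have "continuous_map Z euclidean (h \<circ> (\<lambda>z. (f z, g z)))"
    by (rule continuous_map_compose)
  then show ?thesis by (simp add: o_def)
qed

section \<open>Blocks of a flag and the units of its monoid\<close>

definition block_sets :: "'n::finite set set \<Rightarrow> 'n \<Rightarrow> 'n set set" where
  "block_sets c i = {A\<in>c. i \<in> A}"

definition block_rep :: "'n::finite set set \<Rightarrow> 'n \<Rightarrow> 'n" where
  "block_rep c i = (SOME j. block_sets c j = block_sets c i)"

text \<open>One index for each coordinate of the torus of units: every block contributes all of its
  elements but one. Subsets of this set therefore enumerate the sign patterns.\<close>

definition non_reps :: "'n::finite set set \<Rightarrow> 'n set" where
  "non_reps c = {i. block_rep c i \<noteq> i}"

lemma block_sets_rep: "block_sets c (block_rep c i) = block_sets c i"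
  unfolding block_rep_def by (rule someI[of _ i]) simp

lemma block_rep_eq: "block_sets c i = block_sets c j \<Longrightarrow> block_rep c i = block_rep c j"
  by (simp add: block_rep_def)

lemma block_rep_idem: "block_rep c (block_rep c i) = block_rep c i"
  by (rule block_rep_eq[OF block_sets_rep])

lemma block_rep_notin: "block_rep c i \<notin> non_reps c"
  by (simp add: non_reps_def block_rep_idem)

text \<open>Each block consists of the points that are new in some \<open>A\<close> of
  \<open>insert UNIV c\<close>, and the members through such a point are those that contain
  \<open>A\<close>. The extra set \<open>UNIV\<close> stands for the indices in no member and
  accounts for the \<open>Suc\<close>.\<close>

lemma card_range_block_sets:
  fixes c :: "'n::finite set set"
  assumes c: "c \<in> flags"
  shows "card (range (block_sets c)) = Suc (card c)"
proof -
  have fin: "finite c" by (rule finite_subset[OF subset_UNIV]) simp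
  define h where "h A = {B\<in>c. A \<subseteq> B}" for A
  have notUNIV: "UNIV \<notin> c" using flags_proper[OF c] by blast
  have hUNIV: "h UNIV = {}" using notUNIV by (auto simp: h_def top.extremum_unique)
  have inj: "inj_on h (insert UNIV c)"
  proof (rule inj_onI)
    fix A B assume AB: "A \<in> insert UNIV c" "B \<in> insert UNIV c" "h A = h B"
    have self: "C \<in> h C" if "C \<in> c" for C using that by (simp add: h_def)
    show "A = B"
    proof (cases "A = UNIV \<or> B = UNIV")
      case True
      then show ?thesis using AB self hUNIV by (metis empty_iff insertE)
    next
      case False
      then have "A \<in> h B" "B \<in> h A" using AB self by auto
      then show ?thesis by (auto simp: h_def)
    qed
  qed
  have "range (block_sets c) = h ` insert UNIV c"
  proof (intro subset_antisym subsetI)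
    fix G assume "G \<in> range (block_sets c)"
    then obtain i where i: "G = block_sets c i" by blast
    show "G \<in> h ` insert UNIV c"
    proof (cases "G = {}")
      case True
      then show ?thesis using hUNIV by blast
    next
      case False
      have "\<Inter>G \<in> c"
        using chain_Inter_Union[of G c] False flags_nested[OF c] finite_subset[OF _ fin, of G]
        by (auto simp: i block_sets_def)
      moreover have "h (\<Inter>G) = G"
        using \<open>\<Inter>G \<in> c\<close> by (auto simp: h_def i block_sets_def)
      ultimately show ?thesis by (metis image_eqI insertI2)
    qed
  next
    fix G assume "G \<in> h ` insert UNIV c"
    then obtain A where A: "A \<in> insert UNIV c" "G = h A" by blast
    obtain i where i: "i \<in> A" "\<forall>B\<in>c. B \<subset> A \<longrightarrow> i \<notin> B"
      using flag_new_element[OF c A(1)] by blast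
    have "A \<subseteq> B" if B: "B \<in> c" "i \<in> B" for B
    proof -
      have "A \<subseteq> B \<or> B \<subseteq> A" using A(1) flags_nested[OF c B(1)] by auto
      then show ?thesis using i(2) B by (auto simp: psubset_eq)
    qed
    then have "block_sets c i = h A" using i(1) by (auto simp: block_sets_def h_def)
    then show "G \<in> range (block_sets c)" using A(2) by blast
  qed
  then show ?thesis using inj notUNIV fin by (simp add: card_image)
qed

lemma card_non_reps:
  fixes c :: "'n::finite set set"
  assumes c: "c \<in> flags"
  shows "card (non_reps c) = CARD('n) - 1 - card c"
proof -
  have "range (block_rep c) = - non_reps c"
  proof (intro subset_antisym subsetI)
    fix i assume "i \<in> - non_reps c"
    then have "block_rep c i = i" by (simp add: non_reps_def)
    then show "i \<in> range (block_rep c)" by (metis rangeI)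
  qed (use block_rep_notin in auto)
  moreover have "card (range (block_rep c)) = card (range (block_sets c))"
  proof -
    have "inj_on (block_sets c) (range (block_rep c))"
    proof (rule inj_onI)
      fix a b assume "a \<in> range (block_rep c)" "b \<in> range (block_rep c)" "block_sets c a = block_sets c b"
      then show "a = b" using block_rep_eq[of c a b] by (auto simp: block_rep_idem)
    qed
    moreover have "block_sets c ` range (block_rep c) = range (block_sets c)"
      by (simp add: image_image block_sets_rep)
    ultimately show ?thesis by (metis card_image)
  qed
  ultimately have "card (- non_reps c) = Suc (card c)" using card_range_block_sets[OF c] by simp
  moreover have "CARD('n) = card (non_reps c) + card (- non_reps c)"
    using card_Un_disjoint[of "non_reps c" "- non_reps c"] by simp
  ultimately show ?thesis by simp
qed

text \<open>The invertible elements of the monoid, that is, the characters which are trivial on the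
  span of the cone.\<close>

definition flag_units :: "'n::finite set set \<Rightarrow> (real ^ 'n) set" where
  "flag_units c = {m \<in> flag_monoid c. \<forall>A\<in>c. part_sum m A = 0}"

abbreviation rep_root :: "'n::finite set set \<Rightarrow> 'n \<Rightarrow> real ^ 'n" where
  "rep_root c i \<equiv> axis i 1 - axis (block_rep c i) 1"

lemma flag_units_sub: "m \<in> flag_units c \<Longrightarrow> m \<in> flag_monoid c"
  by (simp add: flag_units_def)

lemma flag_units_0: "0 \<in> flag_units c"
  by (simp add: flag_units_def flag_monoid_0)

lemma flag_units_add: "m \<in> flag_units c \<Longrightarrow> m' \<in> flag_units c \<Longrightarrow> m + m' \<in> flag_units c"
  by (simp add: flag_units_def flag_monoid_add part_sum_add)

lemma flag_units_minus:
  assumes "m \<in> flag_units c"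
  shows "- m \<in> flag_units c"
proof -
  have "- m \<in> zero_sum"
    using assms by (intro subspace_neg[OF subspace_zero_sum]) (simp add: flag_units_def flag_monoid_def)
  then show ?thesis using assms by (simp add: flag_units_def flag_monoid_def part_sum_minus)
qed

lemma flag_units_add_iff:
  assumes m: "m \<in> flag_monoid c" and m': "m' \<in> flag_monoid c"
  shows "m + m' \<in> flag_units c \<longleftrightarrow> m \<in> flag_units c \<and> m' \<in> flag_units c"
proof
  assume sum: "m + m' \<in> flag_units c"
  have "part_sum m A = 0 \<and> part_sum m' A = 0" if "A \<in> c" for A
  proof -
    have "0 \<le> part_sum m A" "0 \<le> part_sum m' A" using m m' that by (simp_all add: flag_monoid_def)
    moreover have "part_sum m A + part_sum m' A = 0" using sum that by (simp add: flag_units_def part_sum_add)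
    ultimately show ?thesis by linarith
  qed
  then show "m \<in> flag_units c \<and> m' \<in> flag_units c" using m m' by (simp add: flag_units_def)
qed (simp add: flag_units_add)

lemma rep_root_in_units: "rep_root c i \<in> flag_units c"
proof -
  have "block_rep c i \<in> A \<longleftrightarrow> i \<in> A" if "A \<in> c" for A
    using block_sets_rep[of c i] that by (auto simp: block_sets_def)
  moreover have "rep_root c i $ k \<in> \<int>" for k by (simp add: axis_def)
  ultimately show ?thesis
    by (simp add: flag_units_def flag_monoid_def axis_diff_in_zero_sum part_sum_axis_diff)
qed

text \<open>The coordinates of a unit sum to \<open>0\<close> on every block.\<close>

lemma flag_units_expansion:
  fixes c :: "'n::finite set set"
  assumes c: "c \<in> flags" and m: "m \<in> flag_units c"
  shows "m = (\<Sum>i\<in>UNIV. (m $ i) *\<^sub>R rep_root c i)"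
proof -
  have fin: "finite c" by (rule finite_subset[OF subset_UNIV]) simp
  have m0: "part_sum m A = 0" if "A \<in> c \<or> A = {} \<or> A = UNIV" for A
    using that m by (auto simp: flag_units_def flag_monoid_def zero_sum_def part_sum_def)
  have "(\<Sum>i\<in>UNIV. (m $ i) *\<^sub>R axis (block_rep c i) (1::real)) = 0"
  proof (rule vec_eq_iff[THEN iffD2], rule allI)
    fix k
    have "(\<Sum>i\<in>UNIV. (m $ i) *\<^sub>R axis (block_rep c i) (1::real)) $ k = (\<Sum>i\<in>UNIV. if block_rep c i = k then m $ i else 0)"
      by (simp add: axis_def) (intro sum.cong refl, simp)
    also have "\<dots> = part_sum m {i. block_rep c i = k}"
      by (simp add: part_sum_def sum.If_cases)
    also have "\<dots> = 0"
    proof (cases "{i. block_rep c i = k} = {}")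
      case False
      define G where "G = block_sets c k"
      have k: "block_rep c k = k" using False block_rep_idem by auto
      have "block_rep c i = k \<longleftrightarrow> block_sets c i = G" for i
        using block_sets_rep[of c i] block_rep_eq[of c i k] k by (auto simp: G_def)
      \<comment> \<open>A block is the part of the smallest member around it that lies outside all
        members not containing it. Empty \<open>G\<close> gives \<open>UNIV\<close> for the
        intersection, and \<open>G = c\<close> gives the empty union, in the outermost and the
        innermost block.\<close>
      then have "{i. block_rep c i = k} = \<Inter>G - \<Union>(c - G)"
        by (auto simp: G_def block_sets_def)
      moreover have "\<Union>(c - G) \<subseteq> \<Inter>G"
      proof (intro Union_least Inter_greatest)
        fix B C assume "B \<in> c - G" "C \<in> G"
        then show "B \<subseteq> C" using flags_nested[OF c, of B C] by (auto simp: G_def block_sets_def)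
      qed
      ultimately have diff: "part_sum m {i. block_rep c i = k} = part_sum m (\<Inter>G) - part_sum m (\<Union>(c - G))"
        unfolding part_sum_def by (simp add: sum_diff)
      have "\<Inter>G \<in> c \<or> \<Inter>G = UNIV"
        using chain_Inter_Union[of G c] flags_nested[OF c] finite_subset[OF _ fin, of G]
        by (cases "G = {}") (auto simp: G_def block_sets_def)
      then have 1: "part_sum m (\<Inter>G) = 0" by (intro m0) blast
      have "\<Union>(c - G) \<in> c \<or> \<Union>(c - G) = {}"
        using chain_Inter_Union[of "c - G" c] flags_nested[OF c] fin
        by (cases "c - G = {}") auto
      then have "part_sum m (\<Union>(c - G)) = 0" by (intro m0) blast
      then show ?thesis unfolding diff 1 by simp
    next
      case True
      have "part_sum m {} = 0" by (rule m0) simp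
      then show ?thesis by (rule subst[OF sym[OF True]])
    qed
    finally show "(\<Sum>i\<in>UNIV. (m $ i) *\<^sub>R axis (block_rep c i) (1::real)) $ k = 0 $ k"
      unfolding zero_index .
  qed
  moreover have "(\<Sum>i\<in>UNIV. (m $ i) *\<^sub>R rep_root c i) =
      (\<Sum>i\<in>UNIV. (m $ i) *\<^sub>R axis i 1) - (\<Sum>i\<in>UNIV. (m $ i) *\<^sub>R axis (block_rep c i) (1::real))"
    by (simp add: scaleR_diff_right sum_subtractf)
  moreover have "(\<Sum>i\<in>UNIV. (m $ i) *\<^sub>R axis i 1) = m"
    using basis_expansion[of m] by (simp add: scalar_mult_eq_scaleR)
  ultimately have "(\<Sum>i\<in>UNIV. (m $ i) *\<^sub>R rep_root c i) = m - 0" by (simp only:)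
  then show ?thesis by simp
qed

text \<open>The sign character of the torus that is \<open>-1\<close> exactly on the coordinates in \<open>P\<close>.\<close>

definition sign_char :: "'n::finite set \<Rightarrow> real ^ 'n \<Rightarrow> real" where
  "sign_char P m = (if even \<lfloor>part_sum m P\<rfloor> then 1 else -1)"

lemma sign_char_add:
  assumes "m \<in> flag_monoid c" "m' \<in> flag_monoid c"
  shows "sign_char P (m + m') = sign_char P m * sign_char P m'"
proof -
  have "part_sum m P \<in> \<int>" "part_sum m' P \<in> \<int>"
    using assms by (auto simp: flag_monoid_def intro!: part_sum_Ints)
  then obtain a b where "part_sum m P = of_int a" "part_sum m' P = of_int b" by (metis Ints_cases)
  then show ?thesis by (simp add: sign_char_def part_sum_add flip: of_int_add)
qed

lemma sign_char_0: "sign_char P 0 = 1"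
  by (simp add: sign_char_def)

lemma sign_char_cases: "sign_char P m = 1 \<or> sign_char P m = -1"
  by (simp add: sign_char_def)

lemma sign_char_rep_root:
  assumes "P \<subseteq> non_reps c"
  shows "sign_char P (rep_root c i) = (if i \<in> P then -1 else 1)"
proof -
  have "block_rep c i \<notin> P" using assms block_rep_notin by blast
  then show ?thesis by (simp add: sign_char_def part_sum_axis_diff)
qed

section \<open>Sign patterns on the real charts\<close>

definition real_chart :: "'n::finite set set \<Rightarrow> (real ^ 'n \<Rightarrow> complex) set" where
  "real_chart c = {x \<in> topspace (flag_chart c). \<forall>m\<in>flag_monoid c. x m \<in> \<real>}"

text \<open>Only units are constrained, since their values cannot vanish. The other coordinates may
  pass through zero, which joins the corresponding orthants into one piece.\<close>

definition chart_piece :: "'n::finite set set \<Rightarrow> 'n set \<Rightarrow> (real ^ 'n \<Rightarrow> complex) set" where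
  "chart_piece c P = {x \<in> real_chart c. \<forall>m\<in>flag_units c. 0 < Re (x m) * sign_char P m}"

lemma real_chart_Re: "x \<in> real_chart c \<Longrightarrow> m \<in> flag_monoid c \<Longrightarrow> x m = of_real (Re (x m))"
  by (simp add: real_chart_def complex_is_Real_iff complex_eq_iff)

lemma real_chart_Re_add:
  assumes "x \<in> real_chart c" "m \<in> flag_monoid c" "m' \<in> flag_monoid c"
  shows "Re (x (m + m')) = Re (x m) * Re (x m')"
proof -
  have "x (m + m') = of_real (Re (x m)) * of_real (Re (x m'))"
    using assms real_chart_Re[OF assms(1)] hom_space_add[of x "flag_monoid c" m m'] by (simp add: real_chart_def)
  then show ?thesis by simp
qed

text \<open>The units at which \<open>x\<close> has the prescribed sign form a group, so it is
  enough to test the generators \<open>rep_root c i\<close>. This leaves finitely many conditions,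
  which makes the pieces open.\<close>

lemma chart_piece_iff:
  fixes c :: "'n::finite set set"
  assumes c: "c \<in> flags" and P: "P \<subseteq> non_reps c" and x: "x \<in> real_chart c"
  shows "x \<in> chart_piece c P \<longleftrightarrow> (\<forall>i. 0 < Re (x (rep_root c i)) * (if i \<in> P then -1 else 1))"
proof
  assume "x \<in> chart_piece c P"
  then have "0 < Re (x (rep_root c i)) * sign_char P (rep_root c i)" for i
    using rep_root_in_units[of i c] by (simp add: chart_piece_def)
  then show "\<forall>i. 0 < Re (x (rep_root c i)) * (if i \<in> P then -1 else 1)"
    unfolding sign_char_rep_root[OF P] by blast
next
  assume *: "\<forall>i. 0 < Re (x (rep_root c i)) * (if i \<in> P then -1 else 1)"
  have x0: "Re (x 0) = 1" using x hom_space_0[of x "flag_monoid c"] by (simp add: real_chart_def)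
  define Z where "Z = {m \<in> flag_units c. 0 < Re (x m) * sign_char P m}"
  have Z0: "0 \<in> Z" by (simp add: Z_def flag_units_0 x0 sign_char_0)
  have Zadd: "m + m' \<in> Z" if m: "m \<in> Z" and m': "m' \<in> Z" for m m'
  proof -
    have u: "m \<in> flag_monoid c" "m' \<in> flag_monoid c" using m m' by (simp_all add: Z_def flag_units_sub)
    have "Re (x (m + m')) * sign_char P (m + m') = (Re (x m) * sign_char P m) * (Re (x m') * sign_char P m')"
      using real_chart_Re_add[OF x u] sign_char_add[OF u] by simp
    then show ?thesis using m m' by (simp add: Z_def flag_units_add)
  qed
  have Zminus: "- m \<in> Z" if m: "m \<in> Z" for m
  proof -
    have u: "m \<in> flag_monoid c" "- m \<in> flag_monoid c" "- m \<in> flag_units c"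
      using m by (simp_all add: Z_def flag_units_sub flag_units_minus)
    have "(Re (x m) * sign_char P m) * (Re (x (- m)) * sign_char P (- m)) = Re (x (m + - m)) * sign_char P (m + - m)"
      unfolding real_chart_Re_add[OF x u(1,2)] sign_char_add[OF u(1,2)] by simp
    also have "\<dots> = 1" by (simp add: x0 sign_char_0)
    finally have "0 < (Re (x m) * sign_char P m) * (Re (x (- m)) * sign_char P (- m))" by simp
    then have "0 < Re (x (- m)) * sign_char P (- m)"
      by (rule zero_less_mult_pos) (use m in \<open>simp add: Z_def\<close>)
    then show ?thesis using u(3) by (simp add: Z_def)
  qed
  have Znat: "real k *\<^sub>R m \<in> Z" if "m \<in> Z" for k m
    by (induction k) (simp_all add: Z0 Zadd that scaleR_left_distrib)
  have Zint: "r *\<^sub>R m \<in> Z" if r: "r \<in> \<int>" and m: "m \<in> Z" for r m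
  proof -
    obtain k where k: "r = of_int k" using r by (elim Ints_cases)
    show ?thesis
    proof (cases "k \<ge> 0")
      case True
      then show ?thesis using Znat[OF m, of "nat k"] k by simp
    next
      case False
      then have "- (real (nat (- k)) *\<^sub>R m) = r *\<^sub>R m" using k by simp
      then show ?thesis using Zminus[OF Znat[OF m, of "nat (- k)"]] by simp
    qed
  qed
  have Zsum: "(\<Sum>i\<in>I. f i) \<in> Z" if "\<And>i. i \<in> I \<Longrightarrow> f i \<in> Z" for f :: "'n \<Rightarrow> real ^ 'n" and I
    using that by (induction I rule: infinite_finite_induct) (simp_all add: Z0 Zadd)
  have gen: "rep_root c i \<in> Z" for i
    unfolding Z_def using * rep_root_in_units by (simp add: sign_char_rep_root[OF P])
  have "m \<in> Z" if m: "m \<in> flag_units c" for m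
  proof -
    have int: "m $ i \<in> \<int>" for i using m by (simp add: flag_units_def flag_monoid_def)
    have "(\<Sum>i\<in>UNIV. (m $ i) *\<^sub>R rep_root c i) \<in> Z" by (intro Zsum Zint int gen)
    then show ?thesis using flag_units_expansion[OF c m] by simp
  qed
  then show "x \<in> chart_piece c P" using x by (auto simp: chart_piece_def Z_def)
qed

lemma chart_piece_disjoint:
  assumes c: "c \<in> flags" and P: "P \<subseteq> non_reps c" "Q \<subseteq> non_reps c" and ne: "P \<noteq> Q"
  shows "chart_piece c P \<inter> chart_piece c Q = {}"
proof (rule ccontr)
  assume "chart_piece c P \<inter> chart_piece c Q \<noteq> {}"
  then obtain x where x: "x \<in> chart_piece c P" "x \<in> chart_piece c Q" by blast
  have xr: "x \<in> real_chart c" using x(1) by (simp add: chart_piece_def)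
  have "i \<in> P \<longleftrightarrow> i \<in> Q" for i
  proof -
    have "0 < Re (x (rep_root c i)) * (if i \<in> P then -1 else 1)" "0 < Re (x (rep_root c i)) * (if i \<in> Q then -1 else 1)"
      using x chart_piece_iff[OF c P(1) xr] chart_piece_iff[OF c P(2) xr] by blast+
    then show ?thesis by (auto split: if_splits)
  qed
  then show False using ne by blast
qed

lemma real_chart_eq_Union_pieces:
  assumes c: "c \<in> flags"
  shows "real_chart c = (\<Union>P\<in>Pow (non_reps c). chart_piece c P)"
proof (intro subset_antisym subsetI)
  fix x assume x: "x \<in> real_chart c"
  \<comment> \<open>The generator of a representative is the zero vector, where \<open>x\<close> is
    1, so negative values occur only at non-representatives.\<close>
  define P where "P = {i. Re (x (rep_root c i)) < 0}"
  have nz: "Re (x (rep_root c i)) \<noteq> 0" for i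
  proof -
    have u: "rep_root c i \<in> flag_monoid c" "- rep_root c i \<in> flag_monoid c"
      using rep_root_in_units[of i c] flag_units_minus[of "rep_root c i" c] by (simp_all add: flag_units_sub del: minus_diff_eq)
    have "Re (x (rep_root c i)) * Re (x (- rep_root c i)) = Re (x (rep_root c i + - rep_root c i))"
      by (rule real_chart_Re_add[OF x u, symmetric])
    also have "\<dots> = 1" using x hom_space_0[of x "flag_monoid c"] by (simp add: real_chart_def)
    finally show ?thesis by auto
  qed
  have P: "P \<subseteq> non_reps c"
  proof
    fix i assume i: "i \<in> P"
    show "i \<in> non_reps c"
    proof (rule ccontr)
      assume "i \<notin> non_reps c"
      then have "Re (x (rep_root c i)) = 1" using x hom_space_0[of x "flag_monoid c"] by (simp add: non_reps_def real_chart_def)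
      then show False using i by (simp add: P_def)
    qed
  qed
  have "0 < Re (x (rep_root c i)) * (if i \<in> P then -1 else 1)" for i
    using nz[of i] by (auto simp: P_def)
  then have "x \<in> chart_piece c P" using chart_piece_iff[OF c P x] by blast
  then show "x \<in> (\<Union>P\<in>Pow (non_reps c). chart_piece c P)" using P by blast
qed (auto simp: chart_piece_def)

lemma openin_chart_piece:
  assumes c: "c \<in> flags" and P: "P \<subseteq> non_reps c"
  shows "openin (subtopology (flag_chart c) (real_chart c)) (chart_piece c P)"
proof -
  let ?Y = "subtopology (flag_chart c) (real_chart c)"
  have top: "topspace ?Y = real_chart c" by (auto simp: real_chart_def)
  have "openin ?Y {x \<in> topspace ?Y. x (rep_root c i) \<in> {z. 0 < Re z * (if i \<in> P then -1 else 1)}}" for i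
  proof (rule openin_continuous_map_preimage)
    show "continuous_map ?Y euclidean (\<lambda>x. x (rep_root c i))"
      by (intro continuous_map_from_subtopology continuous_map_hom_space_eval flag_units_sub rep_root_in_units)
    have "open {z. 0 < Re z * (if i \<in> P then -1 else 1)}"
      by (intro open_Collect_less continuous_intros)
    then show "openin euclidean {z. 0 < Re z * (if i \<in> P then -1 else 1)}" by simp
  qed
  then have "openin ?Y (\<Inter>i\<in>UNIV. {x \<in> topspace ?Y. x (rep_root c i) \<in> {z. 0 < Re z * (if i \<in> P then -1 else 1)}})"
    by (intro openin_INT2) auto
  also have "(\<Inter>i\<in>UNIV. {x \<in> topspace ?Y. x (rep_root c i) \<in> {z. 0 < Re z * (if i \<in> P then -1 else 1)}}) = chart_piece c P"
    unfolding top using chart_piece_iff[OF c P] by (auto simp: chart_piece_def)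
  finally show ?thesis .
qed

lemma in_chart_pieceI:
  fixes y :: "real ^ 'n::finite \<Rightarrow> real"
  assumes "y 0 = 1" "\<And>m m'. m \<in> flag_monoid c \<Longrightarrow> m' \<in> flag_monoid c \<Longrightarrow> y (m + m') = y m * y m'"
    and "\<And>m. m \<in> flag_units c \<Longrightarrow> 0 < y m * sign_char P m"
  shows "(\<lambda>m\<in>flag_monoid c. complex_of_real (y m)) \<in> chart_piece c P"
proof -
  let ?x = "\<lambda>m\<in>flag_monoid c. complex_of_real (y m)"
  have "?x \<in> topspace (flag_chart c)"
    unfolding in_hom_space_iff using assms(1,2) by (simp add: flag_monoid_0 flag_monoid_add)
  then have "?x \<in> real_chart c" by (simp add: real_chart_def)
  then show ?thesis using assms(3) by (simp add: chart_piece_def flag_units_sub)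
qed

lemma continuous_map_into_chart_piece:
  assumes "\<And>z. z \<in> topspace Z \<Longrightarrow> f z \<in> chart_piece c P"
    and "\<And>m. m \<in> flag_monoid c \<Longrightarrow> continuous_map Z euclidean (\<lambda>z. f z m)"
  shows "continuous_map Z (subtopology (flag_chart c) (chart_piece c P)) f"
  unfolding continuous_map_in_subtopology
proof
  show "f \<in> topspace Z \<rightarrow> chart_piece c P" using assms(1) by blast
  have "f z \<in> topspace (flag_chart c)" if "z \<in> topspace Z" for z
    using assms(1)[OF that] by (simp add: chart_piece_def real_chart_def)
  then show "continuous_map Z (flag_chart c) f"
    using assms(2) by (intro continuous_map_into_hom_space) auto
qed

text \<open>The pairing of \<open>m\<close> with \<open>flag_vec c\<close>, as a natural number so
  that it can be an exponent of 0; units are the elements of level 0.\<close>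

definition flag_level :: "'n::finite set set \<Rightarrow> real ^ 'n \<Rightarrow> nat" where
  "flag_level c m = nat \<lfloor>\<Sum>A\<in>c. part_sum m A\<rfloor>"

lemma of_nat_flag_level:
  assumes "m \<in> flag_monoid c"
  shows "real (flag_level c m) = (\<Sum>A\<in>c. part_sum m A)"
proof -
  have "(\<Sum>A\<in>c. part_sum m A) \<in> \<int>"
    using assms by (intro Ints_sum part_sum_Ints) (simp add: flag_monoid_def)
  moreover have "0 \<le> (\<Sum>A\<in>c. part_sum m A)"
    using assms by (intro sum_nonneg) (simp add: flag_monoid_def)
  ultimately show ?thesis unfolding flag_level_def by (elim Ints_cases) simp
qed

lemma flag_level_add:
  assumes "m \<in> flag_monoid c" "m' \<in> flag_monoid c"
  shows "flag_level c (m + m') = flag_level c m + flag_level c m'"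
proof -
  have "real (flag_level c (m + m')) = real (flag_level c m) + real (flag_level c m')"
    unfolding of_nat_flag_level[OF assms(1)] of_nat_flag_level[OF assms(2)]
      of_nat_flag_level[OF flag_monoid_add[OF assms]] by (simp add: part_sum_add sum.distrib)
  then show ?thesis by simp
qed

lemma flag_level_eq_0_iff:
  fixes c :: "'n::finite set set"
  assumes "m \<in> flag_monoid c"
  shows "flag_level c m = 0 \<longleftrightarrow> m \<in> flag_units c"
proof -
  have fin: "finite c" by (rule finite_subset[OF subset_UNIV]) simp
  have "flag_level c m = 0 \<longleftrightarrow> (\<Sum>A\<in>c. part_sum m A) = 0"
    using of_nat_flag_level[OF assms] by linarith
  also have "\<dots> \<longleftrightarrow> (\<forall>A\<in>c. part_sum m A = 0)"
    using assms fin by (intro sum_nonneg_eq_0_iff) (simp_all add: flag_monoid_def)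
  finally show ?thesis using assms by (simp add: flag_units_def)
qed

text \<open>
  The one-parameter subgroup of \<^term>\<open>flag_vec c\<close> contracts the chart onto its closed orbit, the absolute values
  on the orbit contract by powers.
\<close>

proposition contractible_chart_piece:
  fixes c :: "'n::finite set set" and P :: "'n set"
  shows "contractible_space (subtopology (flag_chart c) (chart_piece c P))"
    and "chart_piece c P \<noteq> {}"
proof -
  define Y where "Y = subtopology (flag_chart c) (chart_piece c P)"
  have topY: "topspace Y = chart_piece c P"
    by (auto simp: Y_def chart_piece_def real_chart_def)
  define s where "s = sign_char P"
  have s: "s m * s m = 1" for m :: "real ^ 'n" using sign_char_cases[of P m] by (auto simp: s_def)
  have s_add: "s (m + m') = s m * s m'" if "m \<in> flag_monoid c" "m' \<in> flag_monoid c" for m m'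
    unfolding s_def by (rule sign_char_add[OF that])
  have s_0: "s 0 = 1" by (simp add: s_def sign_char_0)
  have real: "x \<in> real_chart c" if "x \<in> chart_piece c P" for x
    using that by (simp add: chart_piece_def)
  have pos: "0 < Re (x m) * s m" if "x \<in> chart_piece c P" "m \<in> flag_units c" for x m
    using that by (simp add: chart_piece_def s_def)
  have Re_add: "Re (x (m + m')) = Re (x m) * Re (x m')"
    if "x \<in> chart_piece c P" "m \<in> flag_monoid c" "m' \<in> flag_monoid c" for x m m'
    by (rule real_chart_Re_add[OF real[OF that(1)] that(2,3)])
  have Re_0: "Re (x 0) = 1" if "x \<in> chart_piece c P" for x
    using real[OF that] hom_space_0[of x "flag_monoid c"] by (simp add: real_chart_def)
  \<comment> \<open>At time 1 the factor is \<open>0 ^ flag_level c m\<close>, which is 1 on units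
    and 0 on all other elements: the point has reached the closed orbit.\<close>
  define H1 where "H1 z = (\<lambda>m\<in>flag_monoid c. complex_of_real ((1 - fst z) ^ flag_level c m * Re (snd z m)))"
    for z :: "real \<times> (real ^ 'n \<Rightarrow> complex)"
  \<comment> \<open>On the units \<open>Re (x m) * s m\<close> is the absolute value of
    \<open>x m\<close>; its exponent runs from 1 to 0 while the sign is kept.\<close>
  define H2 where "H2 z = (\<lambda>m\<in>flag_monoid c. complex_of_real
      (if m \<in> flag_units c then s m * exp ((1 - fst z) * ln (Re (snd z m) * s m)) else 0))"
    for z :: "real \<times> (real ^ 'n \<Rightarrow> complex)"
  \<comment> \<open>The point of the closed orbit with absolute value 1 and the signs of
    \<open>P\<close>.\<close>
  define q where "q = (\<lambda>m\<in>flag_monoid c. complex_of_real (if m \<in> flag_units c then s m else 0))"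
  have level_0: "flag_level c 0 = 0" using flag_level_eq_0_iff[OF flag_monoid_0] flag_units_0 by blast
  have level_units: "flag_level c m = 0" if "m \<in> flag_units c" for m
    using flag_level_eq_0_iff[OF flag_units_sub[OF that]] that by blast
  have H1_in: "H1 z \<in> chart_piece c P" if z: "snd z \<in> chart_piece c P" for z
    unfolding H1_def
  proof (rule in_chart_pieceI)
    show "(1 - fst z) ^ flag_level c 0 * Re (snd z 0) = 1" by (simp add: level_0 Re_0[OF z])
    show "(1 - fst z) ^ flag_level c (m + m') * Re (snd z (m + m')) =
        (1 - fst z) ^ flag_level c m * Re (snd z m) * ((1 - fst z) ^ flag_level c m' * Re (snd z m'))"
      if "m \<in> flag_monoid c" "m' \<in> flag_monoid c" for m m'
      by (simp add: flag_level_add[OF that] Re_add[OF z that] power_add)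
    show "0 < (1 - fst z) ^ flag_level c m * Re (snd z m) * sign_char P m" if "m \<in> flag_units c" for m
      using pos[OF z that] by (simp add: level_units[OF that] s_def)
  qed
  have H2_in: "H2 z \<in> chart_piece c P" if z: "snd z \<in> chart_piece c P" for z
    unfolding H2_def
  proof (rule in_chart_pieceI)
    let ?y = "\<lambda>m. if m \<in> flag_units c then s m * exp ((1 - fst z) * ln (Re (snd z m) * s m)) else 0"
    show "?y 0 = 1" by (simp add: flag_units_0 Re_0[OF z] s_0)
    show "?y (m + m') = ?y m * ?y m'" if m: "m \<in> flag_monoid c" "m' \<in> flag_monoid c" for m m'
    proof (cases "m \<in> flag_units c \<and> m' \<in> flag_units c")
      case True
      have "Re (snd z (m + m')) * s (m + m') = (Re (snd z m) * s m) * (Re (snd z m') * s m')"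
        by (simp add: Re_add[OF z m] s_add[OF m])
      then have "ln (Re (snd z (m + m')) * s (m + m')) = ln (Re (snd z m) * s m) + ln (Re (snd z m') * s m')"
        using pos[OF z] True by (simp add: ln_mult_pos del: mult.assoc)
      then have "exp ((1 - fst z) * ln (Re (snd z (m + m')) * s (m + m'))) =
          exp ((1 - fst z) * ln (Re (snd z m) * s m)) * exp ((1 - fst z) * ln (Re (snd z m') * s m'))"
        by (simp only: distrib_left exp_add)
      then show ?thesis using True by (simp add: flag_units_add s_add[OF m])
    next
      case False
      \<comment> \<open>A sum in the monoid is a unit only if both summands are, so both sides are
        0.\<close>
      then show ?thesis using flag_units_add_iff[OF m] by auto
    qed
    show "0 < ?y m * sign_char P m" if "m \<in> flag_units c" for m
    proof -
      let ?e = "exp ((1 - fst z) * ln (Re (snd z m) * s m))"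
      have "?y m * sign_char P m = (s m * s m) * ?e" using that by (simp add: s_def mult_ac)
      then show ?thesis using s[of m] by simp
    qed
  qed
  have q_in: "q \<in> chart_piece c P"
    unfolding q_def
  proof (rule in_chart_pieceI)
    show "(if 0 \<in> flag_units c then s 0 else 0) = 1" by (simp add: flag_units_0 s_0)
    show "(if m + m' \<in> flag_units c then s (m + m') else 0) =
        (if m \<in> flag_units c then s m else 0) * (if m' \<in> flag_units c then s m' else 0)"
      if "m \<in> flag_monoid c" "m' \<in> flag_monoid c" for m m'
      using flag_units_add_iff[OF that] s_add[OF that] by auto
    show "0 < (if m \<in> flag_units c then s m else 0) * sign_char P m" if "m \<in> flag_units c" for m
      using that s[of m] by (simp add: s_def[symmetric])
  qed
  show "chart_piece c P \<noteq> {}" using q_in by blast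
  let ?Z = "prod_topology (top_of_set {0..1::real}) Y"
  have topZ: "snd z \<in> chart_piece c P" if "z \<in> topspace ?Z" for z using that by (auto simp: topY)
  have fst: "continuous_map ?Z euclidean fst"
    using continuous_map_fst[of "top_of_set {0..1::real}" Y] by (rule continuous_map_into_fulltopology)
  have snd: "continuous_map ?Z euclidean (\<lambda>z. snd z m)" if "m \<in> flag_monoid c" for m
  proof -
    have "continuous_map Y euclidean (\<lambda>x. x m)"
      unfolding Y_def by (intro continuous_map_from_subtopology continuous_map_hom_space_eval that)
    from continuous_map_compose[OF continuous_map_snd this] show ?thesis by (simp add: o_def)
  qed
  have H1_cont: "continuous_map ?Z (subtopology (flag_chart c) (chart_piece c P)) H1"
  proof (rule continuous_map_into_chart_piece)
    show "H1 z \<in> chart_piece c P" if "z \<in> topspace ?Z" for z by (rule H1_in[OF topZ[OF that]])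
    show "continuous_map ?Z euclidean (\<lambda>z. H1 z m)" if m: "m \<in> flag_monoid c" for m
    proof -
      have "continuous_on UNIV (\<lambda>p. complex_of_real ((1 - fst p) ^ flag_level c m * Re (snd p)))"
        by (intro continuous_intros)
      from continuous_map_compose_Pair[OF fst snd[OF m] UNIV_I this] show ?thesis
        using m by (simp add: H1_def)
    qed
  qed
  have H2_cont: "continuous_map ?Z (subtopology (flag_chart c) (chart_piece c P)) H2"
  proof (rule continuous_map_into_chart_piece)
    show "H2 z \<in> chart_piece c P" if "z \<in> topspace ?Z" for z by (rule H2_in[OF topZ[OF that]])
    show "continuous_map ?Z euclidean (\<lambda>z. H2 z m)" if m: "m \<in> flag_monoid c" for m
    proof (cases "m \<in> flag_units c")
      case True
      have "continuous_on {p. 0 < Re (snd p) * s m}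
          (\<lambda>p. complex_of_real (s m * exp ((1 - fst p) * ln (Re (snd p) * s m))))"
        by (intro continuous_intros) auto
      moreover have "(fst z, snd z m) \<in> {p. 0 < Re (snd p) * s m}" if "z \<in> topspace ?Z" for z
        using pos[OF topZ[OF that] True] by simp
      ultimately have "continuous_map ?Z euclidean
          (\<lambda>z. complex_of_real (s m * exp ((1 - fst (fst z, snd z m)) * ln (Re (snd (fst z, snd z m)) * s m))))"
        by (intro continuous_map_compose_Pair[OF fst snd[OF m]])
      then show ?thesis using m True by (simp add: H2_def)
    next
      case False
      then show ?thesis using m by (simp add: H2_def)
    qed
  qed
  have undef: "x m = undefined" if "x \<in> chart_piece c P" "m \<notin> flag_monoid c" for x m
    using real[OF that(1)] hom_space_extensional[of x "flag_monoid c"] that(2)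
    by (simp add: real_chart_def extensional_def)
  have H1_0: "H1 (0, x) = x" if x: "x \<in> chart_piece c P" for x
  proof
    fix m
    show "H1 (0, x) m = x m"
      using undef[OF x, of m] real_chart_Re[OF real[OF x], of m] by (cases "m \<in> flag_monoid c") (simp_all add: H1_def)
  qed
  \<comment> \<open>The two homotopies match: on units the exponential undoes the logarithm, and
    elsewhere the level is positive, so both values are 0.\<close>
  have H12: "H1 (1, x) = H2 (0, x)" if x: "x \<in> chart_piece c P" for x
  proof
    fix m
    show "H1 (1, x) m = H2 (0, x) m"
    proof (cases "m \<in> flag_units c")
      case True
      have "s m * exp (ln (Re (x m) * s m)) = s m * (Re (x m) * s m)" using pos[OF x True] by simp
      also have "\<dots> = Re (x m)" using s[of m] by (simp add: mult.commute mult.left_commute)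
      finally have "s m * exp (ln (Re (x m) * s m)) = Re (x m)" .
      then show ?thesis
        using True flag_units_sub[OF True] by (simp add: H1_def H2_def level_units del: exp_ln)
    next
      case False
      then have "m \<in> flag_monoid c \<Longrightarrow> flag_level c m \<noteq> 0" using flag_level_eq_0_iff[of m c] by simp
      then show ?thesis using False by (simp add: H1_def H2_def)
    qed
  qed
  have H2_1: "H2 (1, x) = q" for x by (rule ext) (simp add: H2_def q_def)
  have "homotopic_with (\<lambda>_. True) Y Y id (\<lambda>x. H1 (1, x))"
    unfolding homotopic_with[where P = "\<lambda>_. True", simplified]
    using H1_cont[folded Y_def] H1_0 topY by (intro exI[of _ H1]) auto
  moreover have "homotopic_with (\<lambda>_. True) Y Y (\<lambda>x. H1 (1, x)) (\<lambda>x. q)"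
    unfolding homotopic_with[where P = "\<lambda>_. True", simplified]
    using H2_cont[folded Y_def] H12 H2_1 topY by (intro exI[of _ H2]) auto
  ultimately have "homotopic_with (\<lambda>_. True) Y Y id (\<lambda>x. q)"
    by (rule homotopic_with_trans)
  then show "contractible_space (subtopology (flag_chart c) (chart_piece c P))"
    unfolding contractible_space_def Y_def by blast
qed

section \<open>The real locus\<close>

definition real_points :: "((real ^ 'n::finite) set \<times> (real ^ 'n \<Rightarrow> complex)) set set" where
  "real_points = {P. toric_conj (weight_lattice type_A_roots) P = P}"

lemma coxeter_toric_real_locus_type_A:
  "coxeter_toric_real_locus type_A_roots = subtopology flag_variety real_points"
  by (simp add: coxeter_toric_real_locus_def toric_real_locus_def flag_variety_def real_points_def)

text \<open>Conjugation preserves each chart and the chart map is injective, so a class fixed by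
  conjugation has a fixed representative in every chart that contains it.\<close>

lemma chart_point_real_iff:
  fixes c :: "'n::finite set set"
  assumes c: "c \<in> flags" and x: "x \<in> topspace (flag_chart c)"
  shows "chart_point c x \<in> real_points \<longleftrightarrow> x \<in> real_chart c"
proof -
  have cj: "flag_restrict c (cnj \<circ> x) \<in> topspace (flag_chart c)"
    using x by (auto simp: in_hom_space_iff flag_monoid_0 flag_monoid_add)
  have "chart_point c x \<in> real_points \<longleftrightarrow> chart_point c (flag_restrict c (cnj \<circ> x)) = chart_point c x"
    by (simp add: real_points_def toric_conj_chart_point[OF c x])
  also have "\<dots> \<longleftrightarrow> flag_restrict c (cnj \<circ> x) = x"
    by (rule inj_on_eq_iff[OF inj_on_chart_point[OF c] cj x])
  also have "\<dots> \<longleftrightarrow> (\<forall>m\<in>flag_monoid c. cnj (x m) = x m)"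
  proof
    assume eq: "flag_restrict c (cnj \<circ> x) = x"
    show "\<forall>m\<in>flag_monoid c. cnj (x m) = x m"
    proof
      fix m assume "m \<in> flag_monoid c"
      then show "cnj (x m) = x m" using fun_cong[OF eq, of m] by simp
    qed
  next
    assume "\<forall>m\<in>flag_monoid c. cnj (x m) = x m"
    then show "flag_restrict c (cnj \<circ> x) = x"
      using hom_space_extensional[OF x] by (auto simp: fun_eq_iff extensional_def)
  qed
  also have "\<dots> \<longleftrightarrow> x \<in> real_chart c"
    using x by (simp add: real_chart_def Reals_cnj_iff)
  finally show ?thesis .
qed

definition real_cell :: "'n::finite set set \<Rightarrow> ((real ^ 'n) set \<times> (real ^ 'n \<Rightarrow> complex)) set set" where
  "real_cell c = chart_point c ` real_chart c"

lemma real_chart_sub: "real_chart c \<subseteq> topspace (flag_chart c)"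
  by (auto simp: real_chart_def)

lemma chart_point_image_Int_real:
  assumes c: "c \<in> flags" and W: "W \<subseteq> topspace (flag_chart c)"
  shows "chart_point c ` W \<inter> real_points = chart_point c ` (W \<inter> real_chart c)"
proof (intro subset_antisym subsetI)
  fix p assume "p \<in> chart_point c ` W \<inter> real_points"
  then obtain x where "x \<in> W" "p = chart_point c x" "chart_point c x \<in> real_points" by blast
  then show "p \<in> chart_point c ` (W \<inter> real_chart c)"
    using chart_point_real_iff[OF c subsetD[OF W]] by blast
next
  fix p assume "p \<in> chart_point c ` (W \<inter> real_chart c)"
  then obtain x where "x \<in> W" "x \<in> real_chart c" "p = chart_point c x" by blast
  then show "p \<in> chart_point c ` W \<inter> real_points"
    using chart_point_real_iff[OF c subsetD[OF W]] by blast
qed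

lemma openin_real_image:
  fixes c :: "'n::finite set set"
  assumes c: "c \<in> flags" and K: "openin (subtopology (flag_chart c) (real_chart c)) K"
  shows "openin (subtopology flag_variety real_points) (chart_point c ` K)"
proof -
  obtain W where W: "openin (flag_chart c) W" "K = W \<inter> real_chart c"
    using K unfolding openin_subtopology by blast
  have "openin flag_variety (chart_point c ` W)"
    using open_map_chart_point[OF c] W(1) unfolding open_map_def by blast
  then have "openin (subtopology flag_variety real_points) (chart_point c ` W \<inter> real_points)"
    by (rule openin_subtopology_Int)
  then show ?thesis
    unfolding chart_point_image_Int_real[OF c openin_subset[OF W(1)]] W(2) .
qed

lemma chart_image_homeomorphic:
  fixes c :: "'n::finite set set"
  assumes c: "c \<in> flags" and K: "K \<subseteq> real_chart c"
  shows "subtopology (flag_chart c) K homeomorphic_space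
    subtopology (subtopology flag_variety real_points) (chart_point c ` K)"
proof -
  let ?f = "chart_point c"
  have Kt: "K \<subseteq> topspace (flag_chart c)" using K real_chart_sub by blast
  have "embedding_map (flag_chart c) flag_variety ?f"
    by (intro injective_open_imp_embedding_map continuous_map_chart_point open_map_chart_point inj_on_chart_point c)
  then have hm: "homeomorphic_map (flag_chart c) (subtopology flag_variety (?f ` topspace (flag_chart c))) ?f"
    by (simp add: embedding_map_def)
  have sub: "?f ` topspace (flag_chart c) \<subseteq> topspace flag_variety"
    unfolding topspace_flag_variety using c by blast
  have "homeomorphic_map (subtopology (flag_chart c) K)
      (subtopology (subtopology flag_variety (?f ` topspace (flag_chart c))) (?f ` K)) ?f"
  proof (rule homeomorphic_map_subtopologies[OF hm])
    have "topspace (flag_chart c) \<inter> K = K" using Kt by blast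
    moreover have "topspace (subtopology flag_variety (?f ` topspace (flag_chart c))) \<inter> ?f ` K = ?f ` K"
      unfolding topspace_subtopology using sub image_mono[OF Kt, of ?f] by blast
    ultimately show "?f ` (topspace (flag_chart c) \<inter> K) =
        topspace (subtopology flag_variety (?f ` topspace (flag_chart c))) \<inter> ?f ` K" by simp
  qed
  moreover have "subtopology (subtopology flag_variety (?f ` topspace (flag_chart c))) (?f ` K) = subtopology flag_variety (?f ` K)"
    unfolding subtopology_subtopology using image_mono[OF Kt, of ?f] by (simp add: Int_absorb1)
  moreover have "subtopology (subtopology flag_variety real_points) (?f ` K) = subtopology flag_variety (?f ` K)"
  proof -
    have "?f ` K \<subseteq> real_points"
      using chart_point_real_iff[OF c] K real_chart_sub by blast
    then show ?thesis unfolding subtopology_subtopology by (simp add: Int_absorb1)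
  qed
  ultimately show ?thesis by (metis homeomorphic_map_imp_homeomorphic_space)
qed

text \<open>A common point comes from the chart of \<open>c \<inter> d\<close>. Being real is a
  property of the class, so it may be tested in that chart as well.\<close>

lemma real_cell_Int:
  fixes c d :: "'n::finite set set"
  assumes c: "c \<in> flags" and d: "d \<in> flags"
  shows "real_cell c \<inter> real_cell d = real_cell (c \<inter> d)"
proof (intro subset_antisym subsetI)
  have cd: "c \<inter> d \<in> flags" by (rule flags_Int[OF c])
  fix p assume "p \<in> real_cell c \<inter> real_cell d"
  then obtain x y where x: "x \<in> real_chart c" "p = chart_point c x" and y: "y \<in> real_chart d" "p = chart_point d y"
    by (auto simp: real_cell_def)
  have xt: "x \<in> topspace (flag_chart c)" "y \<in> topspace (flag_chart d)" using x(1) y(1) by (simp_all add: real_chart_def)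
  obtain z where z: "z \<in> topspace (flag_chart (c \<inter> d))" "x = flag_restrict c z"
    using chart_point_eq_iff[OF c d xt] x(2) y(2) by auto
  have pz: "p = chart_point (c \<inter> d) z"
    unfolding x(2) z(2) by (rule chart_point_restrict[OF c _ z(1)]) simp
  moreover have "p \<in> real_points" unfolding x(2) using chart_point_real_iff[OF c xt(1)] x(1) by simp
  ultimately have "z \<in> real_chart (c \<inter> d)" using chart_point_real_iff[OF cd z(1)] by simp
  then show "p \<in> real_cell (c \<inter> d)" unfolding real_cell_def pz by (rule imageI)
next
  fix p assume "p \<in> real_cell (c \<inter> d)"
  then obtain z where z: "z \<in> real_chart (c \<inter> d)" "p = chart_point (c \<inter> d) z" by (auto simp: real_cell_def)
  have zt: "z \<in> topspace (flag_chart (c \<inter> d))" using z(1) by (simp add: real_chart_def)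
  have "p \<in> real_cell b" if b: "b \<in> flags" "c \<inter> d \<subseteq> b" for b
  proof -
    have "p = chart_point b (flag_restrict b z)"
      unfolding z(2) by (rule chart_point_restrict[OF b zt, symmetric])
    moreover have "flag_restrict b z \<in> real_chart b"
      using flag_restrict_in[OF b zt] z(1) flag_monoid_mono[OF b(2)] by (auto simp: real_chart_def)
    ultimately show ?thesis unfolding real_cell_def by (rule image_eqI)
  qed
  from this[OF c] this[OF d] show "p \<in> real_cell c \<inter> real_cell d" by simp
qed

lemma has_euler_char_real_cell:
  fixes c :: "'n::finite set set"
  assumes c: "c \<in> flags"
  shows "has_euler_char (subtopology (subtopology flag_variety real_points) (real_cell c)) {} (2 ^ (CARD('n) - 1 - card c))"
proof -
  let ?R = "subtopology flag_variety real_points"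
  have piece_sub: "chart_piece c P \<subseteq> real_chart c" for P by (auto simp: chart_piece_def)
  have "has_euler_char (subtopology ?R (\<Union>P\<in>Pow (non_reps c). chart_point c ` chart_piece c P)) {}
      (int (card (Pow (non_reps c))))"
  proof (rule has_euler_char_disjoint_contractible)
    fix P assume "P \<in> Pow (non_reps c)"
    then have P: "P \<subseteq> non_reps c" by simp
    show "openin ?R (chart_point c ` chart_piece c P) \<and> chart_point c ` chart_piece c P \<noteq> {} \<and>
        contractible_space (subtopology ?R (chart_point c ` chart_piece c P))"
      using openin_real_image[OF c openin_chart_piece[OF c P]] contractible_chart_piece[of c P]
        homeomorphic_space_contractibility[OF chart_image_homeomorphic[OF c piece_sub[of P]]] by simp
  next
    show "disjoint_family_on (\<lambda>P. chart_point c ` chart_piece c P) (Pow (non_reps c))"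
      unfolding disjoint_family_on_def
    proof (intro ballI impI)
      fix P Q assume PQ: "P \<in> Pow (non_reps c)" "Q \<in> Pow (non_reps c)" "P \<noteq> Q"
      have "chart_point c ` chart_piece c P \<inter> chart_point c ` chart_piece c Q = chart_point c ` (chart_piece c P \<inter> chart_piece c Q)"
        using piece_sub real_chart_sub by (intro inj_on_image_Int[OF inj_on_chart_point[OF c], symmetric]) blast+
      also have "\<dots> = {}" using chart_piece_disjoint[OF c, of P Q] PQ by simp
      finally show "chart_point c ` chart_piece c P \<inter> chart_point c ` chart_piece c Q = {}" .
    qed
  qed simp
  moreover have "(\<Union>P\<in>Pow (non_reps c). chart_point c ` chart_piece c P) = real_cell c"
    unfolding real_cell_def real_chart_eq_Union_pieces[OF c] by (simp only: image_UN)
  moreover have "int (card (Pow (non_reps c))) = 2 ^ (CARD('n) - 1 - card c)"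
    by (simp add: card_Pow card_non_reps[OF c])
  ultimately show ?thesis by simp
qed

proposition has_euler_char_real_locus:
  "has_euler_char (coxeter_toric_real_locus (type_A_roots :: (real ^ 'n::finite) set)) {}
    (\<Sum>c\<in>(flags :: 'n set set set). (-1) ^ card c * 2 ^ (CARD('n) - 1 - card c))"
proof -
  let ?R = "subtopology flag_variety real_points :: ((real ^ 'n) set \<times> (real ^ 'n \<Rightarrow> complex)) set topology"
  have "has_euler_char (subtopology ?R (\<Union>c\<in>flags. real_cell c)) {}
    (\<Sum>c\<in>(flags :: 'n set set set). (-1) ^ card c * 2 ^ (CARD('n) - 1 - card c))"
  proof (rule has_euler_char_fan)
    fix c :: "'n set set" assume c: "c \<in> flags"
    show "finite c \<and> card c \<le> CARD('n) - 1"
      using flags_in_card[OF finite c] by simp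
    have top: "topspace (subtopology (flag_chart c) (real_chart c)) = real_chart c"
      unfolding topspace_subtopology using real_chart_sub[of c] by blast
    have "openin (subtopology (flag_chart c) (real_chart c)) (real_chart c)"
      using openin_topspace[of "subtopology (flag_chart c) (real_chart c)"] unfolding top .
    then show "openin ?R (real_cell c)" unfolding real_cell_def by (rule openin_real_image[OF c])
    show "has_euler_char (subtopology ?R (real_cell c)) {} (2 ^ (CARD('n) - 1 - card c))"
      by (rule has_euler_char_real_cell[OF c])
  next
    show "real_cell c \<inter> real_cell d = real_cell (c \<inter> d)" if "c \<in> flags" "d \<in> flags" for c d :: "'n set set"
      by (rule real_cell_Int[OF that])
  qed (simp_all add: finite_flags_in flags_in_subset)
  moreover have "topspace ?R = (\<Union>c\<in>flags. real_cell c)"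
  proof -
    have "topspace ?R = (\<Union>c\<in>flags. chart_point c ` topspace (flag_chart c) \<inter> real_points)"
      by (simp add: topspace_flag_variety)
    also have "\<dots> = (\<Union>c\<in>flags. real_cell c)"
    proof (rule SUP_cong[OF refl])
      fix c :: "'n set set" assume c: "c \<in> flags"
      show "chart_point c ` topspace (flag_chart c) \<inter> real_points = real_cell c"
        unfolding chart_point_image_Int_real[OF c subset_refl] real_cell_def
        using real_chart_sub[of c] by (simp only: Int_absorb1)
    qed
    finally show ?thesis .
  qed
  ultimately show ?thesis
    unfolding coxeter_toric_real_locus_type_A by (metis subtopology_topspace)
qed

theorem mainTheorem3:
  fixes n :: nat
  assumes "n = CARD('n::finite)"
  defines "T \<equiv> coxeter_toric_real_locus (type_A_roots :: (real ^ 'n) set)"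
  shows "finite_total_cohomology T \<and>
    real_of_int (euler_characteristic T) =
      (if even n then 0 else (-1) ^ ((n - 1) div 2) * euler_number n)"
proof -
  let ?e = "\<Sum>c\<in>(flags :: 'n set set set). (-1) ^ card c * 2 ^ (CARD('n) - 1 - card c) :: int"
  have "finite_total_cohomology T \<and> euler_characteristic T = ?e"
    unfolding T_def by (rule euler_characteristic_eq[OF has_euler_char_real_locus])
  moreover have "real_of_int ?e = (if even n then 0 else (-1) ^ ((n - 1) div 2) * euler_number n)"
    using sum_flags_in_euler_number[of "UNIV :: 'n set"] assms(1) by simp
  ultimately show ?thesis by simp
qed

end
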